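(* Let $X$ be a path-connected based simplicial complex, let $\Sigma X$ be its suspension, and let $x_0\in\Sigma X$ be the basepoint. Then there is a homotopy equivalence $$\mathrm{Sub}_3(\Sigma X,x_0)\simeq \overline{\mathrm{SP}}^2(\Sigma X).$$
   Context: For a based space $(Y,x_0)$: $\mathrm{Sub}_3Y$ is the space of nonempty subsets of $Y$ of cardinality at most $3$, with the quotient topology from $Y^3$ (two triples are identified if and only if their sets of coordinates coincide), and $\mathrm{Sub}_3(Y,x_0)\subset \mathrm{Sub}_3Y$ is the subspace of subsets containing $x_0$. $\mathrm{SP}^2Y=Y^2/\mathfrak S_2$ is the symmetric square, $Y$ is embedded in it by $x\mapsto[x,x_0]$, and $\overline{\mathrm{SP}}^2(Y)=\mathrm{SP}^2Y/Y$ is the quotient (the reduced symmetric square). $\Sigma X$ is the (reduced) suspension. *)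

theory Defs
  imports "HOL-Analysis.Analysis"
begin

section \<open>Quotient spaces\<close>

text \<open>The image of \<open>f\<close> with the finest topology making \<open>f\<close> continuous: the quotient of \<open>X\<close> by the
  relation \<open>f x = f y\<close>.\<close>

definition quotient_topology :: "'a topology \<Rightarrow> ('a \<Rightarrow> 'b) \<Rightarrow> 'b topology" where
  "quotient_topology X f =
     topology (\<lambda>U. U \<subseteq> f ` topspace X \<and> openin X {x \<in> topspace X. f x \<in> U})"

lemma openin_quotient_topology:
  "openin (quotient_topology X f) U \<longleftrightarrow>
     U \<subseteq> f ` topspace X \<and> openin X {x \<in> topspace X. f x \<in> U}"
proof -
  have "istopology (\<lambda>U. U \<subseteq> f ` topspace X \<and> openin X {x \<in> topspace X. f x \<in> U})"
    unfolding istopology_def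
  proof (intro conjI allI impI)
    fix S T
    assume S: "S \<subseteq> f ` topspace X \<and> openin X {x \<in> topspace X. f x \<in> S}"
      and T: "T \<subseteq> f ` topspace X \<and> openin X {x \<in> topspace X. f x \<in> T}"
    have "{x \<in> topspace X. f x \<in> S \<inter> T} =
        {x \<in> topspace X. f x \<in> S} \<inter> {x \<in> topspace X. f x \<in> T}" by auto
    then show "openin X {x \<in> topspace X. f x \<in> S \<inter> T}" using S T by auto
    show "S \<inter> T \<subseteq> f ` topspace X" using S by auto
  next
    fix \<U>
    assume \<U>: "\<forall>U\<in>\<U>. U \<subseteq> f ` topspace X \<and> openin X {x \<in> topspace X. f x \<in> U}"
    have "{x \<in> topspace X. f x \<in> \<Union>\<U>} = (\<Union>U\<in>\<U>. {x \<in> topspace X. f x \<in> U})" by auto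
    then show "openin X {x \<in> topspace X. f x \<in> \<Union>\<U>}" using \<U> by auto
    show "\<Union>\<U> \<subseteq> f ` topspace X" using \<U> by auto
  qed
  then show ?thesis by (simp add: quotient_topology_def)
qed

lemma topspace_quotient_topology [simp]:
  "topspace (quotient_topology X f) = f ` topspace X"
proof
  show "topspace (quotient_topology X f) \<subseteq> f ` topspace X"
    using openin_topspace[of "quotient_topology X f"] unfolding openin_quotient_topology by blast
  have "{x \<in> topspace X. f x \<in> f ` topspace X} = topspace X" by auto
  then have "openin (quotient_topology X f) (f ` topspace X)"
    by (simp add: openin_quotient_topology)
  then show "f ` topspace X \<subseteq> topspace (quotient_topology X f)"
    by (rule openin_subset)
qed

lemma quotient_map_quotient_topology: "quotient_map X (quotient_topology X f) f"
  by (simp add: quotient_map_def openin_quotient_topology)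

text \<open>\<open>X/A\<close> for \<open>A \<noteq> {}\<close>, whose points are the classes of the relation collapsing \<open>A\<close>; the
  collapsed point is \<open>A\<close> itself.\<close>

definition collapse_class :: "'a set \<Rightarrow> 'a \<Rightarrow> 'a set" where
  "collapse_class A x = (if x \<in> A then A else {x})"

definition collapse_space :: "'a topology \<Rightarrow> 'a set \<Rightarrow> 'a set topology" where
  "collapse_space X A = quotient_topology X (collapse_class A)"


section \<open>Simplicial complexes\<close>

text \<open>No finiteness or local finiteness is imposed on the complex; only its simplices are finite.\<close>

definition abstract_simplicial_complex :: "'v set set \<Rightarrow> bool" where
  "abstract_simplicial_complex K \<longleftrightarrow>
     (\<forall>s\<in>K. finite s \<and> s \<noteq> {}) \<and> (\<forall>s\<in>K. \<forall>t. t \<noteq> {} \<and> t \<subseteq> s \<longrightarrow> t \<in> K)"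

text \<open>The points of a simplex are given by their barycentric coordinates.\<close>

definition closed_simplex :: "'v set \<Rightarrow> ('v \<Rightarrow> real) set" where
  "closed_simplex s = {t. (\<forall>v. 0 \<le> t v) \<and> (\<forall>v. v \<notin> s \<longrightarrow> t v = 0) \<and> (\<Sum>v\<in>s. t v) = 1}"

text \<open>The weak (coherent) topology: each closed simplex has its Euclidean topology (as a subspace
  of the product \<open>'v \<Rightarrow> real\<close>), and a set is open iff its trace on every closed simplex is open.\<close>

definition geometric_realization :: "'v set set \<Rightarrow> ('v \<Rightarrow> real) topology" where
  "geometric_realization K =
     topology (\<lambda>U. U \<subseteq> (\<Union>s\<in>K. closed_simplex s) \<and>
       (\<forall>s\<in>K. openin (top_of_set (closed_simplex s)) (U \<inter> closed_simplex s)))"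

lemma openin_geometric_realization:
  "openin (geometric_realization K) U \<longleftrightarrow>
     U \<subseteq> (\<Union>s\<in>K. closed_simplex s) \<and>
     (\<forall>s\<in>K. openin (top_of_set (closed_simplex s)) (U \<inter> closed_simplex s))"
proof -
  have "istopology (\<lambda>U. U \<subseteq> (\<Union>s\<in>K. closed_simplex s) \<and>
       (\<forall>s\<in>K. openin (top_of_set (closed_simplex s)) (U \<inter> closed_simplex s)))"
    unfolding istopology_def
  proof (intro conjI allI impI ballI)
    fix S T s
    assume S: "S \<subseteq> (\<Union>s\<in>K. closed_simplex s) \<and>
        (\<forall>s\<in>K. openin (top_of_set (closed_simplex s)) (S \<inter> closed_simplex s))"
      and T: "T \<subseteq> (\<Union>s\<in>K. closed_simplex s) \<and>
        (\<forall>s\<in>K. openin (top_of_set (closed_simplex s)) (T \<inter> closed_simplex s))"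
    show "S \<inter> T \<subseteq> (\<Union>s\<in>K. closed_simplex s)" using S by auto
    assume s: "s \<in> K"
    have "S \<inter> T \<inter> closed_simplex s = (S \<inter> closed_simplex s) \<inter> (T \<inter> closed_simplex s)" by auto
    then show "openin (top_of_set (closed_simplex s)) (S \<inter> T \<inter> closed_simplex s)"
      using S T s by (metis openin_Int)
  next
    fix \<U> s
    assume \<U>: "\<forall>U\<in>\<U>. U \<subseteq> (\<Union>s\<in>K. closed_simplex s) \<and>
        (\<forall>s\<in>K. openin (top_of_set (closed_simplex s)) (U \<inter> closed_simplex s))"
    show "\<Union>\<U> \<subseteq> (\<Union>s\<in>K. closed_simplex s)" using \<U> by blast
    assume s: "s \<in> K"
    have "\<Union>\<U> \<inter> closed_simplex s = (\<Union>U\<in>\<U>. U \<inter> closed_simplex s)" by auto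
    moreover have "openin (top_of_set (closed_simplex s)) (\<Union>U\<in>\<U>. U \<inter> closed_simplex s)"
      using \<U> s by (intro openin_Union) auto
    ultimately show "openin (top_of_set (closed_simplex s)) (\<Union>\<U> \<inter> closed_simplex s)"
      by simp
  qed
  then show ?thesis by (simp add: geometric_realization_def)
qed

lemma topspace_geometric_realization:
  "topspace (geometric_realization K) = (\<Union>s\<in>K. closed_simplex s)"
proof
  show "topspace (geometric_realization K) \<subseteq> (\<Union>s\<in>K. closed_simplex s)"
    using openin_topspace[of "geometric_realization K"]
    unfolding openin_geometric_realization by blast
  have "(\<Union>s\<in>K. closed_simplex s) \<inter> closed_simplex s = closed_simplex s" if "s \<in> K" for s :: "'a set"
    using that by auto
  then have "openin (geometric_realization K) (\<Union>s\<in>K. closed_simplex s)"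
    by (auto simp: openin_geometric_realization)
  then show "(\<Union>s\<in>K. closed_simplex s) \<subseteq> topspace (geometric_realization K)"
    by (rule openin_subset)
qed


section \<open>Suspension, finite subset spaces and symmetric squares\<close>

text \<open>The reduced suspension of \<open>(X, p)\<close>: in \<open>X \<times> [0,1]\<close> the subspace
  \<open>X \<times> {0,1} \<union> {p} \<times> [0,1]\<close> is collapsed to a point, which is the basepoint.\<close>

definition suspension_base :: "'a topology \<Rightarrow> 'a \<Rightarrow> ('a \<times> real) set" where
  "suspension_base X p = topspace X \<times> {0, 1} \<union> {p} \<times> {0..1}"

definition suspension :: "'a topology \<Rightarrow> 'a \<Rightarrow> ('a \<times> real) set topology" where
  "suspension X p =
     collapse_space (prod_topology X (top_of_set {0..1})) (suspension_base X p)"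

definition Sub3 :: "'a topology \<Rightarrow> 'a set topology" where
  "Sub3 Y = quotient_topology (prod_topology Y (prod_topology Y Y)) (\<lambda>(a, b, c). {a, b, c})"

definition Sub3_based :: "'a topology \<Rightarrow> 'a \<Rightarrow> 'a set topology" where
  "Sub3_based Y y0 = subtopology (Sub3 Y) {S. y0 \<in> S}"

text \<open>A point of \<open>SP\<^sup>2 Y\<close> is an orbit of the coordinate swap on \<open>Y \<times> Y\<close>.\<close>

definition sp2_class :: "'a \<Rightarrow> 'a \<Rightarrow> ('a \<times> 'a) set" where
  "sp2_class a b = {(a, b), (b, a)}"

definition SP2 :: "'a topology \<Rightarrow> ('a \<times> 'a) set topology" where
  "SP2 Y = quotient_topology (prod_topology Y Y) (\<lambda>(a, b). sp2_class a b)"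

definition reduced_SP2 :: "'a topology \<Rightarrow> 'a \<Rightarrow> ('a \<times> 'a) set set topology" where
  "reduced_SP2 Y y0 = collapse_space (SP2 Y) ((\<lambda>y. sp2_class y y0) ` topspace Y)"

lemma topspace_Sub3:
  "topspace (Sub3 Y) = {S. S \<subseteq> topspace Y \<and> S \<noteq> {} \<and> finite S \<and> card S \<le> 3}"
proof (intro equalityI subsetI)
  fix S assume "S \<in> topspace (Sub3 Y)"
  then obtain a b c where abc: "a \<in> topspace Y" "b \<in> topspace Y" "c \<in> topspace Y" "S = {a, b, c}"
    by (auto simp: Sub3_def)
  moreover have "card {a, b, c} \<le> 3"
    by (simp add: card_insert_if)
  ultimately show "S \<in> {S. S \<subseteq> topspace Y \<and> S \<noteq> {} \<and> finite S \<and> card S \<le> 3}" by auto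
next
  fix S assume S: "S \<in> {S. S \<subseteq> topspace Y \<and> S \<noteq> {} \<and> finite S \<and> card S \<le> 3}"
  then have "card S \<noteq> 0" by auto
  moreover have "card S \<le> 3" using S by simp
  ultimately have "card S = 1 \<or> card S = 2 \<or> card S = 3" by linarith
  then have "\<exists>a b c. S = {a, b, c}"
    by (metis card_1_singletonE card_2_iff card_3_iff insert_absorb2)
  then obtain a b c where "S = {a, b, c}" by blast
  with S show "S \<in> topspace (Sub3 Y)"
    by (auto simp: Sub3_def intro!: image_eqI[where x = "(a, b, c)"])
qed

end

theory Submission
  imports Defs
begin

text \<open>Write \<open>Y = \<Sigma>X\<close>. Both spaces are quotients of \<open>Y \<times> Y\<close>, by \<open>(a, b) \<mapsto> {x\<^sub>0, a, b}\<close> and by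
  \<open>(a, b) \<mapsto> [a, b]\<close>. Beyond the coordinate swap, the two relations identify only points of
  the set \<open>A\<close> of pairs \<open>((x, s), (x, s'))\<close> with a common \<open>X\<close>-coordinate, since \<open>A\<close> contains the
  diagonal and both axes. So the images \<open>E\<close> of \<open>A\<close> have the same complement and the same collapse, and
  it suffices that in each space some homotopy from the identity contracts \<open>E\<close> within itself. The image
  is \<open>X \<and> D\<close>, where \<open>D\<close> is a disc for the reduced symmetric square and the dunce hat
  \<open>Sub\<^sub>3(S\<^sup>1, 1)\<close> for the finite subset space; both contract. To spread the contraction over a
  neighbourhood of \<open>A\<close>, nearby points \<open>x, x'\<close> of the complex are first moved to a common point,
  the normalised minimum of their barycentric coordinates.\<close>

section \<open>Spaces with a common collapse\<close>

text \<open>The obstacle is point-set. The complex is arbitrary, so the product topology on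
  \<open>X \<times> X\<close> need not be coherent with its cells, the square of the collapse onto Y
  need not be a quotient map, and homotopy extension for a subcomplex is not at hand. The
  contraction of E is therefore spread by explicit formulas, which have two features. Maps out of
  \<open>Y \<times> Y\<close> are given on pairs of points of the cylinder and are constant while
  one point is near the basepoint; a preliminary squeezing, which exists on Y itself, makes this
  possible. Maps into X from products are built from coordinates, hence continuous only for
  pointwise convergence, and a truncation \<open>g\<close> with locally finite supports carries them
  back to the weak topology. This is why points are merged only after squeezing: \<open>m\<close>
  starts at \<open>g\<close>, not at the identity. The heights in the suspension are never merged:
  once the X-coordinates agree, the pair lies in A whatever its heights are, and a contraction of
  the triangle of ordered heights takes over, damped to zero away from A.\<close>

abbreviation unit_interval :: "real topology" where
  "unit_interval \<equiv> top_of_set {0..1}"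

lemma continuous_map_comp:
  assumes "continuous_map Y Z g" "continuous_map X Y f"
  shows "continuous_map X Z (\<lambda>x. g (f x))"
  using continuous_map_compose[OF assms(2,1)] by (simp add: o_def)

text \<open>The interval is locally compact and Hausdorff, so homotopies descend along any quotient
  map; the square of a quotient map admits no such argument in general.\<close>

lemma quotient_map_unit_interval_prod:
  assumes "quotient_map X Y f"
  shows "quotient_map (prod_topology unit_interval X) (prod_topology unit_interval Y) (\<lambda>(t, x). (t, f x))"
proof (rule quotient_map_prod_right[OF _ _ assms])
  show "locally_compact_space unit_interval"
    by (metis compact_Icc compact_imp_locally_compact_space compact_space_subtopology compactin_euclidean_iff)
  show "Hausdorff_space unit_interval \<or> regular_space unit_interval"
    by (simp add: Hausdorff_space_subtopology)
qed

lemma quotient_map_lift: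
  assumes "quotient_map X Y f" "continuous_map X Z h"
    and "\<And>x y. \<lbrakk>x \<in> topspace X; y \<in> topspace X; f x = f y\<rbrakk> \<Longrightarrow> h x = h y"
  shows "\<exists>g. continuous_map Y Z g \<and> (\<forall>x\<in>topspace X. g (f x) = h x)"
proof -
  obtain g where "continuous_map Y Z g" "\<And>x. x \<in> topspace X \<Longrightarrow> g (f x) = h x"
    using quotient_map_lift_exists[OF assms(1,2)] assms(3) by metis
  then show ?thesis by (intro exI[of _ g]) simp
qed

lemma homotopy_through_quotient:
  assumes q: "quotient_map Z V q"
    and H: "continuous_map (prod_topology unit_interval Z) W H"
    and eq: "\<And>t z z'. \<lbrakk>t \<in> {0..1}; z \<in> topspace Z; z' \<in> topspace Z; q z = q z'\<rbrakk> \<Longrightarrow> H (t, z) = H (t, z')"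
  shows "\<exists>F. continuous_map (prod_topology unit_interval V) W F \<and>
    (\<forall>t\<in>{0..1}. \<forall>z\<in>topspace Z. F (t, q z) = H (t, z))"
proof -
  have *: "H u = H v" if "u \<in> topspace (prod_topology unit_interval Z)"
      "v \<in> topspace (prod_topology unit_interval Z)"
      "(\<lambda>(t, x). (t, q x)) u = (\<lambda>(t, x). (t, q x)) v" for u v
    using that eq[of "fst u" "snd u" "snd v"] by (cases u; cases v) simp
  obtain F where F: "continuous_map (prod_topology unit_interval V) W F"
      "\<forall>u\<in>topspace (prod_topology unit_interval Z). F ((\<lambda>(t, x). (t, q x)) u) = H u"
    using quotient_map_lift[OF quotient_map_unit_interval_prod[OF q] H] * by blast
  have "F (t, q z) = H (t, z)" if "t \<in> {0..1}" "z \<in> topspace Z" for t z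
    using F(2)[rule_format, of "(t, z)"] that by simp
  with F(1) show ?thesis by (intro exI[of _ F] conjI ballI)
qed

text \<open>\<open>homotopic_with\<close> demands its end conditions at every argument. Here they
  are checked on the space alone, which suffices once \<open>P\<close> depends only on values there,
  the last premise.\<close>

lemma homotopic_withI:
  assumes "continuous_map (prod_topology unit_interval X) Y h"
    and "\<And>x. x \<in> topspace X \<Longrightarrow> h (0, x) = f x"
    and "\<And>x. x \<in> topspace X \<Longrightarrow> h (1, x) = g x"
    and "\<And>t. t \<in> {0..1} \<Longrightarrow> P (\<lambda>x. h (t, x))"
    and "\<And>h k. (\<And>x. x \<in> topspace X \<Longrightarrow> h x = k x) \<Longrightarrow> (P h \<longleftrightarrow> P k)"
  shows "homotopic_with P X Y f g"
proof -
  have "homotopic_with P X Y f g \<longleftrightarrow> (\<exists>h. continuous_map (prod_topology unit_interval X) Y h \<and>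
              (\<forall>x \<in> topspace X. h(0,x) = f x) \<and> (\<forall>x \<in> topspace X. h(1,x) = g x) \<and>
              (\<forall>t \<in> {0..1}. P(\<lambda>x. h(t, x))))"
    by (rule homotopic_with) (fact assms(5))
  moreover have "\<exists>h. continuous_map (prod_topology unit_interval X) Y h \<and>
              (\<forall>x \<in> topspace X. h(0,x) = f x) \<and> (\<forall>x \<in> topspace X. h(1,x) = g x) \<and>
              (\<forall>t \<in> {0..1}. P(\<lambda>x. h(t, x)))"
    using assms(1-4) by (intro exI[of _ h] conjI ballI)
  ultimately show ?thesis by (rule iffD2)
qed

lemma continuous_map_homotopy_at:
  assumes "continuous_map (prod_topology unit_interval X) Y h" "t \<in> {0..1}"
  shows "continuous_map X Y (\<lambda>x. h (t, x))"
  using continuous_map_o_Pair[OF assms(1), of t] assms(2) by (simp add: o_def)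

text \<open>Points identified by \<open>qV\<close> but not by \<open>qW\<close> lie in
  \<open>A\<close>, and \<open>l\<close> sends the image of \<open>A\<close> to one point; so
  \<open>l \<circ> qW\<close> is constant on the fibres of \<open>qV\<close>.\<close>

lemma collapse_map_exists:
  assumes qV: "quotient_map Z V qV" and qW: "quotient_map Z W qW"
    and VW: "\<forall>z\<in>topspace Z. \<forall>z'\<in>topspace Z. qV z = qV z' \<longrightarrow> qW z = qW z' \<or> z \<in> A \<and> z' \<in> A"
    and l: "continuous_map W W l" "l ` qW ` A \<subseteq> {d}"
  shows "\<exists>f. continuous_map V W f \<and> (\<forall>z\<in>topspace Z. f (qV z) = l (qW z))"
proof -
  have "continuous_map Z W (\<lambda>z. l (qW z))"
    by (rule continuous_map_comp[OF l(1) quotient_imp_continuous_map[OF qW]])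
  moreover have "l (qW z) = l (qW z')"
    if "z \<in> topspace Z" "z' \<in> topspace Z" "qV z = qV z'" for z z'
    using VW[rule_format, OF that] l(2) by auto
  ultimately show ?thesis
    by (rule quotient_map_lift[OF qV])
qed

text \<open>For the homotopy \<open>L\<close> from \<open>id\<close> to \<open>l\<close>, the point
  \<open>g (L (t, qW z))\<close> depends only on \<open>qV z\<close>: \<open>L\<close> keeps the
  image of \<open>A\<close> inside itself, and \<open>g\<close> is constant there. On
  \<open>V\<close> this runs from \<open>k\<close> to \<open>g \<circ> f\<close>, and
  \<open>k\<close> is homotopic to \<open>id\<close>.\<close>

lemma collapse_maps_inverse:
  assumes qV: "quotient_map Z V qV" and qW: "quotient_map Z W qW" and A: "A \<subseteq> topspace Z"
    and VW: "\<forall>z\<in>topspace Z. \<forall>z'\<in>topspace Z. qV z = qV z' \<longrightarrow> qW z = qW z' \<or> z \<in> A \<and> z' \<in> A"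
    and k: "homotopic_with P V V id k" "k ` qV ` A \<subseteq> {c}"
    and l: "homotopic_with (\<lambda>f. f ` qW ` A \<subseteq> qW ` A) W W id l"
    and f: "\<And>z. z \<in> topspace Z \<Longrightarrow> f (qV z) = l (qW z)"
    and g: "continuous_map W V g" "\<And>z. z \<in> topspace Z \<Longrightarrow> g (qW z) = k (qV z)"
  shows "homotopic_with (\<lambda>_. True) V V (g \<circ> f) id"
proof -
  obtain L where "continuous_map (prod_topology unit_interval W) W L \<and>
      (\<forall>x. L (0, x) = id x) \<and> (\<forall>x. L (1, x) = l x) \<and>
      (\<forall>t\<in>{0..1}. (\<lambda>x. L (t, x)) ` qW ` A \<subseteq> qW ` A)"
    using l unfolding homotopic_with_def by (rule exE)
  then have L: "continuous_map (prod_topology unit_interval W) W L"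
    and L0: "L (0, x) = x" and L1: "L (1, x) = l x"
    and LA: "t \<in> {0..1} \<Longrightarrow> (\<lambda>x. L (t, x)) ` qW ` A \<subseteq> qW ` A" for x t
    by simp_all
  have "continuous_map (prod_topology unit_interval Z) V (\<lambda>u. g (L ((\<lambda>(t, z). (t, qW z)) u)))"
    by (intro continuous_map_comp[OF g(1)] continuous_map_comp[OF L]
        quotient_imp_continuous_map[OF quotient_map_unit_interval_prod[OF qW]])
  then have cont: "continuous_map (prod_topology unit_interval Z) V (\<lambda>(t, z). g (L (t, qW z)))"
    by (simp add: case_prod_unfold)
  have gA: "g (qW z) = c" if "z \<in> A" for z
    using that g(2)[of z] k(2) A by auto
  have eq: "(\<lambda>(t, z). g (L (t, qW z))) (t, z) = (\<lambda>(t, z). g (L (t, qW z))) (t, z')"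
    if t: "t \<in> {0..1}" and z: "z \<in> topspace Z" "z' \<in> topspace Z" "qV z = qV z'" for t z z'
  proof (cases "qW z = qW z'")
    case False
    then have "z \<in> A" "z' \<in> A" using VW[rule_format, OF z] by auto
    then have "L (t, qW z) \<in> qW ` A" "L (t, qW z') \<in> qW ` A" using LA[OF t] by auto
    then show ?thesis using gA by auto
  qed simp
  obtain F where F: "continuous_map (prod_topology unit_interval V) V F"
    and F_eq: "\<forall>t\<in>{0..1}. \<forall>z\<in>topspace Z. F (t, qV z) = g (L (t, qW z))"
    using homotopy_through_quotient[OF qV cont] eq unfolding case_prod_conv by blast
  have surj: "\<exists>z\<in>topspace Z. v = qV z" if "v \<in> topspace V" for v
    using that quotient_imp_surjective_map[OF qV] by blast
  have "homotopic_with (\<lambda>_. True) V V k (g \<circ> f)"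
  proof (rule homotopic_withI[OF F])
    show "F (0, v) = k v" if "v \<in> topspace V" for v
      using surj[OF that] F_eq g(2) L0 by auto
    show "F (1, v) = (g \<circ> f) v" if "v \<in> topspace V" for v
      using surj[OF that] F_eq f L1 by auto
  qed auto
  moreover have "homotopic_with (\<lambda>_. True) V V id k"
    using k(1) by (rule homotopic_with_mono) simp
  ultimately show ?thesis
    by (metis homotopic_with_symD homotopic_with_trans)
qed

text \<open>For a single quotient map this is the equivalence of \<open>V\<close> with \<open>V/E\<close> for a subspace \<open>E\<close> that
  some homotopy of \<open>V\<close> contracts within itself; here \<open>V\<close> and \<open>W\<close> have the same quotient \<open>Z/A\<close>.\<close>

lemma homotopy_equivalent_space_same_collapse:
  assumes qV: "quotient_map Z V qV" and qW: "quotient_map Z W qW" and A: "A \<subseteq> topspace Z"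
    and VW: "\<forall>z\<in>topspace Z. \<forall>z'\<in>topspace Z. qV z = qV z' \<longrightarrow> qW z = qW z' \<or> z \<in> A \<and> z' \<in> A"
    and WV: "\<forall>z\<in>topspace Z. \<forall>z'\<in>topspace Z. qW z = qW z' \<longrightarrow> qV z = qV z' \<or> z \<in> A \<and> z' \<in> A"
    and k: "homotopic_with (\<lambda>f. f ` qV ` A \<subseteq> qV ` A) V V id k" "k ` qV ` A \<subseteq> {c}"
    and l: "homotopic_with (\<lambda>f. f ` qW ` A \<subseteq> qW ` A) W W id l" "l ` qW ` A \<subseteq> {d}"
  shows "V homotopy_equivalent_space W"
proof -
  have kl: "continuous_map V V k" "continuous_map W W l"
    using k(1) l(1) homotopic_with_imp_continuous_maps by blast+
  obtain f where f: "continuous_map V W f" "\<And>z. z \<in> topspace Z \<Longrightarrow> f (qV z) = l (qW z)"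
    using collapse_map_exists[OF qV qW VW kl(2) l(2)] by metis
  obtain g where g: "continuous_map W V g" "\<And>z. z \<in> topspace Z \<Longrightarrow> g (qW z) = k (qV z)"
    using collapse_map_exists[OF qW qV WV kl(1) k(2)] by metis
  show ?thesis
    unfolding homotopy_equivalent_space_def
    using f(1) g(1) collapse_maps_inverse[OF qV qW A VW k l(1) f(2) g]
      collapse_maps_inverse[OF qW qV A WV l k(1) g(2) f] by (intro exI conjI)
qed

section \<open>Reduced suspensions of equiconnected spaces\<close>

definition clamp01 :: "real \<Rightarrow> real" where
  "clamp01 x = max 0 (min 1 x)"

lemma clamp01_range [simp]: "0 \<le> clamp01 x" "clamp01 x \<le> 1"
  by (auto simp: clamp01_def)

lemma clamp01_eq [simp]: "x \<le> 0 \<Longrightarrow> clamp01 x = 0" "1 \<le> x \<Longrightarrow> clamp01 x = 1"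
  by (auto simp: clamp01_def)

lemma continuous_map_clamp01:
  assumes "continuous_map X euclideanreal f"
  shows "continuous_map X euclideanreal (\<lambda>x. clamp01 (f x))"
  unfolding clamp01_def by (intro continuous_intros assms)

lemma continuous_map_fst':
  assumes "continuous_map Z (prod_topology X Y) f"
  shows "continuous_map Z X (\<lambda>z. fst (f z))"
  using continuous_map_fst_of[OF assms] by (simp add: o_def)

lemma continuous_map_snd':
  assumes "continuous_map Z (prod_topology X Y) f"
  shows "continuous_map Z Y (\<lambda>z. snd (f z))"
  using continuous_map_snd_of[OF assms] by (simp add: o_def)

lemma continuous_map_into_unit_interval:
  "continuous_map X unit_interval f \<longleftrightarrow>
    continuous_map X euclideanreal f \<and> (\<forall>x\<in>topspace X. 0 \<le> f x \<and> f x \<le> 1)"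
  by (auto simp: continuous_map_in_subtopology)

lemma continuous_map_projections:
  "continuous_map (prod_topology A B) A (\<lambda>z. fst z)"
  "continuous_map (prod_topology A B) B (\<lambda>z. snd z)"
  "continuous_map (prod_topology T (prod_topology A B)) A (\<lambda>z. fst (snd z))"
  "continuous_map (prod_topology T (prod_topology A B)) B (\<lambda>z. snd (snd z))"
  by (auto intro: continuous_map_fst continuous_map_snd continuous_map_fst' continuous_map_snd')

lemmas continuous_map_rules = continuous_map_real_mult continuous_map_add continuous_map_diff
  continuous_map_real_max continuous_map_real_min continuous_map_clamp01 continuous_map_pairedI
  continuous_map_projections continuous_map_id[unfolded id_def]

lemma continuous_map_unit_interval_real:
  assumes "continuous_map X unit_interval f"
  shows "continuous_map X euclideanreal f"
  using assms by (simp add: continuous_map_into_unit_interval)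

text \<open>\<open>w\<close> and \<open>d\<close> measure the distance from \<open>p\<close> and from the diagonal, \<open>r\<close> squeezes a neighbourhood of
  \<open>p\<close> onto \<open>p\<close>, and \<open>m (\<cdot>, x, y)\<close>, \<open>m (\<cdot>, y, x)\<close> move the squeezed points to a common
  point if \<open>x\<close> and \<open>y\<close> are close.\<close>

locale equiconnected =
  fixes X :: "'a topology" and p :: 'a and r :: "real \<times> 'a \<Rightarrow> 'a" and w :: "'a \<Rightarrow> real"
    and d :: "'a \<times> 'a \<Rightarrow> real" and m :: "real \<times> 'a \<times> 'a \<Rightarrow> 'a"
  assumes p: "p \<in> topspace X"
    and r: "continuous_map (prod_topology unit_interval X) X r"
    and r_0: "x \<in> topspace X \<Longrightarrow> r (0, x) = x"
    and r_p: "t \<in> {0..1} \<Longrightarrow> r (t, p) = p"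
    and w: "continuous_map X euclideanreal w"
    and w_nonneg: "x \<in> topspace X \<Longrightarrow> 0 \<le> w x"
    and w_0_iff: "x \<in> topspace X \<Longrightarrow> w x = 0 \<longleftrightarrow> x = p"
    and r_1: "\<lbrakk>x \<in> topspace X; w x \<le> 1/3\<rbrakk> \<Longrightarrow> r (1, x) = p"
    and d: "continuous_map (prod_topology X X) euclideanreal d"
    and d_self: "x \<in> topspace X \<Longrightarrow> d (x, x) = 0"
    and d_commute: "\<lbrakk>x \<in> topspace X; y \<in> topspace X\<rbrakk> \<Longrightarrow> d (x, y) = d (y, x)"
    and m: "continuous_map (prod_topology unit_interval (prod_topology X X)) X m"
    and m_0: "\<lbrakk>x \<in> topspace X; y \<in> topspace X\<rbrakk> \<Longrightarrow> m (0, x, y) = r (1, x)"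
    and m_self: "\<lbrakk>u \<in> {0..1}; x \<in> topspace X\<rbrakk> \<Longrightarrow> m (u, x, x) = r (1, x)"
    and m_1: "\<lbrakk>x \<in> topspace X; y \<in> topspace X; d (x, y) \<le> 1\<rbrakk> \<Longrightarrow> m (1, x, y) = m (1, y, x)"
    and m_p: "\<lbrakk>u \<in> {0..1}; x \<in> topspace X; y \<in> topspace X; w x \<le> 1/3\<rbrakk> \<Longrightarrow> m (u, x, y) = p"
begin

section \<open>The collapse of the cylinder onto the suspension\<close>

abbreviation C :: "('a \<times> real) topology" where
  "C \<equiv> prod_topology X unit_interval"

abbreviation base :: "('a \<times> real) set" where
  "base \<equiv> suspension_base X p"

abbreviation Y :: "('a \<times> real) set topology" where
  "Y \<equiv> suspension X p"

abbreviation \<kappa> :: "'a \<times> real \<Rightarrow> ('a \<times> real) set" where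
  "\<kappa> \<equiv> collapse_class base"

text \<open>A distance from \<open>base\<close>. The factor 9 turns the level 1/3, at which
  squeezing reaches the basepoint, into 3, and leaves the levels 1 and 2 below it for cut-off
  functions.\<close>

definition \<eta> :: "'a \<times> real \<Rightarrow> real" where
  "\<eta> a = 9 * min (snd a) (min (1 - snd a) (w (fst a)))"

lemma continuous_map_w: "continuous_map Z X f \<Longrightarrow> continuous_map Z euclideanreal (\<lambda>z. w (f z))"
  by (rule continuous_map_comp[OF w])

lemma continuous_map_\<eta>:
  assumes "continuous_map Z C f"
  shows "continuous_map Z euclideanreal (\<lambda>z. \<eta> (f z))"
  unfolding \<eta>_def
  by (intro continuous_map_rules continuous_map_w continuous_map_fst'[OF assms] continuous_map_canonical_const
      continuous_map_unit_interval_real[OF continuous_map_snd'[OF assms]])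

lemma \<eta>_0_iff:
  assumes "a \<in> topspace C"
  shows "\<eta> a = 0 \<longleftrightarrow> a \<in> base"
proof -
  obtain x s where a: "a = (x, s)" "x \<in> topspace X" "0 \<le> s" "s \<le> 1" using assms by auto
  have "\<eta> a = 0 \<longleftrightarrow> s = 0 \<or> s = 1 \<or> w x = 0"
    using a w_nonneg[of x] by (auto simp: \<eta>_def min_def split: if_splits)
  then show ?thesis using a w_0_iff[of x] by (auto simp: suspension_base_def)
qed

lemma base_subset: "base \<subseteq> topspace C"
  using p by (auto simp: suspension_base_def)

lemma p0: "(p, 0) \<in> topspace C" "(p, 0) \<in> base" "\<eta> (p, 0) = 0"
  using p \<eta>_0_iff[of "(p, 0)"] by (auto simp: suspension_base_def)

lemma \<kappa>_eq_base: "a \<in> topspace C \<Longrightarrow> \<kappa> a = base \<longleftrightarrow> \<eta> a = 0"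
proof -
  \<comment> \<open>Points of \<open>Y\<close> are the set \<open>base\<close> and singletons; two
    distinct elements of \<open>base\<close> keep these apart.\<close>
  have "(p, 0) \<in> base" "(p, 1) \<in> base" using p by (auto simp: suspension_base_def)
  then have "base \<noteq> {a}" by fastforce
  then show "a \<in> topspace C \<Longrightarrow> ?thesis" using \<eta>_0_iff[of a] by (auto simp: collapse_class_def)
qed

lemma \<kappa>_eq_iff:
  assumes "a \<in> topspace C" "b \<in> topspace C"
  shows "\<kappa> a = \<kappa> b \<longleftrightarrow> a = b \<or> \<eta> a = 0 \<and> \<eta> b = 0"
proof -
  have "\<kappa> c = (if \<eta> c = 0 then base else {c})" if "c \<in> topspace C" for c
    using \<eta>_0_iff[OF that] by (simp add: collapse_class_def)
  with assms show ?thesis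
    using \<kappa>_eq_base[of a] \<kappa>_eq_base[of b] by (auto split: if_splits simp del: topspace_prod_topology)
qed

lemma quotient_\<kappa>: "quotient_map C Y \<kappa>"
  unfolding suspension_def collapse_space_def by (rule quotient_map_quotient_topology)

lemma topspace_Y: "topspace Y = \<kappa> ` topspace C"
  using quotient_imp_surjective_map[OF quotient_\<kappa>] by simp

lemma \<kappa>_in_Y: "a \<in> topspace C \<Longrightarrow> \<kappa> a \<in> topspace Y"
  unfolding topspace_Y by (rule imageI)

lemma base_in_Y: "base \<in> topspace Y"
  using \<kappa>_in_Y[OF p0(1)] \<kappa>_eq_base[OF p0(1)] p0(3) by simp

lemma continuous_\<kappa>: "continuous_map C Y \<kappa>"
  by (rule quotient_imp_continuous_map[OF quotient_\<kappa>])

text \<open>A section of \<kappa>, continuous off the basepoint but in general not at it; the value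
  over the basepoint is an arbitrary choice in \<open>base\<close>.\<close>

definition rep :: "('a \<times> real) set \<Rightarrow> 'a \<times> real" where
  "rep y = (if y = base then (p, 0) else the_elem y)"

lemma rep_\<kappa>: "a \<in> topspace C \<Longrightarrow> rep (\<kappa> a) = (if \<eta> a = 0 then (p, 0) else a)"
  using \<kappa>_eq_base[of a] \<eta>_0_iff[of a] by (simp add: rep_def) (simp add: collapse_class_def)

lemma rep_in_C: "y \<in> topspace Y \<Longrightarrow> rep y \<in> topspace C"
  and \<kappa>_rep: "y \<in> topspace Y \<Longrightarrow> \<kappa> (rep y) = y"
proof -
  assume "y \<in> topspace Y"
  then obtain a where a: "a \<in> topspace C" "y = \<kappa> a" unfolding topspace_Y by (rule imageE)
  show "rep y \<in> topspace C" "\<kappa> (rep y) = y"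
    using a(1) p0 \<kappa>_eq_iff[OF p0(1) a(1)] unfolding a(2) rep_\<kappa>[OF a(1)] by (simp_all split: if_splits)
qed

lemma openin_\<eta>: "open U \<Longrightarrow> openin C {a \<in> topspace C. \<eta> a \<in> U}"
  using openin_continuous_map_preimage[OF continuous_map_\<eta>[OF continuous_map_id[unfolded id_def]]] by simp

text \<open>\<eta> has the single value 0 on \<open>base\<close>, so it factors through \<kappa> as
  a continuous function on \<open>Y\<close>.\<close>

lemma openin_Y_\<eta>:
  assumes "open U" shows "openin Y {y \<in> topspace Y. \<eta> (rep y) \<in> U}"
proof -
  have "{a \<in> topspace C. \<kappa> a \<in> {y \<in> topspace Y. \<eta> (rep y) \<in> U}} = {a \<in> topspace C. \<eta> a \<in> U}"
    using rep_\<kappa> p0(3) \<kappa>_in_Y by (auto split: if_splits simp del: topspace_prod_topology)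
  then have "openin C {a \<in> topspace C. \<kappa> a \<in> {y \<in> topspace Y. \<eta> (rep y) \<in> U}}"
    using openin_\<eta>[OF assms] by simp
  moreover have "{y \<in> topspace Y. \<eta> (rep y) \<in> U} \<subseteq> topspace Y" by blast
  ultimately show ?thesis
    using quotient_\<kappa> unfolding quotient_map_def by meson
qed

text \<open>A quotient map restricts to a quotient map over an open set, and off \<open>base\<close>
  \<kappa> is injective with inverse \<open>rep\<close>.\<close>

lemma continuous_map_rep:
  "continuous_map (subtopology Y {y \<in> topspace Y. \<eta> (rep y) \<noteq> 0}) C rep"
proof -
  let ?Y = "{y \<in> topspace Y. \<eta> (rep y) \<in> - {0}}"
  let ?C = "{a \<in> topspace C. \<kappa> a \<in> ?Y}"
  have "quotient_map (subtopology C ?C) (subtopology Y ?Y) \<kappa>"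
    by (rule quotient_map_restriction[OF quotient_\<kappa> refl]) (rule disjI1, rule openin_Y_\<eta>, auto)
  moreover have "continuous_map (subtopology C ?C) C (rep \<circ> \<kappa>)"
  proof (rule continuous_map_eq)
    show "continuous_map (subtopology C ?C) C (\<lambda>a. a)"
      using continuous_map_id_subt[of C] by (simp add: id_def)
    show "a = (rep \<circ> \<kappa>) a" if "a \<in> topspace (subtopology C ?C)" for a
    proof -
      have "a \<in> topspace C" "\<eta> (rep (\<kappa> a)) \<noteq> 0" using that by (auto simp: topspace_subtopology)
      then show ?thesis using rep_\<kappa>[of a] p0(3) by (auto split: if_splits)
    qed
  qed
  ultimately show ?thesis
    using continuous_compose_quotient_map by fastforce
qed

text \<open>A quotient map need not stay one after squaring, so a map on \<open>Y \<times> Y\<close> is given on \<open>C \<times> C\<close> and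
  required to be constant in each variable near the collapsed set.\<close>

lemma continuous_map_on_square:
  assumes f: "continuous_map (prod_topology unit_interval (prod_topology C C)) V f"
    and left: "\<And>t a b. \<lbrakk>t \<in> {0..1}; a \<in> topspace C; b \<in> topspace C; \<eta> a < 1\<rbrakk> \<Longrightarrow> f (t, a, b) = f (t, (p, 0), b)"
    and right: "\<And>t a b. \<lbrakk>t \<in> {0..1}; a \<in> topspace C; b \<in> topspace C; \<eta> b < 1\<rbrakk> \<Longrightarrow> f (t, a, b) = f (t, a, (p, 0))"
  shows "continuous_map (prod_topology unit_interval (prod_topology Y Y)) V (\<lambda>(t, a, b). f (t, rep a, rep b))"
    (is "continuous_map ?D V ?f")
proof -
  have f_rep: "f (t, a, rep (\<kappa> b)) = f (t, a, b)" "f (t, rep (\<kappa> b), a) = f (t, b, a)"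
    if "t \<in> {0..1}" "a \<in> topspace C" "b \<in> topspace C" for t a b
    using that left right rep_\<kappa> by auto
  have contY: "continuous_map (prod_topology unit_interval Y) V (\<lambda>(t, b). g (t, rep b))"
    if g: "continuous_map (prod_topology unit_interval C) V g"
      and g_rep: "\<And>t b. \<lbrakk>t \<in> {0..1}; b \<in> topspace C\<rbrakk> \<Longrightarrow> g (t, rep (\<kappa> b)) = g (t, b)" for g
  proof (rule continuous_compose_quotient_map[OF quotient_map_unit_interval_prod[OF quotient_\<kappa>]])
    show "continuous_map (prod_topology unit_interval C) V ((\<lambda>(t, b). g (t, rep b)) \<circ> (\<lambda>(t, x). (t, \<kappa> x)))"
      by (rule continuous_map_eq[OF g]) (auto simp: g_rep)
  qed
  let ?e = "(p, 0)"
  have continuous_map_const': "continuous_map Z C (\<lambda>z. ?e)" for Z :: "(real \<times> 'a \<times> real) topology"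
    using p0(1) by (metis continuous_map_const)
  have e1: "continuous_map ?D V (\<lambda>(t, a, b). f (t, ?e, rep b))"
  proof -
    have "continuous_map (prod_topology unit_interval C) V (\<lambda>u. f (fst u, ?e, snd u))"
      by (intro continuous_map_comp[OF f] continuous_map_rules continuous_map_const') 
    then have "continuous_map (prod_topology unit_interval Y) V (\<lambda>(t, b). f (t, ?e, rep b))"
      using contY[of "\<lambda>u. f (fst u, ?e, snd u)"] f_rep(1)[OF _ p0(1)] by simp
    then have "continuous_map ?D V (\<lambda>u. (\<lambda>(t, b). f (t, ?e, rep b)) (fst u, snd (snd u)))"
      by (rule continuous_map_comp) (intro continuous_map_rules)
    then show ?thesis by (simp add: case_prod_unfold)
  qed
  have e2: "continuous_map ?D V (\<lambda>(t, a, b). f (t, rep a, ?e))"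
  proof -
    have "continuous_map (prod_topology unit_interval C) V (\<lambda>u. f (fst u, snd u, ?e))"
      by (intro continuous_map_comp[OF f] continuous_map_rules continuous_map_const') 
    then have "continuous_map (prod_topology unit_interval Y) V (\<lambda>(t, b). f (t, rep b, ?e))"
      using contY[of "\<lambda>u. f (fst u, snd u, ?e)"] f_rep(2)[OF _ p0(1)] by simp
    then have "continuous_map ?D V (\<lambda>u. (\<lambda>(t, b). f (t, rep b, ?e)) (fst u, fst (snd u)))"
      by (rule continuous_map_comp) (intro continuous_map_rules)
    then show ?thesis by (simp add: case_prod_unfold)
  qed
  let ?N = "{y \<in> topspace Y. \<eta> (rep y) \<in> {..<1}}"
  let ?P = "{y \<in> topspace Y. \<eta> (rep y) \<in> - {0}}"
  \<comment> \<open>Three open sets cover \<open>Y \<times> Y\<close>. Where both points avoid the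
    basepoint, \<open>rep\<close> is continuous; where one point has \<eta> below 1,
    \<open>f\<close> forgets it and is a map of time and the other point, for which the interval
    times \<kappa> is a quotient map.\<close>
  let ?T = "\<lambda>i. if i = (0::nat) then {0..1} \<times> ?P \<times> ?P
      else if i = 1 then {0..1} \<times> ?N \<times> topspace Y else {0..1} \<times> topspace Y \<times> ?N"
  let ?g = "\<lambda>i. if i = (0::nat) then ?f
      else if i = 1 then (\<lambda>(t, a, b). f (t, ?e, rep b)) else (\<lambda>(t, a, b). f (t, rep a, ?e))"
  have P: "continuous_map (subtopology Y ?P) C rep"
    using continuous_map_rep by simp
  have e0: "continuous_map (subtopology ?D ({0..1} \<times> ?P \<times> ?P)) V ?f"
  proof -
    have "subtopology ?D ({0..1} \<times> ?P \<times> ?P)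
      = prod_topology unit_interval (prod_topology (subtopology Y ?P) (subtopology Y ?P))"
      by (simp only: subtopology_Times) (simp add: subtopology_subtopology)
    moreover have "continuous_map (prod_topology unit_interval (prod_topology (subtopology Y ?P) (subtopology Y ?P))) V
      (\<lambda>u. f (fst u, rep (fst (snd u)), rep (snd (snd u))))"
      by (intro continuous_map_comp[OF f] continuous_map_rules continuous_map_comp[OF P])
    ultimately show ?thesis by (simp add: case_prod_unfold)
  qed
  have open_N: "openin Y ?N" and open_P: "openin Y ?P" and open_I: "openin unit_interval {0..1}"
    using openin_Y_\<eta>[of "{..<1}"] openin_Y_\<eta>[of "- {0}"] openin_topspace[of unit_interval] by auto
  show ?thesis
  proof (rule pasting_lemma[where I = "{0, 1, 2}" and T = ?T and f = ?g])
    show "openin ?D (?T i)" for i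
      using open_N open_P open_I by (simp add: openin_prod_Times_iff)
    show "continuous_map (subtopology ?D (?T i)) V (?g i)" for i
      using e0 continuous_map_from_subtopology[OF e1] continuous_map_from_subtopology[OF e2] by simp
    have eq: "?g i u = ?f u" if "u \<in> topspace ?D" "u \<in> ?T i" for i u
      using that left right rep_in_C by (cases u) (auto split: if_splits)
    then show "?g i u = ?g j u" if "u \<in> topspace ?D \<inter> ?T i \<inter> ?T j" for i j u
      using that by simp
    show "\<exists>j. j \<in> {0, 1, 2} \<and> u \<in> ?T j \<and> ?f u = ?g j u" if u: "u \<in> topspace ?D" for u
    proof -
      have "\<exists>j\<in>{0, 1, 2}. u \<in> ?T j"
        using u by (cases u) auto
      then obtain j where j: "j \<in> {0, 1, 2}" "u \<in> ?T j"
        by (rule bexE)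
      show ?thesis
        by (rule exI[of _ j], intro conjI j eq[OF u j(2), symmetric])
    qed
  qed
qed

text \<open>At time 1 the middle third of the heights is stretched over the whole interval and
  \<open>r\<close> has sent the points with \<open>w \<le> 1/3\<close> to \<open>p\<close>; so a
  neighbourhood of \<open>base\<close> lands in \<open>base\<close>.\<close>

definition squeeze :: "real \<times> 'a \<times> real \<Rightarrow> 'a \<times> real" where
  "squeeze u = (r (fst u, fst (snd u)), (1 - fst u) * snd (snd u) + fst u * clamp01 (3 * snd (snd u) - 1))"

definition \<sigma> :: "real \<Rightarrow> real" where
  "\<sigma> s = clamp01 (3 * s - 1)"

lemma \<sigma>_range [simp]: "0 \<le> \<sigma> s" "\<sigma> s \<le> 1"
  by (auto simp: \<sigma>_def)

lemma continuous_map_\<sigma>: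
  assumes "continuous_map Z unit_interval f"
  shows "continuous_map Z unit_interval (\<lambda>z. \<sigma> (f z))"
  unfolding continuous_map_into_unit_interval \<sigma>_def
  by (intro conjI ballI continuous_map_rules continuous_map_canonical_const clamp01_range
      continuous_map_unit_interval_real[OF assms])

lemma squeeze_0: "a \<in> topspace C \<Longrightarrow> squeeze (0, a) = a"
  by (auto simp: squeeze_def r_0)

lemma squeeze_1: "squeeze (1, x, s) = (r (1, x), \<sigma> s)"
  by (simp add: squeeze_def \<sigma>_def)

lemma continuous_map_r:
  assumes "continuous_map Z unit_interval f" "continuous_map Z X g"
  shows "continuous_map Z X (\<lambda>z. r (f z, g z))"
  by (intro continuous_map_comp[OF r] continuous_map_pairedI assms)

lemma continuous_map_m:
  assumes "continuous_map Z unit_interval f" "continuous_map Z X g" "continuous_map Z X h"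
  shows "continuous_map Z X (\<lambda>z. m (f z, g z, h z))"
  by (intro continuous_map_comp[OF m] continuous_map_pairedI assms)

lemma r_in_X: "t \<in> {0..1} \<Longrightarrow> x \<in> topspace X \<Longrightarrow> r (t, x) \<in> topspace X"
  using continuous_map_image_subset_topspace[OF r] by (auto simp: image_subset_iff)

lemma m_in_X: "t \<in> {0..1} \<Longrightarrow> x \<in> topspace X \<Longrightarrow> y \<in> topspace X \<Longrightarrow> m (t, x, y) \<in> topspace X"
  using continuous_map_image_subset_topspace[OF m] by (auto simp: image_subset_iff)

lemma convex_combination_unit_interval:
  fixes s s' t :: real
  assumes "t \<in> {0..1}" "s \<in> {0..1}" "s' \<in> {0..1}"
  shows "(1 - t) * s + t * s' \<in> {0..1}"
  using convexD[of "{0..1::real}" s s' "1 - t" t] assms by simp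

lemma continuous_map_squeeze: "continuous_map (prod_topology unit_interval C) C squeeze"
proof -
  have "continuous_map (prod_topology unit_interval C) C (\<lambda>u. (r (fst u, fst (snd u)),
      (1 - fst u) * snd (snd u) + fst u * clamp01 (3 * snd (snd u) - 1)))"
  proof (rule continuous_map_pairedI)
    show "continuous_map (prod_topology unit_interval C) X (\<lambda>u. r (fst u, fst (snd u)))"
      by (intro continuous_map_r continuous_map_projections)
    have "continuous_map (prod_topology unit_interval C) euclideanreal (\<lambda>u. fst u)"
      "continuous_map (prod_topology unit_interval C) euclideanreal (\<lambda>u. snd (snd u))"
      by (rule continuous_map_unit_interval_real, rule continuous_map_projections)+
    then have "continuous_map (prod_topology unit_interval C) euclideanreal
        (\<lambda>u. (1 - fst u) * snd (snd u) + fst u * clamp01 (3 * snd (snd u) - 1))"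
      by (intro continuous_map_rules continuous_map_canonical_const)
    then show "continuous_map (prod_topology unit_interval C) unit_interval
        (\<lambda>u. (1 - fst u) * snd (snd u) + fst u * clamp01 (3 * snd (snd u) - 1))"
      unfolding continuous_map_into_unit_interval
      using convex_combination_unit_interval by auto
  qed
  then show ?thesis by (simp add: squeeze_def[abs_def])
qed

lemma squeeze_base:
  assumes "t \<in> {0..1}" "a \<in> base"
  shows "squeeze (t, a) \<in> base"
proof -
  obtain x s where a: "a = (x, s)" by force
  have s: "s \<in> {0..1}" "x \<in> topspace X"
    using assms(2) base_subset unfolding a by auto
  consider "s = 0" | "s = 1" | "x = p"
    using assms(2) unfolding a suspension_base_def by auto
  then show ?thesis
  proof cases
    case 1
    then show ?thesis using r_in_X[OF assms(1) s(2)] by (simp add: a squeeze_def suspension_base_def)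
  next
    case 2
    then show ?thesis using r_in_X[OF assms(1) s(2)] by (simp add: a squeeze_def suspension_base_def)
  next
    case 3
    then show ?thesis
      using convex_combination_unit_interval[OF assms(1) s(1), of "clamp01 (3 * s - 1)"] r_p[OF assms(1)]
      by (simp add: a squeeze_def suspension_base_def)
  qed
qed

text \<open>\<open>\<eta> (x, s) \<le> 3\<close> says that \<open>s\<close>, \<open>1 - s\<close> or
  \<open>w x\<close> is at most 1/3: the first two make \<open>\<sigma> s\<close> an endpoint, the
  third makes \<open>m\<close> equal to \<open>p\<close>, whatever \<open>u\<close> and
  \<open>y\<close> are.\<close>

lemma \<kappa>_m_eq_base:
  assumes "u \<in> {0..1}" "x \<in> topspace X" "s \<in> {0..1}" "y \<in> topspace X" "\<eta> (x, s) \<le> 3"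
  shows "\<kappa> (m (u, x, y), \<sigma> s) = base"
proof -
  have "s \<le> 1/3 \<or> 2/3 \<le> s \<or> w x \<le> 1/3" using assms(5) by (auto simp: \<eta>_def min_def split: if_splits)
  then have "\<sigma> s = 0 \<or> \<sigma> s = 1 \<or> m (u, x, y) = p"
    using m_p[OF assms(1,2,4)] by (auto simp: \<sigma>_def)
  then have "(m (u, x, y), \<sigma> s) \<in> base"
    using m_in_X[OF assms(1,2,4)] by (auto simp: suspension_base_def)
  then show ?thesis by (simp add: collapse_class_def)
qed

lemma \<kappa>_0: "x \<in> topspace X \<Longrightarrow> \<kappa> (x, 0) = base"
  and \<kappa>_1: "x \<in> topspace X \<Longrightarrow> \<kappa> (x, 1) = base"
  and \<kappa>_p: "s \<in> {0..1} \<Longrightarrow> \<kappa> (p, s) = base"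
  by (auto simp: collapse_class_def suspension_base_def)

definition A :: "(('a \<times> real) set \<times> ('a \<times> real) set) set" where
  "A = {(\<kappa> (x, s), \<kappa> (x, s')) | x s s'. x \<in> topspace X \<and> s \<in> {0..1} \<and> s' \<in> {0..1}}"

end

text \<open>What the homotopies use of either quotient: \<open>q_eqD\<close> bounds the
  identifications by the swap and those inside \<open>A\<close>, and \<open>q_natural\<close> lets a
  based self-map of \<open>Y\<close> act on \<open>V\<close>.\<close>

locale quadratic_quotient = equiconnected X p r w d m
  for X :: "'a topology" and p r w d m +
  fixes V :: "'c topology" and q :: "('a \<times> real) set \<times> ('a \<times> real) set \<Rightarrow> 'c"
  assumes quotient_q: "quotient_map (prod_topology Y Y) V q"
    and q_commute: "\<lbrakk>a \<in> topspace Y; b \<in> topspace Y\<rbrakk> \<Longrightarrow> q (a, b) = q (b, a)"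
    and q_eqD: "\<lbrakk>a \<in> topspace Y; b \<in> topspace Y; a' \<in> topspace Y; b' \<in> topspace Y; q (a, b) = q (a', b')\<rbrakk>
      \<Longrightarrow> a' = a \<and> b' = b \<or> a' = b \<and> b' = a \<or> (a, b) \<in> A \<and> (a', b') \<in> A"
    and q_natural: "\<lbrakk>\<phi> \<in> topspace Y \<rightarrow> topspace Y; \<phi> base = base; a \<in> topspace Y; b \<in> topspace Y;
      a' \<in> topspace Y; b' \<in> topspace Y; q (a, b) = q (a', b')\<rbrakk> \<Longrightarrow> q (\<phi> a, \<phi> b) = q (\<phi> a', \<phi> b')"
begin

definition Q :: "('a \<times> real) \<times> ('a \<times> real) \<Rightarrow> 'c" where
  "Q u = q (\<kappa> (fst u), \<kappa> (snd u))"

abbreviation T :: "('a \<times> real \<times> real) topology" where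
  "T \<equiv> prod_topology X (prod_topology unit_interval unit_interval)"

text \<open>A parametrisation of E, the image of \<open>A\<close>, by an X-coordinate and two
  heights; homotopies of E are written on \<open>T\<close>, compatibly with the fibres of
  \<open>B\<close>.\<close>

definition B :: "'a \<times> real \<times> real \<Rightarrow> 'c" where
  "B l = Q ((fst l, fst (snd l)), (fst l, snd (snd l)))"

lemma B_eq: "B (x, s, s') = Q ((x, s), (x, s'))"
  by (simp add: B_def)

lemma Q_eq: "Q (a, b) = q (\<kappa> a, \<kappa> b)"
  by (simp add: Q_def)

lemma continuous_Q: "continuous_map (prod_topology C C) V Q"
proof -
  have "continuous_map (prod_topology C C) V (\<lambda>u. q (\<kappa> (fst u), \<kappa> (snd u)))"
    by (intro continuous_map_comp[OF quotient_imp_continuous_map[OF quotient_q]] continuous_map_pairedI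
        continuous_map_comp[OF continuous_\<kappa>] continuous_map_projections)
  then show ?thesis by (simp add: Q_def[abs_def])
qed

lemma continuous_map_Q:
  assumes "continuous_map Z C f" "continuous_map Z C g"
  shows "continuous_map Z V (\<lambda>z. Q (f z, g z))"
  by (intro continuous_map_comp[OF continuous_Q] continuous_map_pairedI assms)

lemma continuous_B: "continuous_map T V B"
proof -
  have "continuous_map T V (\<lambda>l. Q ((fst l, fst (snd l)), (fst l, snd (snd l))))"
    by (intro continuous_map_Q continuous_map_pairedI continuous_map_projections)
  then show ?thesis by (simp add: B_def[abs_def])
qed

lemma V_cases:
  assumes "v \<in> topspace V"
  obtains a b where "a \<in> topspace C" "b \<in> topspace C" "v = Q (a, b)"
proof -
  obtain z where z: "z \<in> topspace (prod_topology Y Y)" "v = q z"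
    using assms quotient_imp_surjective_map[OF quotient_q] by (metis imageE)
  obtain y y' where y: "z = (y, y')" "y \<in> topspace Y" "y' \<in> topspace Y"
    using z(1) by auto
  show thesis
    by (rule that[OF rep_in_C[OF y(2)] rep_in_C[OF y(3)]]) (simp add: Q_eq z y \<kappa>_rep)
qed

lemma A_subset: "A \<subseteq> topspace (prod_topology Y Y)"
  using \<kappa>_in_Y by (auto simp: A_def)

lemma q_A: "q ` A = B ` topspace T"
proof -
  have "A = (\<lambda>l. (\<kappa> (fst l, fst (snd l)), \<kappa> (fst l, snd (snd l)))) ` topspace T"
    by (force simp: A_def)
  then show ?thesis by (simp add: image_image B_def Q_def)
qed

text \<open>\<open>left\<close> with \<open>commute\<close> lets \<open>f\<close> descend to the
  square of \<open>Y\<close>. By \<open>q_eqD\<close> two pairs with the same image differ by the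
  swap, handled by \<open>commute\<close>, or both lie in \<open>A\<close>, handled by
  \<open>diag\<close>.\<close>

lemma homotopy_lift:
  assumes f: "continuous_map (prod_topology unit_interval (prod_topology C C)) V f"
    and left: "\<And>t a b. \<lbrakk>t \<in> {0..1}; a \<in> topspace C; b \<in> topspace C; \<eta> a < 1\<rbrakk> \<Longrightarrow> f (t, a, b) = f (t, (p, 0), b)"
    and commute: "\<And>t a b. \<lbrakk>t \<in> {0..1}; a \<in> topspace C; b \<in> topspace C\<rbrakk> \<Longrightarrow> f (t, a, b) = f (t, b, a)"
    and diag: "\<And>t l l'. \<lbrakk>t \<in> {0..1}; l \<in> topspace T; l' \<in> topspace T; B l = B l'\<rbrakk>
      \<Longrightarrow> f (t, (fst l, fst (snd l)), (fst l, snd (snd l))) = f (t, (fst l', fst (snd l')), (fst l', snd (snd l')))"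
  shows "\<exists>F. continuous_map (prod_topology unit_interval V) V F \<and>
    (\<forall>t\<in>{0..1}. \<forall>a\<in>topspace C. \<forall>b\<in>topspace C. F (t, Q (a, b)) = f (t, a, b))"
proof -
  have right: "f (t, a, b) = f (t, a, (p, 0))"
    if "t \<in> {0..1}" "a \<in> topspace C" "b \<in> topspace C" "\<eta> b < 1" for t a b
    using left[OF that(1,3,2,4)] commute[OF that(1-3)] commute[OF that(1,2) p0(1)] by simp
  have f_rep: "f (t, rep (\<kappa> a), rep (\<kappa> b)) = f (t, a, b)"
    if "t \<in> {0..1}" "a \<in> topspace C" "b \<in> topspace C" for t a b
    using left[OF that] right[OF that] left[OF that(1,2) p0(1)] rep_\<kappa>[OF that(2)] rep_\<kappa>[OF that(3)] by simp
  let ?H = "\<lambda>(t, a, b). f (t, rep a, rep b)"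
  have H: "continuous_map (prod_topology unit_interval (prod_topology Y Y)) V ?H"
    by (rule continuous_map_on_square[OF f left right])
  \<comment> \<open>The lifts chosen by \<open>rep\<close> need not share an X-coordinate, even for
    a pair in \<open>A\<close>; \<open>f_rep\<close> replaces them by lifts that do.\<close>
  have AH: "\<exists>l\<in>topspace T. q (y, y') = B l \<and>
      (\<forall>t\<in>{0..1}. f (t, rep y, rep y') = f (t, (fst l, fst (snd l)), (fst l, snd (snd l))))"
    if yA: "(y, y') \<in> A" for y y'
  proof -
    obtain x s s' where l: "y = \<kappa> (x, s)" "y' = \<kappa> (x, s')" "x \<in> topspace X" "s \<in> {0..1}" "s' \<in> {0..1}"
      using yA unfolding A_def by blast
    then have "(x, s) \<in> topspace C" "(x, s') \<in> topspace C" by auto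
    then show ?thesis
      using l f_rep by (intro bexI[of _ "(x, s, s')"]) (auto simp: B_eq Q_eq)
  qed
  have "?H (t, z) = ?H (t, z')"
    if t: "t \<in> {0..1}" and z: "z \<in> topspace (prod_topology Y Y)" "z' \<in> topspace (prod_topology Y Y)"
      and eq: "q z = q z'" for t z z'
  proof -
    obtain a b where ab: "z = (a, b)" "a \<in> topspace Y" "b \<in> topspace Y" using z(1) by auto
    obtain a' b' where ab': "z' = (a', b')" "a' \<in> topspace Y" "b' \<in> topspace Y" using z(2) by auto
    consider "a' = a" "b' = b" | "a' = b" "b' = a" | "(a, b) \<in> A" "(a', b') \<in> A"
      using q_eqD[OF ab(2,3) ab'(2,3)] eq ab(1) ab'(1) by blast
    then show ?thesis
    proof cases
      case 1
      then show ?thesis using ab ab' by simp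
    next
      case 2
      then show ?thesis using ab ab' commute[OF t rep_in_C[OF ab(2)] rep_in_C[OF ab(3)]] by simp
    next
      case 3
      obtain l where "l \<in> topspace T" "q (a, b) = B l"
        "f (t, rep a, rep b) = f (t, (fst l, fst (snd l)), (fst l, snd (snd l)))"
        using AH[OF 3(1)] t by blast
      moreover obtain l' where "l' \<in> topspace T" "q (a', b') = B l'"
        "f (t, rep a', rep b') = f (t, (fst l', fst (snd l')), (fst l', snd (snd l')))"
        using AH[OF 3(2)] t by blast
      ultimately show ?thesis
        using diag[OF t, of l l'] eq by (simp only: ab(1) ab'(1) case_prod_conv)
    qed
  qed
  then obtain F where F: "continuous_map (prod_topology unit_interval V) V F"
    and F_eq: "\<forall>t\<in>{0..1}. \<forall>z\<in>topspace (prod_topology Y Y). F (t, q z) = ?H (t, z)"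
    using homotopy_through_quotient[OF quotient_q H] by blast
  have "F (t, Q (a, b)) = f (t, a, b)" if "t \<in> {0..1}" "a \<in> topspace C" "b \<in> topspace C" for t a b
  proof -
    have "(\<kappa> a, \<kappa> b) \<in> topspace (prod_topology Y Y)"
      using \<kappa>_in_Y[OF that(2)] \<kappa>_in_Y[OF that(3)] by simp
    then show ?thesis using F_eq that(1) f_rep[OF that] by (simp only: Q_eq) force
  qed
  with F show ?thesis by blast
qed

end

section \<open>Collapsing the pairs with a common coordinate\<close>

context quadratic_quotient
begin

lemma squeeze_on_Y:
  "\<exists>R. continuous_map (prod_topology unit_interval Y) Y R \<and>
    (\<forall>t\<in>{0..1}. \<forall>a\<in>topspace C. R (t, \<kappa> a) = \<kappa> (squeeze (t, a)))"
proof -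
  have cont: "continuous_map (prod_topology unit_interval C) Y (\<lambda>u. \<kappa> (squeeze u))"
    by (intro continuous_map_comp[OF continuous_\<kappa>] continuous_map_squeeze)
  have "\<kappa> (squeeze (t, a)) = \<kappa> (squeeze (t, b))"
    if t: "t \<in> {0..1}" and ab: "a \<in> topspace C" "b \<in> topspace C" "\<kappa> a = \<kappa> b" for t a b
  proof (cases "a = b")
    case False
    then have "a \<in> base" "b \<in> base"
      using \<kappa>_eq_iff[OF ab(1,2)] ab \<eta>_0_iff by blast+
    then show ?thesis
      using squeeze_base[OF t] by (simp add: collapse_class_def)
  qed simp
  then show ?thesis
    by (rule homotopy_through_quotient[OF quotient_\<kappa> cont])
qed

lemma squeeze_in_C: "t \<in> {0..1} \<Longrightarrow> a \<in> topspace C \<Longrightarrow> squeeze (t, a) \<in> topspace C"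
  using continuous_map_image_subset_topspace[OF continuous_map_squeeze]
  by (metis (no_types, lifting) image_subset_iff mem_Sigma_iff topspace_euclidean_subtopology topspace_prod_topology)

text \<open>Squeezing preserves \<open>base\<close>, so it induces a based self-map of
  \<open>Y\<close>, to which \<open>q_natural\<close> applies.\<close>

lemma squeeze_natural:
  assumes t: "t \<in> {0..1}" and C: "a \<in> topspace C" "b \<in> topspace C" "a' \<in> topspace C" "b' \<in> topspace C"
    and eq: "Q (a, b) = Q (a', b')"
  shows "Q (squeeze (t, a), squeeze (t, b)) = Q (squeeze (t, a'), squeeze (t, b'))"
proof -
  obtain R where R: "continuous_map (prod_topology unit_interval Y) Y R"
    and R_eq: "\<And>a. a \<in> topspace C \<Longrightarrow> R (t, \<kappa> a) = \<kappa> (squeeze (t, a))"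
    using squeeze_on_Y t by blast
  have "continuous_map Y Y (\<lambda>y. R (t, y))"
    by (rule continuous_map_homotopy_at[OF R t])
  then have "(\<lambda>y. R (t, y)) \<in> topspace Y \<rightarrow> topspace Y"
    using continuous_map_image_subset_topspace by fastforce
  moreover have "R (t, base) = base"
    using R_eq[OF p0(1)] squeeze_base[OF t p0(2)] p0(2) by (simp add: collapse_class_def)
  ultimately have "q (R (t, \<kappa> a), R (t, \<kappa> b)) = q (R (t, \<kappa> a'), R (t, \<kappa> b'))"
    using q_natural[of "\<lambda>y. R (t, y)" "\<kappa> a" "\<kappa> b" "\<kappa> a'" "\<kappa> b'"] \<kappa>_in_Y C eq
    unfolding Q_eq by blast
  then show ?thesis using R_eq C by (simp add: Q_eq)
qed

lemma preserves_q_A_cong: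
  assumes "\<And>x. x \<in> topspace V \<Longrightarrow> h x = k x"
  shows "h ` q ` A \<subseteq> q ` A \<longleftrightarrow> k ` q ` A \<subseteq> q ` A"
proof -
  have "q ` A \<subseteq> topspace V"
    using A_subset quotient_imp_surjective_map[OF quotient_q] by blast
  then have "h ` q ` A = k ` q ` A" using assms by (intro image_cong) auto
  then show ?thesis by simp
qed

text \<open>This homotopy starts at the identity, which is not constant near \<open>base\<close>, so
  \<open>homotopy_lift\<close> cannot provide it. It exists because squeezing descends to a based
  homotopy of \<open>Y\<close>, which \<open>q_natural\<close> carries to \<open>V\<close>. Its end
  is constant near \<open>base\<close> in each variable, as the later stages require.\<close>

lemma homotopic_squeeze:
  "\<exists>k. homotopic_with (\<lambda>f. f ` q ` A \<subseteq> q ` A) V V id k \<and>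
    (\<forall>a\<in>topspace C. \<forall>b\<in>topspace C. k (Q (a, b)) = Q (squeeze (1, a), squeeze (1, b)))"
proof -
  obtain R where R: "continuous_map (prod_topology unit_interval Y) Y R"
    and R_eq: "\<forall>t\<in>{0..1}. \<forall>a\<in>topspace C. R (t, \<kappa> a) = \<kappa> (squeeze (t, a))"
    using squeeze_on_Y by blast
  let ?H = "\<lambda>u. q (R (fst u, fst (snd u)), R (fst u, snd (snd u)))"
  have H: "continuous_map (prod_topology unit_interval (prod_topology Y Y)) V ?H"
    by (intro continuous_map_comp[OF quotient_imp_continuous_map[OF quotient_q]] continuous_map_pairedI
        continuous_map_comp[OF R] continuous_map_projections)
  have H_eq: "?H (t, \<kappa> a, \<kappa> b) = Q (squeeze (t, a), squeeze (t, b))"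
    if "t \<in> {0..1}" "a \<in> topspace C" "b \<in> topspace C" for t a b
    using R_eq[rule_format, OF that(1)] that by (simp add: Q_eq del: topspace_prod_topology)
  have "?H (t, z) = ?H (t, z')"
    if t: "t \<in> {0..1}" and z: "z \<in> topspace (prod_topology Y Y)" "z' \<in> topspace (prod_topology Y Y)"
      and eq: "q z = q z'" for t z z'
  proof -
    obtain a b where ab: "z = (\<kappa> a, \<kappa> b)" "a \<in> topspace C" "b \<in> topspace C"
      using z(1) unfolding topspace_prod_topology topspace_Y by blast
    obtain a' b' where ab': "z' = (\<kappa> a', \<kappa> b')" "a' \<in> topspace C" "b' \<in> topspace C"
      using z(2) unfolding topspace_prod_topology topspace_Y by blast
    show ?thesis
      unfolding ab(1) ab'(1) H_eq[OF t ab(2,3)] H_eq[OF t ab'(2,3)]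
      by (rule squeeze_natural[OF t ab(2,3) ab'(2,3)]) (use eq ab(1) ab'(1) in \<open>simp add: Q_eq\<close>)
  qed
  then obtain F where F: "continuous_map (prod_topology unit_interval V) V F"
    and "\<forall>t\<in>{0..1}. \<forall>z\<in>topspace (prod_topology Y Y). F (t, q z) = ?H (t, z)"
    using homotopy_through_quotient[OF quotient_q H] by blast
  then have F_eq: "F (t, Q (a, b)) = Q (squeeze (t, a), squeeze (t, b))"
    if "t \<in> {0..1}" "a \<in> topspace C" "b \<in> topspace C" for t a b
    using H_eq[OF that] that \<kappa>_in_Y by (simp add: Q_eq)
  have "homotopic_with (\<lambda>f. f ` q ` A \<subseteq> q ` A) V V id (\<lambda>v. F (1, v))"
  proof (rule homotopic_withI[OF F])
    show "F (0, v) = id v" if v: "v \<in> topspace V" for v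
    proof -
      obtain a b where "a \<in> topspace C" "b \<in> topspace C" "v = Q (a, b)" by (rule V_cases[OF v])
      then show ?thesis using F_eq[of 0] squeeze_0 by simp
    qed
    show "(\<lambda>x. F (t, x)) ` q ` A \<subseteq> q ` A" if t: "t \<in> {0..1}" for t
    proof -
      have "F (t, B l) \<in> B ` topspace T" if l: "l \<in> topspace T" for l
      proof -
        obtain x s s' where l: "l = (x, s, s')" "x \<in> topspace X" "s \<in> {0..1}" "s' \<in> {0..1}" using l by auto
        have C: "(x, s) \<in> topspace C" "(x, s') \<in> topspace C" using l by auto
        let ?l = "(r (t, x), snd (squeeze (t, x, s)), snd (squeeze (t, x, s')))"
        have "F (t, B l) = B ?l"
          using F_eq[OF t C] by (simp add: l(1) B_eq squeeze_def)
        moreover have "?l \<in> topspace T"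
          using squeeze_in_C[OF t C(1)] squeeze_in_C[OF t C(2)] r_in_X[OF t l(2)] by (simp add: mem_Times_iff)
        ultimately show ?thesis by (rule image_eqI)
      qed
      then show ?thesis unfolding q_A by blast
    qed
  qed (rule refl, rule preserves_q_A_cong)
  then show ?thesis
    using F_eq[of 1] by (intro exI[of _ "\<lambda>v. F (1, v)"]) auto
qed

text \<open>Beyond the premises of \<open>homotopy_lift\<close>, \<open>diag_A\<close> keeps E
  invariant and \<open>f_0\<close> attaches the homotopy to the preceding stage.\<close>

lemma homotopic_lift:
  assumes f: "continuous_map (prod_topology unit_interval (prod_topology C C)) V f"
    and left: "\<And>t a b. \<lbrakk>t \<in> {0..1}; a \<in> topspace C; b \<in> topspace C; \<eta> a < 1\<rbrakk> \<Longrightarrow> f (t, a, b) = f (t, (p, 0), b)"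
    and commute: "\<And>t a b. \<lbrakk>t \<in> {0..1}; a \<in> topspace C; b \<in> topspace C\<rbrakk> \<Longrightarrow> f (t, a, b) = f (t, b, a)"
    and diag: "\<And>t l l'. \<lbrakk>t \<in> {0..1}; l \<in> topspace T; l' \<in> topspace T; B l = B l'\<rbrakk>
      \<Longrightarrow> f (t, (fst l, fst (snd l)), (fst l, snd (snd l))) = f (t, (fst l', fst (snd l')), (fst l', snd (snd l')))"
    and diag_A: "\<And>t l. \<lbrakk>t \<in> {0..1}; l \<in> topspace T\<rbrakk>
      \<Longrightarrow> f (t, (fst l, fst (snd l)), (fst l, snd (snd l))) \<in> B ` topspace T"
    and f_0: "\<And>a b. \<lbrakk>a \<in> topspace C; b \<in> topspace C\<rbrakk> \<Longrightarrow> f (0, a, b) = k (Q (a, b))"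
  shows "\<exists>k'. homotopic_with (\<lambda>f. f ` q ` A \<subseteq> q ` A) V V k k' \<and>
    (\<forall>a\<in>topspace C. \<forall>b\<in>topspace C. k' (Q (a, b)) = f (1, a, b))"
proof -
  obtain F where F: "continuous_map (prod_topology unit_interval V) V F"
    and F_eq: "\<forall>t\<in>{0..1}. \<forall>a\<in>topspace C. \<forall>b\<in>topspace C. F (t, Q (a, b)) = f (t, a, b)"
    using homotopy_lift[OF f left commute diag] by blast
  have "homotopic_with (\<lambda>f. f ` q ` A \<subseteq> q ` A) V V k (\<lambda>v. F (1, v))"
  proof (rule homotopic_withI[OF F])
    show "F (0, v) = k v" if v: "v \<in> topspace V" for v
    proof -
      obtain a b where "a \<in> topspace C" "b \<in> topspace C" "v = Q (a, b)" by (rule V_cases[OF v])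
      then show ?thesis using F_eq f_0 by (simp del: topspace_prod_topology)
    qed
    show "(\<lambda>x. F (t, x)) ` q ` A \<subseteq> q ` A" if t: "t \<in> {0..1}" for t
    proof -
      have "F (t, B l) \<in> B ` topspace T" if l: "l \<in> topspace T" for l
      proof -
        have "(fst l, fst (snd l)) \<in> topspace C" "(fst l, snd (snd l)) \<in> topspace C" using l by auto
        then show ?thesis using diag_A[OF t l] F_eq t by (simp add: B_def del: topspace_prod_topology)
      qed
      then show ?thesis unfolding q_A by blast
    qed
  qed (rule refl, rule preserves_q_A_cong)
  then show ?thesis
    using F_eq by (intro exI[of _ "\<lambda>v. F (1, v)"]) (simp del: topspace_prod_topology)
qed

end

section \<open>Cut-off functions for merging and contracting\<close>

context equiconnected
begin

text \<open>The thresholds of \<open>\<eta>\<close>: below \<open>1\<close> a map has to be constant to descend to \<open>Y\<close>, from \<open>2\<close> on close points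
  are merged completely, and up to \<open>3\<close> a squeezed point is the basepoint. So \<open>\<beta>\<close> is \<open>1\<close> on \<open>A\<close>, and where it
  is positive the merged pair lies in \<open>A\<close>.\<close>

definition \<alpha> :: "('a \<times> real) \<times> ('a \<times> real) \<Rightarrow> real" where
  "\<alpha> u = clamp01 (min (\<eta> (fst u) - 1) (\<eta> (snd u) - 1))"

definition \<beta> :: "('a \<times> real) \<times> ('a \<times> real) \<Rightarrow> real" where
  "\<beta> u = clamp01 (max (3 - \<eta> (fst u)) (max (3 - \<eta> (snd u)) (1 - d (fst (fst u), fst (snd u)))))"

abbreviation D :: "(real \<times> ('a \<times> real) \<times> ('a \<times> real)) topology" where
  "D \<equiv> prod_topology unit_interval (prod_topology C C)"

lemma D_projections:
  "continuous_map D unit_interval (\<lambda>z. fst z)"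
  "continuous_map D C (\<lambda>z. fst (snd z))" "continuous_map D C (\<lambda>z. snd (snd z))"
  "continuous_map D X (\<lambda>z. fst (fst (snd z)))" "continuous_map D X (\<lambda>z. fst (snd (snd z)))"
  "continuous_map D unit_interval (\<lambda>z. snd (fst (snd z)))" "continuous_map D unit_interval (\<lambda>z. snd (snd (snd z)))"
proof -
  show 1: "continuous_map D unit_interval (\<lambda>z. fst z)"
    "continuous_map D C (\<lambda>z. fst (snd z))" "continuous_map D C (\<lambda>z. snd (snd z))"
    by (intro continuous_map_projections)+
  show "continuous_map D X (\<lambda>z. fst (fst (snd z)))" "continuous_map D X (\<lambda>z. fst (snd (snd z)))"
    "continuous_map D unit_interval (\<lambda>z. snd (fst (snd z)))" "continuous_map D unit_interval (\<lambda>z. snd (snd (snd z)))"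
    by (rule continuous_map_fst'[OF 1(2)] continuous_map_fst'[OF 1(3)]
        continuous_map_snd'[OF 1(2)] continuous_map_snd'[OF 1(3)])+
qed

lemma continuous_map_scaled:
  assumes "continuous_map Z unit_interval f" "continuous_map Z unit_interval g"
  shows "continuous_map Z unit_interval (\<lambda>z. f z * g z)"
  using assms unfolding continuous_map_into_unit_interval
  by (simp add: continuous_map_real_mult mult_le_one)

lemma continuous_\<alpha>: "continuous_map D unit_interval (\<lambda>z. \<alpha> (snd z))"
proof -
  have "continuous_map D euclideanreal (\<lambda>z. \<eta> (fst (snd z)))" "continuous_map D euclideanreal (\<lambda>z. \<eta> (snd (snd z)))"
    by (intro continuous_map_\<eta> D_projections)+
  then have "continuous_map D euclideanreal (\<lambda>z. \<alpha> (snd z))"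
    unfolding \<alpha>_def by (intro continuous_map_rules continuous_map_canonical_const)
  then show ?thesis by (simp add: continuous_map_into_unit_interval \<alpha>_def)
qed

lemma continuous_map_d:
  assumes "continuous_map Z X f" "continuous_map Z X g"
  shows "continuous_map Z euclideanreal (\<lambda>z. d (f z, g z))"
  by (intro continuous_map_comp[OF d] continuous_map_pairedI assms)

lemma continuous_\<beta>: "continuous_map D unit_interval (\<lambda>z. \<beta> (snd z))"
proof -
  have "continuous_map D euclideanreal (\<lambda>z. \<eta> (fst (snd z)))" "continuous_map D euclideanreal (\<lambda>z. \<eta> (snd (snd z)))"
    "continuous_map D euclideanreal (\<lambda>z. d (fst (fst (snd z)), fst (snd (snd z))))"
    by (intro continuous_map_\<eta> continuous_map_d D_projections)+
  then have "continuous_map D euclideanreal (\<lambda>z. \<beta> (snd z))"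
    unfolding \<beta>_def by (intro continuous_map_rules continuous_map_canonical_const)
  then show ?thesis by (simp add: continuous_map_into_unit_interval \<beta>_def)
qed

lemma \<alpha>_commute: "\<alpha> (a, b) = \<alpha> (b, a)"
  by (simp add: \<alpha>_def min.commute)

lemma \<beta>_commute: "fst a \<in> topspace X \<Longrightarrow> fst b \<in> topspace X \<Longrightarrow> \<beta> (a, b) = \<beta> (b, a)"
  by (simp add: \<beta>_def d_commute max.left_commute)

lemma \<alpha>_range [simp]: "0 \<le> \<alpha> u" "\<alpha> u \<le> 1" and \<beta>_range [simp]: "0 \<le> \<beta> u" "\<beta> u \<le> 1"
  by (simp_all add: \<alpha>_def \<beta>_def)

lemma scaled_in_unit_interval:
  "t \<in> {0..1} \<Longrightarrow> t * \<alpha> u \<in> {0..1}" "t \<in> {0..1} \<Longrightarrow> t * \<beta> u \<in> {0..1}"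
  by (simp_all add: mult_le_one)

lemma \<alpha>_eq_1: "2 \<le> \<eta> a \<Longrightarrow> 2 \<le> \<eta> b \<Longrightarrow> \<alpha> (a, b) = 1"
  by (simp add: \<alpha>_def)

end

section \<open>Merging the X-coordinates of close pairs\<close>

context quadratic_quotient
begin

text \<open>The factor \<alpha> turns the motion off near the basepoint: the motion of one point
  depends on the X-coordinate of the other, which has to be forgotten once that other point is close
  to \<open>base\<close>.\<close>

definition merge :: "real \<times> ('a \<times> real) \<times> ('a \<times> real) \<Rightarrow> 'c" where
  "merge z = Q ((m (fst z * \<alpha> (snd z), fst (fst (snd z)), fst (snd (snd z))), \<sigma> (snd (fst (snd z)))),
    (m (fst z * \<alpha> (snd z), fst (snd (snd z)), fst (fst (snd z))), \<sigma> (snd (snd (snd z)))))"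

lemma merge_eq: "merge (t, (x, s), (y, s')) =
    Q ((m (t * \<alpha> ((x, s), (y, s')), x, y), \<sigma> s), (m (t * \<alpha> ((x, s), (y, s')), y, x), \<sigma> s'))"
  by (simp add: merge_def)

lemma continuous_merge: "continuous_map D V merge"
proof -
  have "continuous_map D V (\<lambda>z. Q ((m (fst z * \<alpha> (snd z), fst (fst (snd z)), fst (snd (snd z))), \<sigma> (snd (fst (snd z)))),
    (m (fst z * \<alpha> (snd z), fst (snd (snd z)), fst (fst (snd z))), \<sigma> (snd (snd (snd z))))))"
    by (intro continuous_map_Q continuous_map_pairedI continuous_map_m continuous_map_scaled
        continuous_map_\<sigma> D_projections continuous_\<alpha>)
  then show ?thesis by (simp add: merge_def[abs_def])
qed

lemma Q_commute: "a \<in> topspace C \<Longrightarrow> b \<in> topspace C \<Longrightarrow> Q (a, b) = Q (b, a)"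
  unfolding Q_eq by (intro q_commute \<kappa>_in_Y)

lemma B_squeeze:
  assumes "B l = B l'" "l \<in> topspace T" "l' \<in> topspace T"
  shows "B (r (1, fst l), \<sigma> (fst (snd l)), \<sigma> (snd (snd l))) = B (r (1, fst l'), \<sigma> (fst (snd l')), \<sigma> (snd (snd l')))"
  using assms squeeze_natural[of 1 "(fst l, fst (snd l))" "(fst l, snd (snd l))" "(fst l', fst (snd l'))" "(fst l', snd (snd l'))"]
  by (auto simp: B_def squeeze_1)

lemma squeezed_in_T: "l \<in> topspace T \<Longrightarrow> (r (1, fst l), \<sigma> (fst (snd l)), \<sigma> (snd (snd l))) \<in> topspace T"
  using r_in_X by auto

text \<open>By \<open>m_self\<close> points with equal X-coordinates do not move, so on
  \<open>A\<close> merging leaves the squeezed pair where it is.\<close>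

lemma merge_diag:
  assumes "t \<in> {0..1}" "l \<in> topspace T"
  shows "merge (t, (fst l, fst (snd l)), (fst l, snd (snd l))) = B (r (1, fst l), \<sigma> (fst (snd l)), \<sigma> (snd (snd l)))"
  using assms scaled_in_unit_interval(1)[OF assms(1)] by (auto simp: merge_eq B_eq m_self simp del: atLeastAtMost_iff)

lemma homotopic_merge:
  assumes k: "\<And>a b. \<lbrakk>a \<in> topspace C; b \<in> topspace C\<rbrakk> \<Longrightarrow> k (Q (a, b)) = Q (squeeze (1, a), squeeze (1, b))"
  shows "\<exists>k'. homotopic_with (\<lambda>f. f ` q ` A \<subseteq> q ` A) V V k k' \<and>
    (\<forall>a\<in>topspace C. \<forall>b\<in>topspace C. k' (Q (a, b)) = merge (1, a, b))"
proof (rule homotopic_lift[OF continuous_merge])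
  fix t :: real and a b :: "'a \<times> real" assume t: "t \<in> {0..1}" and ab: "a \<in> topspace C" "b \<in> topspace C"
  obtain x s where a: "a = (x, s)" "x \<in> topspace X" "s \<in> {0..1}" using ab(1) by auto
  obtain y s' where b: "b = (y, s')" "y \<in> topspace X" "s' \<in> {0..1}" using ab(2) by auto
  show "merge (t, a, b) = merge (t, (p, 0), b)" if "\<eta> a < 1"
  proof -
    \<comment> \<open>With \<alpha> zero the second point sits at \<open>r (1, y)\<close> whatever
      \<open>x\<close> is, and the first one is at the basepoint.\<close>
    have "\<alpha> (a, b) = 0" "\<alpha> ((p, 0), b) = 0" using that p0(3) by (simp_all add: \<alpha>_def)
    moreover have "\<kappa> (m (0, x, y), \<sigma> s) = base" "\<kappa> (m (0, p, y), \<sigma> 0) = base"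
      using \<kappa>_m_eq_base[of 0 x s y] \<kappa>_m_eq_base[of 0 p 0 y] that a b p p0(3) by auto
    ultimately show ?thesis
      unfolding a(1) b(1) merge_eq Q_eq using a b p by (simp add: m_0)
  qed
  have "m (t * \<alpha> (a, b), x, y) \<in> topspace X" "m (t * \<alpha> (a, b), y, x) \<in> topspace X"
    using m_in_X[OF scaled_in_unit_interval(1)[OF t]] a b by blast+
  then show "merge (t, a, b) = merge (t, b, a)"
    unfolding a(1) b(1) merge_eq using \<alpha>_commute[of "(x, s)" "(y, s')"] by (simp add: Q_commute)
next
  fix a b assume ab: "a \<in> topspace C" "b \<in> topspace C"
  then show "merge (0, a, b) = k (Q (a, b))"
    unfolding k[OF ab] by (auto simp: merge_eq m_0 squeeze_1)
next
  fix t :: real and l l' assume t: "t \<in> {0..1}" and l: "l \<in> topspace T" "l' \<in> topspace T" "B l = B l'"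
  show "merge (t, (fst l, fst (snd l)), fst l, snd (snd l)) = merge (t, (fst l', fst (snd l')), fst l', snd (snd l'))"
    unfolding merge_diag[OF t l(1)] merge_diag[OF t l(2)] by (rule B_squeeze[OF l(3,1,2)])
next
  fix t :: real and l assume "t \<in> {0..1}" "l \<in> topspace T"
  then show "merge (t, (fst l, fst (snd l)), fst l, snd (snd l)) \<in> B ` topspace T"
    unfolding merge_diag[OF \<open>t \<in> {0..1}\<close> \<open>l \<in> topspace T\<close>] by (intro imageI squeezed_in_T)
qed

end

text \<open>\<open>h\<close> contracts E to \<open>c\<close>, but it is given and continuous on
  \<open>T\<close>, and \<open>h_cong\<close> makes it depend on \<open>B l\<close> alone. So E as a
  quotient of \<open>T\<close> and E as a subspace of \<open>V\<close> need not be compared.\<close>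

locale quadratic_quotient_contraction = quadratic_quotient X p r w d m V q
  for X :: "'a topology" and p r w d m and V :: "'c topology" and q +
  fixes h :: "real \<times> 'a \<times> real \<times> real \<Rightarrow> 'c" and c :: 'c
  assumes h: "continuous_map (prod_topology unit_interval T) V h"
    and h_0: "l \<in> topspace T \<Longrightarrow> h (0, l) = B l"
    and h_1: "l \<in> topspace T \<Longrightarrow> h (1, l) = c"
    and h_B: "\<lbrakk>t \<in> {0..1}; l \<in> topspace T\<rbrakk> \<Longrightarrow> h (t, l) \<in> B ` topspace T"
    and h_cong: "\<lbrakk>t \<in> {0..1}; l \<in> topspace T; l' \<in> topspace T; B l = B l'\<rbrakk> \<Longrightarrow> h (t, l) = h (t, l')"
begin

text \<open>Applying \<open>h\<close> requires a point of \<open>T\<close> over the merged pair,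
  chosen continuously: height 0 stands in for a point that has reached the basepoint, and otherwise
  the common X-coordinate of a merged pair is used. Where neither is available, \<beta> is zero and
  the merged pair stays fixed.\<close>

definition contract :: "real \<times> ('a \<times> real) \<times> ('a \<times> real) \<Rightarrow> 'c" where
  "contract z =
    (if \<eta> (fst (snd z)) \<le> 3
     then h (fst z * \<beta> (snd z), m (\<alpha> (snd z), fst (snd (snd z)), fst (fst (snd z))), 0, \<sigma> (snd (snd (snd z))))
     else if \<eta> (snd (snd z)) \<le> 3
     then h (fst z * \<beta> (snd z), m (\<alpha> (snd z), fst (fst (snd z)), fst (snd (snd z))), \<sigma> (snd (fst (snd z))), 0)
     else if d (fst (fst (snd z)), fst (snd (snd z))) \<le> 1
     then h (fst z * \<beta> (snd z), m (\<alpha> (snd z), fst (fst (snd z)), fst (snd (snd z))),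
       \<sigma> (snd (fst (snd z))), \<sigma> (snd (snd (snd z))))
     else merge (1, snd z))"

lemma contract_eq: "contract (t, (x, s), (y, s')) =
    (if \<eta> (x, s) \<le> 3 then h (t * \<beta> ((x, s), (y, s')), m (\<alpha> ((x, s), (y, s')), y, x), 0, \<sigma> s')
     else if \<eta> (y, s') \<le> 3 then h (t * \<beta> ((x, s), (y, s')), m (\<alpha> ((x, s), (y, s')), x, y), \<sigma> s, 0)
     else if d (x, y) \<le> 1 then h (t * \<beta> ((x, s), (y, s')), m (\<alpha> ((x, s), (y, s')), x, y), \<sigma> s, \<sigma> s')
     else merge (1, (x, s), (y, s')))"
  by (simp add: contract_def)

context
  fixes x y :: 'a and s s' :: real
  assumes xy: "x \<in> topspace X" "y \<in> topspace X" and ss: "s \<in> {0..1}" "s' \<in> {0..1}"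
begin

abbreviation (input) "u \<equiv> ((x, s), (y, s'))"

lemma m_\<alpha>: "m (\<alpha> u, x, y) \<in> topspace X" "m (\<alpha> u, y, x) \<in> topspace X"
  by (rule m_in_X; use xy in simp)+

lemma B_merge_left:
  assumes "\<eta> (x, s) \<le> 3"
  shows "B (m (\<alpha> u, y, x), 0, \<sigma> s') = merge (1, u)"
  using \<kappa>_m_eq_base[OF _ xy(1) ss(1) xy(2) assms, of "\<alpha> u"] \<kappa>_0[OF m_\<alpha>(2)]
  by (simp add: merge_eq B_eq Q_eq)

lemma B_merge_right:
  assumes "\<eta> (y, s') \<le> 3"
  shows "B (m (\<alpha> u, x, y), \<sigma> s, 0) = merge (1, u)"
  using \<kappa>_m_eq_base[OF _ xy(2) ss(2) xy(1) assms, of "\<alpha> u"] \<kappa>_0[OF m_\<alpha>(1)]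
  by (simp add: merge_eq B_eq Q_eq)

lemma B_merge_close:
  assumes "2 \<le> \<eta> (x, s)" "2 \<le> \<eta> (y, s')" "d (x, y) \<le> 1"
  shows "B (m (\<alpha> u, x, y), \<sigma> s, \<sigma> s') = merge (1, u)"
  using \<alpha>_eq_1[OF assms(1,2)] m_1[OF xy assms(3)] by (simp add: merge_eq B_eq)

lemma \<beta>_eq_0:
  assumes "3 \<le> \<eta> (x, s)" "3 \<le> \<eta> (y, s')" "1 \<le> d (x, y)"
  shows "\<beta> u = 0"
  using assms by (simp add: \<beta>_def)

lemma in_T: "(m (\<alpha> u, y, x), 0, \<sigma> s') \<in> topspace T" "(m (\<alpha> u, x, y), \<sigma> s, 0) \<in> topspace T"
  "(m (\<alpha> u, x, y), \<sigma> s, \<sigma> s') \<in> topspace T"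
  using m_\<alpha> by auto

lemma contract_cases:
  assumes t: "t \<in> {0..1}"
  shows "t * \<beta> u = 0 \<and> contract (t, u) = merge (1, u) \<or>
    (\<exists>l\<in>topspace T. contract (t, u) = h (t * \<beta> u, l) \<and> B l = merge (1, u))"
proof -
  consider (left) "\<eta> (x, s) \<le> 3" | (right) "3 < \<eta> (x, s)" "\<eta> (y, s') \<le> 3"
    | (close) "3 < \<eta> (x, s)" "3 < \<eta> (y, s')" "d (x, y) \<le> 1"
    | (far) "3 < \<eta> (x, s)" "3 < \<eta> (y, s')" "1 < d (x, y)" by linarith
  then show ?thesis
  proof cases
    case left
    then show ?thesis using in_T(1) B_merge_left by (intro disjI2 bexI[OF _ in_T(1)]) (simp add: contract_eq)
  next
    case right
    then show ?thesis using B_merge_right by (intro disjI2 bexI[OF _ in_T(2)]) (simp add: contract_eq)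
  next
    case close
    then show ?thesis using B_merge_close by (intro disjI2 bexI[OF _ in_T(3)]) (simp add: contract_eq)
  next
    case far
    then show ?thesis using \<beta>_eq_0 by (simp add: contract_eq)
  qed
qed

text \<open>By \<open>h_cong\<close> the choice of the lift to \<open>T\<close> does not matter, and
  in the case without a chosen lift the time \<open>t * \<beta> u\<close> is 0 and
  \<open>h_0\<close> gives the same value. Symmetry and the values on \<open>A\<close> then need no
  further look at the branches.\<close>

lemma contract_determined:
  assumes t: "t \<in> {0..1}" and l: "l \<in> topspace T" "B l = merge (1, u)"
  shows "contract (t, u) = h (t * \<beta> u, l)"
  using contract_cases[OF t] h_0[OF l(1)] l(2) h_cong[OF scaled_in_unit_interval(2)[OF t] l(1)] by metis

end

lemma continuous_map_h:
  assumes "continuous_map Z unit_interval f" "continuous_map Z X g"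
    "continuous_map Z unit_interval k" "continuous_map Z unit_interval k'"
  shows "continuous_map Z V (\<lambda>z. h (f z, g z, k z, k' z))"
  by (intro continuous_map_comp[OF h] continuous_map_pairedI assms)

lemma continuous_contract: "continuous_map D V contract"
proof -
  have tb: "continuous_map D unit_interval (\<lambda>z. fst z * \<beta> (snd z))"
    by (intro continuous_map_scaled D_projections continuous_\<beta>)
  have m: "continuous_map D X (\<lambda>z. m (\<alpha> (snd z), fst (fst (snd z)), fst (snd (snd z))))"
    "continuous_map D X (\<lambda>z. m (\<alpha> (snd z), fst (snd (snd z)), fst (fst (snd z))))"
    by (intro continuous_map_m continuous_\<alpha> D_projections)+
  have s: "continuous_map D unit_interval (\<lambda>z. \<sigma> (snd (fst (snd z))))"
    "continuous_map D unit_interval (\<lambda>z. \<sigma> (snd (snd (snd z))))"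
    "continuous_map D unit_interval (\<lambda>z. 0)"
    by (intro continuous_map_\<sigma> D_projections, intro continuous_map_\<sigma> D_projections) simp
  have merge_1: "continuous_map D V (\<lambda>z. merge (1, snd z))"
    by (intro continuous_map_comp[OF continuous_merge] continuous_map_pairedI continuous_map_projections) simp
  have \<eta>: "continuous_map D euclideanreal (\<lambda>z. \<eta> (fst (snd z)))" "continuous_map D euclideanreal (\<lambda>z. \<eta> (snd (snd z)))"
    and d: "continuous_map D euclideanreal (\<lambda>z. d (fst (fst (snd z)), fst (snd (snd z))))"
    by (intro continuous_map_\<eta> continuous_map_d D_projections)+
  \<comment> \<open>On the overlaps of the closed pieces, two branches of \<open>h\<close> agree
    because their lifts have the same image under \<open>B\<close>, and a branch of \<open>h\<close>
    meets the stationary branch only where \<beta> is 0.\<close>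
  have branches: "h (fst z * \<beta> (snd z), l) = h (fst z * \<beta> (snd z), l')"
    if "z \<in> topspace D" "l \<in> topspace T" "l' \<in> topspace T" "B l = B l'" for z l l'
    using that by (intro h_cong scaled_in_unit_interval) auto
  have far: "h (fst z * \<beta> (snd z), l) = merge (1, snd z)"
    if "\<beta> (snd z) = 0" "l \<in> topspace T" "B l = merge (1, snd z)" for z l
    using that h_0 by simp
  have split: "\<exists>t x s y s'. z = (t, (x, s), (y, s')) \<and> t \<in> {0..1} \<and> x \<in> topspace X \<and> s \<in> {0..1}
    \<and> y \<in> topspace X \<and> s' \<in> {0..1}" if "z \<in> topspace D" for z
    using that by (cases z) auto
  show ?thesis
    unfolding contract_def[abs_def]
  proof (rule continuous_map_cases_le[OF \<eta>(1) continuous_map_canonical_const])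
    let ?D1 = "subtopology D {z \<in> topspace D. 3 \<le> \<eta> (fst (snd z))}"
    let ?D2 = "subtopology ?D1 {z \<in> topspace ?D1. 3 \<le> \<eta> (snd (snd z))}"
    have D1: "z \<in> topspace D" "3 \<le> \<eta> (fst (snd z))" if "z \<in> topspace ?D1" for z
      using that by (auto simp: topspace_subtopology simp del: topspace_prod_topology)
    have D2: "z \<in> topspace D" "3 \<le> \<eta> (fst (snd z))" "3 \<le> \<eta> (snd (snd z))" if "z \<in> topspace ?D2" for z
      using that by (auto simp: topspace_subtopology simp del: topspace_prod_topology)
    show "continuous_map (subtopology D {z \<in> topspace D. \<eta> (fst (snd z)) \<le> 3}) V
        (\<lambda>z. h (fst z * \<beta> (snd z), m (\<alpha> (snd z), fst (snd (snd z)), fst (fst (snd z))), 0, \<sigma> (snd (snd (snd z)))))"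
      by (intro continuous_map_from_subtopology continuous_map_h tb m s)
    show "continuous_map ?D1 V (\<lambda>z. if \<eta> (snd (snd z)) \<le> 3
     then h (fst z * \<beta> (snd z), m (\<alpha> (snd z), fst (fst (snd z)), fst (snd (snd z))), \<sigma> (snd (fst (snd z))), 0)
     else if d (fst (fst (snd z)), fst (snd (snd z))) \<le> 1
     then h (fst z * \<beta> (snd z), m (\<alpha> (snd z), fst (fst (snd z)), fst (snd (snd z))),
       \<sigma> (snd (fst (snd z))), \<sigma> (snd (snd (snd z))))
     else merge (1, snd z))"
    proof (rule continuous_map_cases_le[OF continuous_map_from_subtopology[OF \<eta>(2)] continuous_map_canonical_const])
      show "continuous_map (subtopology ?D1 {z \<in> topspace ?D1. \<eta> (snd (snd z)) \<le> 3}) V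
        (\<lambda>z. h (fst z * \<beta> (snd z), m (\<alpha> (snd z), fst (fst (snd z)), fst (snd (snd z))), \<sigma> (snd (fst (snd z))), 0))"
        by (intro continuous_map_from_subtopology continuous_map_h tb m s)
      show "continuous_map ?D2 V (\<lambda>z. if d (fst (fst (snd z)), fst (snd (snd z))) \<le> 1
       then h (fst z * \<beta> (snd z), m (\<alpha> (snd z), fst (fst (snd z)), fst (snd (snd z))),
         \<sigma> (snd (fst (snd z))), \<sigma> (snd (snd (snd z))))
       else merge (1, snd z))"
      proof (rule continuous_map_cases_le)
        show "h (fst z * \<beta> (snd z), m (\<alpha> (snd z), fst (fst (snd z)), fst (snd (snd z))),
            \<sigma> (snd (fst (snd z))), \<sigma> (snd (snd (snd z)))) = merge (1, snd z)"
          if z: "z \<in> topspace ?D2" and eq: "d (fst (fst (snd z)), fst (snd (snd z))) = 1" for z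
        proof -
          obtain t x s y s' where *: "z = (t, (x, s), (y, s'))" "t \<in> {0..1}" "x \<in> topspace X" "y \<in> topspace X"
            "s \<in> {0..1}" "s' \<in> {0..1}" using split[OF D2(1)[OF z]] by blast
          show ?thesis
            using D2[OF z] eq far[of z "(m (\<alpha> ((x, s), (y, s')), x, y), \<sigma> s, \<sigma> s')"] in_T(3)[OF *(3-6)]
              \<beta>_eq_0[OF *(3-6)] B_merge_close[OF *(3-6)] by (simp add: *(1) del: topspace_prod_topology)
        qed
      qed (intro continuous_map_canonical_const continuous_map_from_subtopology continuous_map_h tb m s d merge_1)+
    next
      fix z assume z: "z \<in> topspace ?D1" and eq: "\<eta> (snd (snd z)) = 3"
      obtain t x s y s' where *: "z = (t, (x, s), (y, s'))" "t \<in> {0..1}" "x \<in> topspace X" "y \<in> topspace X"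
        "s \<in> {0..1}" "s' \<in> {0..1}" using split[OF D1(1)[OF z]] by blast
      show "h (fst z * \<beta> (snd z), m (\<alpha> (snd z), fst (fst (snd z)), fst (snd (snd z))), \<sigma> (snd (fst (snd z))), 0) =
        (if d (fst (fst (snd z)), fst (snd (snd z))) \<le> 1
         then h (fst z * \<beta> (snd z), m (\<alpha> (snd z), fst (fst (snd z)), fst (snd (snd z))),
           \<sigma> (snd (fst (snd z))), \<sigma> (snd (snd (snd z))))
         else merge (1, snd z))"
        using D1[OF z] eq far[of z "(m (\<alpha> ((x, s), (y, s')), x, y), \<sigma> s, 0)"] in_T[OF *(3-6)]
          branches[OF D1(1)[OF z] in_T(2)[OF *(3-6)] in_T(3)[OF *(3-6)]]
          \<beta>_eq_0[OF *(3-6)] B_merge_close[OF *(3-6)] B_merge_right[OF *(3-6)]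
        by (simp add: *(1) del: topspace_prod_topology)
    qed
  next
    fix z assume z: "z \<in> topspace D" and eq: "\<eta> (fst (snd z)) = 3"
    obtain t x s y s' where *: "z = (t, (x, s), (y, s'))" "t \<in> {0..1}" "x \<in> topspace X" "y \<in> topspace X"
      "s \<in> {0..1}" "s' \<in> {0..1}" using split[OF z] by blast
    show "h (fst z * \<beta> (snd z), m (\<alpha> (snd z), fst (snd (snd z)), fst (fst (snd z))), 0, \<sigma> (snd (snd (snd z)))) =
     (if \<eta> (snd (snd z)) \<le> 3
     then h (fst z * \<beta> (snd z), m (\<alpha> (snd z), fst (fst (snd z)), fst (snd (snd z))), \<sigma> (snd (fst (snd z))), 0)
     else if d (fst (fst (snd z)), fst (snd (snd z))) \<le> 1
     then h (fst z * \<beta> (snd z), m (\<alpha> (snd z), fst (fst (snd z)), fst (snd (snd z))),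
       \<sigma> (snd (fst (snd z))), \<sigma> (snd (snd (snd z))))
     else merge (1, snd z))"
      using z eq far[of z "(m (\<alpha> ((x, s), (y, s')), y, x), 0, \<sigma> s')"] in_T[OF *(3-6)]
        branches[OF z in_T(1)[OF *(3-6)] in_T(2)[OF *(3-6)]]
        branches[OF z in_T(1)[OF *(3-6)] in_T(3)[OF *(3-6)]]
        \<beta>_eq_0[OF *(3-6)] B_merge_close[OF *(3-6)] B_merge_left[OF *(3-6)] B_merge_right[OF *(3-6)]
      by (simp add: *(1) del: topspace_prod_topology)
  qed
qed

text \<open>\<open>d (x, x) = 0\<close> makes \<beta> equal to 1, so on \<open>A\<close> the
  contraction runs at full speed, applied to the squeezed heights and X-coordinate.\<close>

lemma contract_diag:
  assumes t: "t \<in> {0..1}" and l: "l \<in> topspace T"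
  shows "contract (t, (fst l, fst (snd l)), (fst l, snd (snd l))) = h (t, r (1, fst l), \<sigma> (fst (snd l)), \<sigma> (snd (snd l)))"
proof -
  have x: "fst l \<in> topspace X" "fst (snd l) \<in> {0..1}" "snd (snd l) \<in> {0..1}" using l by auto
  have "\<beta> ((fst l, fst (snd l)), (fst l, snd (snd l))) = 1"
    using d_self[OF x(1)] by (simp add: \<beta>_def)
  then show ?thesis
    using contract_determined[OF x(1,1,2,3) t squeezed_in_T[OF l]] merge_diag[OF _ l, of 1] by simp
qed

text \<open>The branches treat \<open>a\<close> and \<open>b\<close> asymmetrically and choose
  different lifts when both are near the basepoint; but \<open>merge\<close> is symmetric, and it
  determines the value.\<close>

lemma contract_commute:
  assumes t: "t \<in> {0..1}" and ab: "a \<in> topspace C" "b \<in> topspace C"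
  shows "contract (t, a, b) = contract (t, b, a)"
proof -
  obtain x s where a: "a = (x, s)" "x \<in> topspace X" "s \<in> {0..1}" using ab(1) by auto
  obtain y s' where b: "b = (y, s')" "y \<in> topspace X" "s' \<in> {0..1}" using ab(2) by auto
  have "m (\<alpha> (a, b), x, y) \<in> topspace X" "m (\<alpha> (a, b), y, x) \<in> topspace X"
    using m_\<alpha>[OF a(2) b(2) a(3) b(3)] unfolding a(1) b(1) by blast+
  then have merge: "merge (1, a, b) = merge (1, b, a)"
    unfolding a(1) b(1) merge_eq using \<alpha>_commute[of "(x, s)" "(y, s')"] by (simp add: Q_commute)
  have \<beta>: "\<beta> (a, b) = \<beta> (b, a)" using \<beta>_commute a b by simp
  note ab_cases = contract_cases[OF a(2) b(2) a(3) b(3) t, folded a(1) b(1)]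
  note ba_cases = contract_cases[OF b(2) a(2) b(3) a(3) t, folded a(1) b(1)]
  note determined = contract_determined[OF b(2) a(2) b(3) a(3) t, folded a(1) b(1)]
  show ?thesis
    using ab_cases
  proof
    assume 1: "t * \<beta> (a, b) = 0 \<and> contract (t, a, b) = merge (1, a, b)"
    show ?thesis using ba_cases 1 merge h_0 by (auto simp: \<beta>)
  next
    assume "\<exists>l\<in>topspace T. contract (t, a, b) = h (t * \<beta> (a, b), l) \<and> B l = merge (1, a, b)"
    then show ?thesis using determined merge \<beta> by auto
  qed
qed

lemma contract_0:
  assumes ab: "a \<in> topspace C" "b \<in> topspace C"
  shows "contract (0, a, b) = merge (1, a, b)"
proof -
  obtain x s where a: "a = (x, s)" "x \<in> topspace X" "s \<in> {0..1}" using ab(1) by auto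
  obtain y s' where b: "b = (y, s')" "y \<in> topspace X" "s' \<in> {0..1}" using ab(2) by auto
  show ?thesis
    using contract_cases[OF a(2) b(2) a(3) b(3), of 0] h_0 unfolding a(1) b(1) by auto
qed

lemma contract_left:
  assumes t: "t \<in> {0..1}" and ab: "a \<in> topspace C" "b \<in> topspace C" and \<eta>: "\<eta> a < 1"
  shows "contract (t, a, b) = contract (t, (p, 0), b)"
proof -
  obtain x s where a: "a = (x, s)" "x \<in> topspace X" "s \<in> {0..1}" using ab(1) by auto
  obtain y s' where b: "b = (y, s')" "y \<in> topspace X" "s' \<in> {0..1}" using ab(2) by auto
  have "\<alpha> (a, b) = 0" "\<alpha> ((p, 0), b) = 0" "\<beta> (a, b) = 1" "\<beta> ((p, 0), b) = 1"
    using \<eta> p0(3) by (simp_all add: \<alpha>_def \<beta>_def)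
  then show ?thesis
    using \<eta> p0(3) a b p by (simp add: contract_eq m_0)
qed

theorem contracting_homotopy:
  "\<exists>k. homotopic_with (\<lambda>f. f ` q ` A \<subseteq> q ` A) V V id k \<and> k ` q ` A \<subseteq> {c}"
proof -
  obtain k1 where k1: "homotopic_with (\<lambda>f. f ` q ` A \<subseteq> q ` A) V V id k1"
    "\<forall>a\<in>topspace C. \<forall>b\<in>topspace C. k1 (Q (a, b)) = Q (squeeze (1, a), squeeze (1, b))"
    using homotopic_squeeze by blast
  obtain k2 where k2: "homotopic_with (\<lambda>f. f ` q ` A \<subseteq> q ` A) V V k1 k2"
    "\<forall>a\<in>topspace C. \<forall>b\<in>topspace C. k2 (Q (a, b)) = merge (1, a, b)"
    using homotopic_merge[of k1] k1(2) by blast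
  have "\<exists>k3. homotopic_with (\<lambda>f. f ` q ` A \<subseteq> q ` A) V V k2 k3 \<and>
    (\<forall>a\<in>topspace C. \<forall>b\<in>topspace C. k3 (Q (a, b)) = contract (1, a, b))"
  proof (rule homotopic_lift[OF continuous_contract contract_left contract_commute])
    fix t :: real and l l' assume t: "t \<in> {0..1}" and l: "l \<in> topspace T" "l' \<in> topspace T" "B l = B l'"
    show "contract (t, (fst l, fst (snd l)), fst l, snd (snd l)) = contract (t, (fst l', fst (snd l')), fst l', snd (snd l'))"
      unfolding contract_diag[OF t l(1)] contract_diag[OF t l(2)]
      by (rule h_cong[OF t squeezed_in_T[OF l(1)] squeezed_in_T[OF l(2)] B_squeeze[OF l(3,1,2)]])
  next
    fix t :: real and l assume t: "t \<in> {0..1}" and l: "l \<in> topspace T"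
    show "contract (t, (fst l, fst (snd l)), fst l, snd (snd l)) \<in> B ` topspace T"
      unfolding contract_diag[OF t l] by (rule h_B[OF t squeezed_in_T[OF l]])
  next
    fix a b assume "a \<in> topspace C" "b \<in> topspace C"
    then show "contract (0, a, b) = k2 (Q (a, b))" using k2(2) contract_0 by (simp del: topspace_prod_topology)
  qed
  then obtain k3 where k3: "homotopic_with (\<lambda>f. f ` q ` A \<subseteq> q ` A) V V k2 k3"
    "\<forall>a\<in>topspace C. \<forall>b\<in>topspace C. k3 (Q (a, b)) = contract (1, a, b)"
    by blast
  have "k3 (B l) = c" if l: "l \<in> topspace T" for l
  proof -
    have "(fst l, fst (snd l)) \<in> topspace C" "(fst l, snd (snd l)) \<in> topspace C" using l by auto
    then have "k3 (B l) = contract (1, (fst l, fst (snd l)), (fst l, snd (snd l)))"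
      using k3(2) unfolding B_def by blast
    then show ?thesis using contract_diag[OF _ l, of 1] h_1[OF squeezed_in_T[OF l]] by simp
  qed
  then have "k3 ` q ` A \<subseteq> {c}" unfolding q_A by blast
  with homotopic_with_trans[OF homotopic_with_trans[OF k1(1) k2(1)] k3(1)] show ?thesis by blast
qed

end

text \<open>A quotient map need not restrict to one over a subspace. Here closed sets help: a triple
  whose set contains \<open>y0\<close> has it in one of three places, and each place contributes a
  closed set because \<open>{y0}\<close> is closed.\<close>

lemma quotient_map_Sub3_based:
  fixes Y :: "'a topology"
  assumes y0: "y0 \<in> topspace Y" and closed: "closedin Y {y0}"
  shows "quotient_map (prod_topology Y Y) (Sub3_based Y y0) (\<lambda>(a, b). {y0, a, b})"
proof -
  let ?Y3 = "prod_topology Y (prod_topology Y Y)"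
  let ?q3 = "\<lambda>(a, b, c). {a, b, c}"
  have q3: "quotient_map ?Y3 (Sub3 Y) ?q3"
    unfolding Sub3_def by (rule quotient_map_quotient_topology)
  have top: "topspace (Sub3_based Y y0) = {S \<in> topspace (Sub3 Y). y0 \<in> S}"
    by (auto simp: Sub3_based_def)
  have "continuous_map (prod_topology Y Y) ?Y3 (\<lambda>z. (y0, fst z, snd z))"
    by (intro continuous_map_pairedI continuous_map_projections) (simp add: y0)
  then have "continuous_map (prod_topology Y Y) (Sub3 Y) (\<lambda>z. ?q3 (y0, fst z, snd z))"
    by (rule continuous_map_comp[OF quotient_imp_continuous_map[OF q3]])
  then have cont: "continuous_map (prod_topology Y Y) (Sub3_based Y y0) (\<lambda>(a, b). {y0, a, b})"
    unfolding Sub3_based_def by (auto simp: continuous_map_in_subtopology case_prod_unfold)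
  show ?thesis
    unfolding quotient_map_closedin
  proof (intro conjI allI impI iffI)
    show "(\<lambda>(a, b). {y0, a, b}) ` topspace (prod_topology Y Y) = topspace (Sub3_based Y y0)"
    proof
      show "(\<lambda>(a, b). {y0, a, b}) ` topspace (prod_topology Y Y) \<subseteq> topspace (Sub3_based Y y0)"
        by (rule continuous_map_image_subset_topspace[OF cont])
      show "topspace (Sub3_based Y y0) \<subseteq> (\<lambda>(a, b). {y0, a, b}) ` topspace (prod_topology Y Y)"
      proof
        fix S assume "S \<in> topspace (Sub3_based Y y0)"
        then have "S \<in> ?q3 ` topspace ?Y3" "y0 \<in> S"
          using top quotient_imp_surjective_map[OF q3] by auto
        then obtain a b c where abc: "S = {a, b, c}" "a \<in> topspace Y" "b \<in> topspace Y" "c \<in> topspace Y"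
          by auto
        then have "S = {y0, b, c} \<or> S = {y0, a, c} \<or> S = {y0, a, b}" using \<open>y0 \<in> S\<close> by auto
        then show "S \<in> (\<lambda>(a, b). {y0, a, b}) ` topspace (prod_topology Y Y)"
        proof (elim disjE)
          show ?thesis if "S = {y0, b, c}" using that abc(3,4) by (intro image_eqI[of _ _ "(b, c)"]) simp_all
          show ?thesis if "S = {y0, a, c}" using that abc(2,4) by (intro image_eqI[of _ _ "(a, c)"]) simp_all
          show ?thesis if "S = {y0, a, b}" using that abc(2,3) by (intro image_eqI[of _ _ "(a, b)"]) simp_all
        qed
      qed
    qed
  next
    fix U assume "closedin (Sub3_based Y y0) U"
    then show "closedin (prod_topology Y Y) {x \<in> topspace (prod_topology Y Y). (case x of (a, b) \<Rightarrow> {y0, a, b}) \<in> U}"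
      by (rule closedin_continuous_map_preimage[OF cont])
  next
    fix U assume U: "U \<subseteq> topspace (Sub3_based Y y0)"
      and "closedin (prod_topology Y Y) {x \<in> topspace (prod_topology Y Y). (case x of (a, b) \<Rightarrow> {y0, a, b}) \<in> U}"
        (is "closedin _ ?P")
    then have pre: "closedin ?Y3 ({z \<in> topspace ?Y3. f z \<in> {y0}} \<inter> {z \<in> topspace ?Y3. g z \<in> ?P})"
      if "continuous_map ?Y3 Y f" "continuous_map ?Y3 (prod_topology Y Y) g" for f g
      using closed that by (intro closedin_Int closedin_continuous_map_preimage[of _ Y]
          closedin_continuous_map_preimage[of _ "prod_topology Y Y"])
    have "{z \<in> topspace ?Y3. ?q3 z \<in> U} =
        ({z \<in> topspace ?Y3. fst z \<in> {y0}} \<inter> {z \<in> topspace ?Y3. snd z \<in> ?P}) \<union>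
        (({z \<in> topspace ?Y3. fst (snd z) \<in> {y0}} \<inter> {z \<in> topspace ?Y3. (fst z, snd (snd z)) \<in> ?P}) \<union>
        ({z \<in> topspace ?Y3. snd (snd z) \<in> {y0}} \<inter> {z \<in> topspace ?Y3. (fst z, fst (snd z)) \<in> ?P}))"
      (is "?L = ?R")
    proof (rule set_eqI)
      fix z :: "'a \<times> 'a \<times> 'a"
      obtain a b c where z: "z = (a, b, c)" by (metis prod_cases3)
      have "a = y0 \<or> b = y0 \<or> c = y0" if "{a, b, c} \<in> U"
        using subsetD[OF U that] unfolding top by auto
      moreover have "{a, y0, c} = {y0, a, c}" "{a, b, y0} = {y0, a, b}" by auto
      ultimately show "z \<in> ?L \<longleftrightarrow> z \<in> ?R" using y0 unfolding z by auto
    qed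
    moreover have "closedin ?Y3 ?R"
      by (intro closedin_Un pre continuous_map_pairedI continuous_map_projections)
    ultimately have "closedin ?Y3 ?L" by simp
    then have "closedin (Sub3 Y) U"
      using q3 U top unfolding quotient_map_closedin by blast
    then show "closedin (Sub3_based Y y0) U"
      unfolding Sub3_based_def by (rule closedin_subset_topspace) (use U top in auto)
  qed
qed

lemma quotient_map_reduced_SP2:
  "quotient_map (prod_topology Y Y) (reduced_SP2 Y y0)
    (\<lambda>(a, b). collapse_class ((\<lambda>y. sp2_class y y0) ` topspace Y) (sp2_class a b))"
proof -
  have "quotient_map (prod_topology Y Y) (reduced_SP2 Y y0)
      (collapse_class ((\<lambda>y. sp2_class y y0) ` topspace Y) \<circ> (\<lambda>(a, b). sp2_class a b))"
    unfolding reduced_SP2_def collapse_space_def SP2_def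
    by (rule quotient_map_compose[OF quotient_map_quotient_topology quotient_map_quotient_topology])
  then show ?thesis by (simp add: o_def case_prod_unfold)
qed

lemma sp2_class_eq_iff: "sp2_class a b = sp2_class a' b' \<longleftrightarrow> a' = a \<and> b' = b \<or> a' = b \<and> b' = a"
  by (auto simp: sp2_class_def doubleton_eq_iff)

lemma sp2_class_commute: "sp2_class a b = sp2_class b a"
  by (auto simp: sp2_class_def)

lemma sp2_class_in_axis_iff:
  assumes "a \<in> topspace Y" "b \<in> topspace Y" "y0 \<in> topspace Y"
  shows "sp2_class a b \<in> (\<lambda>y. sp2_class y y0) ` topspace Y \<longleftrightarrow> a = y0 \<or> b = y0"
  using assms by (auto simp: sp2_class_eq_iff image_iff)

lemma collapse_class_eq_iff: "collapse_class S a = collapse_class S b \<longleftrightarrow> a = b \<or> a \<in> S \<and> b \<in> S"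
  by (auto simp: collapse_class_def)

context equiconnected
begin

lemma closedin_base: "closedin Y {base}"
proof -
  have "{y \<in> topspace Y. \<eta> (rep y) \<in> - {0}} = topspace Y - {base}"
  proof -
    have "\<eta> (rep y) = 0 \<longleftrightarrow> y = base" if "y \<in> topspace Y" for y
      using \<kappa>_eq_base[OF rep_in_C[OF that]] \<kappa>_rep[OF that] by simp
    then show ?thesis by auto
  qed
  then show ?thesis
    using openin_Y_\<eta>[of "- {0}"] base_in_Y by (simp add: closedin_def open_Compl)
qed

lemma axis_subset_A:
  assumes "y \<in> topspace Y"
  shows "(base, y) \<in> A" "(y, base) \<in> A" "(y, y) \<in> A"
proof -
  obtain x s where y: "y = \<kappa> (x, s)" "x \<in> topspace X" "s \<in> {0..1}"
    using assms unfolding topspace_Y by auto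
  show "(base, y) \<in> A" "(y, base) \<in> A" "(y, y) \<in> A"
    using y \<kappa>_0[OF y(2)] unfolding A_def
    by (force intro: exI[of _ x] exI[of _ s] exI[of _ 0])+
qed

lemma quadratic_quotient_Sub3_based:
  "quadratic_quotient X p r w d m (Sub3_based Y base) (\<lambda>(a, b). {base, a, b})"
proof unfold_locales
  show "quotient_map (prod_topology Y Y) (Sub3_based Y base) (\<lambda>(a, b). {base, a, b})"
    by (rule quotient_map_Sub3_based[OF base_in_Y closedin_base])
next
  fix a b
  show "(case (a, b) of (a, b) \<Rightarrow> {base, a, b}) = (case (b, a) of (a, b) \<Rightarrow> {base, a, b})" by auto
next
  fix a b a' b' assume Y: "a \<in> topspace Y" "b \<in> topspace Y" "a' \<in> topspace Y" "b' \<in> topspace Y"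
    and "(case (a, b) of (a, b) \<Rightarrow> {base, a, b}) = (case (a', b') of (a, b) \<Rightarrow> {base, a, b})"
  then have eq: "{base, a, b} = {base, a', b'}" by simp
  show "a' = a \<and> b' = b \<or> a' = b \<and> b' = a \<or> (a, b) \<in> A \<and> (a', b') \<in> A"
  proof (cases "a \<noteq> base \<and> b \<noteq> base \<and> a \<noteq> b")
    case True
    then have "a' = a \<and> b' = b \<or> a' = b \<and> b' = a" using eq by (metis empty_iff insert_iff)
    then show ?thesis by blast
  next
    case False
    \<comment> \<open>If the common set has fewer than three elements, each of the two pairs lies on
      an axis or on the diagonal.\<close>
    then have "a' = base \<or> b' = base \<or> a' = b'" using eq by (metis empty_iff insert_iff)
    with False show ?thesis using axis_subset_A Y by blast
  qed
next
  fix \<phi> :: "('a \<times> real) set \<Rightarrow> ('a \<times> real) set" and a b a' b'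
  assume "\<phi> base = base" and "(case (a, b) of (a, b) \<Rightarrow> {base, a, b}) = (case (a', b') of (a, b) \<Rightarrow> {base, a, b})"
  then have "\<phi> ` {base, a, b} = \<phi> ` {base, a', b'}" "\<phi> base = base" by simp_all
  then show "(case (\<phi> a, \<phi> b) of (a, b) \<Rightarrow> {base, a, b}) = (case (\<phi> a', \<phi> b') of (a, b) \<Rightarrow> {base, a, b})"
    by simp
qed

lemma quadratic_quotient_reduced_SP2:
  "quadratic_quotient X p r w d m (reduced_SP2 Y base)
    (\<lambda>(a, b). collapse_class ((\<lambda>y. sp2_class y base) ` topspace Y) (sp2_class a b))"
  (is "quadratic_quotient _ _ _ _ _ _ _ ?q")
proof -
  have q_eq: "?q (a, b) = ?q (a', b') \<longleftrightarrow> a' = a \<and> b' = b \<or> a' = b \<and> b' = a \<or>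
      (a = base \<or> b = base) \<and> (a' = base \<or> b' = base)"
    if "a \<in> topspace Y" "b \<in> topspace Y" "a' \<in> topspace Y" "b' \<in> topspace Y" for a b a' b'
    using that base_in_Y by (simp add: collapse_class_eq_iff sp2_class_eq_iff sp2_class_in_axis_iff)
  show ?thesis
  proof unfold_locales
    show "quotient_map (prod_topology Y Y) (reduced_SP2 Y base) ?q"
      by (rule quotient_map_reduced_SP2)
  next
    fix a b assume "a \<in> topspace Y" "b \<in> topspace Y"
    then show "?q (a, b) = ?q (b, a)" by (simp add: sp2_class_commute)
  next
    fix a b a' b' assume Y: "a \<in> topspace Y" "b \<in> topspace Y" "a' \<in> topspace Y" "b' \<in> topspace Y"
      and eq: "?q (a, b) = ?q (a', b')"
    then show "a' = a \<and> b' = b \<or> a' = b \<and> b' = a \<or> (a, b) \<in> A \<and> (a', b') \<in> A"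
      using q_eq[OF Y] axis_subset_A by blast
  next
    fix \<phi> a b a' b'
    assume \<phi>: "\<phi> \<in> topspace Y \<rightarrow> topspace Y" "\<phi> base = base"
      and Y: "a \<in> topspace Y" "b \<in> topspace Y" "a' \<in> topspace Y" "b' \<in> topspace Y"
      and eq: "?q (a, b) = ?q (a', b')"
    have "\<phi> a \<in> topspace Y" "\<phi> b \<in> topspace Y" "\<phi> a' \<in> topspace Y" "\<phi> b' \<in> topspace Y"
      using \<phi>(1) Y by auto
    note E = q_eq[OF this]
    show "?q (\<phi> a, \<phi> b) = ?q (\<phi> a', \<phi> b')"
      unfolding E using iffD1[OF q_eq[OF Y] eq] \<phi>(2) by auto
  qed
qed

end

section \<open>Contracting the disc and the dunce hat\<close>

text \<open>The triangle \<open>0 \<le> a \<le> b \<le> 1\<close> with its three edges identified is the dunce hat; \<open>depth\<close> is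
  measured from the edges \<open>b = 1\<close> and \<open>a = b\<close>. Folding these two edges together reduces the attaching word
  \<open>e e e\<^sup>-\<^sup>1\<close> to \<open>e\<close>: \<open>\<phi>1\<close> blows up an inner triangle and stretches its two edges over a collar, \<open>\<phi>2\<close>
  bends the collar until its curve of depth \<open>1/4\<close> lies at the vertex, and \<open>\<phi>3\<close> contracts the triangle
  inside that curve.\<close>

definition depth :: "real \<Rightarrow> real \<Rightarrow> real" where
  "depth a b = min (1 - b) (b - a)"

text \<open>The part of depth at least \<open>3 * t / 8\<close> is the triangle scaled by
  \<open>1 - 3 * t / 4\<close>. The collar goes to the edge \<open>a = 0\<close> by a formula in
  \<open>a\<close> and the depth only, which gives the two legs of each depth curve the same image:
  this is the folding.\<close>

definition \<phi>1 :: "real \<Rightarrow> real \<Rightarrow> real \<Rightarrow> real \<times> real" where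
  "\<phi>1 t a b = (if depth a b \<le> 3 * t / 8
    then (0, clamp01 ((a - 3 * t / 8 + depth a b) / (1 - 3 * t / 4)))
    else (clamp01 (a / (1 - 3 * t / 4)), clamp01 ((b - 3 * t / 8) / (1 - 3 * t / 4))))"

text \<open>Only the depth term changes, from \<open>4 * depth a b\<close> to a profile with the
  same values 0 at depth 0 and 3/2 at depth 3/8. At depth 1/4 the new profile is -1/2, and
  \<open>a \<le> 1/2\<close> there, so the argument of \<open>clamp01\<close> is at most 0.\<close>

definition \<phi>2 :: "real \<Rightarrow> real \<Rightarrow> real \<Rightarrow> real \<times> real" where
  "\<phi>2 t a b = (if depth a b \<le> 3 / 8
    then (0, clamp01 (4 * a - 3 / 2 + ((1 - t) * (4 * depth a b) + t * max (- 4 * depth a b) (16 * depth a b - 9 / 2))))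
    else (clamp01 (4 * a), clamp01 (4 * b - 3 / 2)))"

text \<open>The end of \<open>\<phi>2\<close> inside the curve of depth 1/4, read in that triangle
  magnified by 2: the edges \<open>b = 1\<close> and \<open>a = b\<close> go to the vertex. Depth
  1/4 in the magnified triangle is depth \<open>1/4 + 1/8 = 3/8\<close> in the original one, the
  origin of the 3/8 above.\<close>

definition \<psi> :: "real \<Rightarrow> real \<Rightarrow> real \<times> real" where
  "\<psi> a b = (if depth a b \<le> 1 / 4
    then (0, clamp01 (2 * a - 2 + 8 * depth a b))
    else (clamp01 (2 * a), clamp01 (2 * b - 1 / 2)))"

text \<open>Up to the parameter of the basepoint, \<open>\<phi>2 1\<close> factors through \<psi>:
  inside by magnification, on the collar through the edge \<open>a = 0\<close>. Sliding the first
  argument of \<psi> to the second then contracts everything, since \<psi> sends the diagonal to the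
  vertex.\<close>

definition \<phi>3 :: "real \<Rightarrow> real \<Rightarrow> real \<Rightarrow> real \<times> real" where
  "\<phi>3 t a b = (if depth a b \<le> 1 / 4
    then \<psi> (t * clamp01 (2 * a - 1 / 2 - 2 * depth a b)) (clamp01 (2 * a - 1 / 2 - 2 * depth a b))
    else \<psi> (clamp01 (2 * a) + t * (clamp01 (2 * b - 1 / 2) - clamp01 (2 * a))) (clamp01 (2 * b - 1 / 2)))"

lemma \<phi>_range: "\<phi>1 t a b \<in> {0..1} \<times> {0..1}" "\<phi>2 t a b \<in> {0..1} \<times> {0..1}" "\<phi>3 t a b \<in> {0..1} \<times> {0..1}"
  by (auto simp: \<phi>1_def \<phi>2_def \<phi>3_def \<psi>_def)

lemma \<psi>_edge: "u \<le> 1 \<Longrightarrow> \<psi> u 1 = (0, 0)" "u \<le> 1 \<Longrightarrow> \<psi> u u = (0, 0)"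
  by (simp_all add: \<psi>_def depth_def)

lemma depth_diag: "y \<le> 1 \<Longrightarrow> depth y y = 0" "y \<le> 1 \<Longrightarrow> depth y 1 = 0" "depth 0 y = min (1 - y) y"
  by (simp_all add: depth_def)

lemma convex_le:
  fixes t u v c :: real
  assumes "0 \<le> t" "t \<le> 1" "u \<le> c" "v \<le> c"
  shows "(1 - t) * u + t * v \<le> c"
  using convex_bound_le[of u c v "1 - t" t] assms by simp

text \<open>Compatibility with the identification of the three edges. On \<open>a = 0\<close> the
  collar has parameter 0 where the other edges may have parameter 1; both stand for the basepoint,
  whence the disjunction.\<close>

lemma \<phi>1_edges:
  assumes "0 \<le> t" "t \<le> 1" "0 \<le> y" "y \<le> 1"
  shows "\<phi>1 t y y = (0, clamp01 ((y - 3 * t / 8) / (1 - 3 * t / 4)))" "\<phi>1 t y 1 = \<phi>1 t y y"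
    "\<phi>1 t 0 y = \<phi>1 t y y \<or> \<phi>1 t 0 y = (0, 0) \<and> \<phi>1 t y y = (0, 1)"
proof -
  show 1: "\<phi>1 t y y = (0, clamp01 ((y - 3 * t / 8) / (1 - 3 * t / 4)))"
    using assms by (simp add: \<phi>1_def depth_diag)
  then show "\<phi>1 t y 1 = \<phi>1 t y y"
    using assms by (simp add: \<phi>1_def depth_diag)
  show "\<phi>1 t 0 y = \<phi>1 t y y \<or> \<phi>1 t 0 y = (0, 0) \<and> \<phi>1 t y y = (0, 1)"
  proof (cases "depth 0 y \<le> 3 * t / 8")
    case True
    have "(0 - 3 * t / 8 + depth 0 y) / (1 - 3 * t / 4) \<le> 0"
      using True assms by (intro divide_nonpos_nonneg) auto
    then have 0: "\<phi>1 t 0 y = (0, 0)" using True by (simp add: \<phi>1_def)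
    have "y \<le> 3 * t / 8 \<or> 1 - y \<le> 3 * t / 8" using True unfolding depth_diag(3) min_le_iff_disj by blast
    then show ?thesis
    proof
      assume "y \<le> 3 * t / 8"
      then have "(y - 3 * t / 8) / (1 - 3 * t / 4) \<le> 0"
        using assms by (intro divide_nonpos_nonneg) auto
      then show ?thesis unfolding 0 1 by simp
    next
      assume "1 - y \<le> 3 * t / 8"
      then have "1 \<le> (y - 3 * t / 8) / (1 - 3 * t / 4)"
        using assms by (simp add: le_divide_eq)
      then show ?thesis unfolding 0 1 by simp
    qed
  next
    case False
    then show ?thesis unfolding 1 by (simp add: \<phi>1_def)
  qed
qed

lemma \<phi>2_edges:
  assumes "0 \<le> t" "t \<le> 1" "0 \<le> y" "y \<le> 1"
  shows "\<phi>2 t y y = (0, clamp01 (4 * y - 3 / 2))" "\<phi>2 t y 1 = \<phi>2 t y y"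
    "\<phi>2 t 0 y = \<phi>2 t y y \<or> \<phi>2 t 0 y = (0, 0) \<and> \<phi>2 t y y = (0, 1)"
proof -
  show 1: "\<phi>2 t y y = (0, clamp01 (4 * y - 3 / 2))"
    using assms by (simp add: \<phi>2_def depth_diag)
  then show "\<phi>2 t y 1 = \<phi>2 t y y"
    using assms by (simp add: \<phi>2_def depth_diag)
  show "\<phi>2 t 0 y = \<phi>2 t y y \<or> \<phi>2 t 0 y = (0, 0) \<and> \<phi>2 t y y = (0, 1)"
  proof (cases "depth 0 y \<le> 3 / 8")
    case True
    have "0 \<le> depth 0 y" using assms by (simp add: depth_def)
    then have "(1 - t) * (4 * depth 0 y) + t * max (- 4 * depth 0 y) (16 * depth 0 y - 9 / 2) \<le> 3 / 2"
      using True assms by (intro convex_le max.boundedI) auto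
    then have 0: "\<phi>2 t 0 y = (0, 0)" using True by (simp add: \<phi>2_def)
    have "y \<le> 3 / 8 \<or> 1 - y \<le> 3 / 8" using True unfolding depth_diag(3) min_le_iff_disj by blast
    then show ?thesis unfolding 0 1 by auto
  next
    case False
    then show ?thesis unfolding 1 by (simp add: \<phi>2_def)
  qed
qed

lemma \<phi>3_edges:
  assumes "0 \<le> t" "t \<le> 1" "0 \<le> y" "y \<le> 1"
  shows "\<phi>3 t y y = \<psi> (t * clamp01 (2 * y - 1 / 2)) (clamp01 (2 * y - 1 / 2))" "\<phi>3 t y 1 = \<phi>3 t y y"
    "\<phi>3 t 0 y = \<phi>3 t y y"
proof -
  show 1: "\<phi>3 t y y = \<psi> (t * clamp01 (2 * y - 1 / 2)) (clamp01 (2 * y - 1 / 2))"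
    using assms by (simp add: \<phi>3_def depth_diag)
  then show "\<phi>3 t y 1 = \<phi>3 t y y"
    using assms by (simp add: \<phi>3_def depth_diag)
  show "\<phi>3 t 0 y = \<phi>3 t y y"
  proof (cases "depth 0 y \<le> 1 / 4")
    case True
    have "0 \<le> depth 0 y" using assms by (simp add: depth_def)
    then have 0: "\<phi>3 t 0 y = (0, 0)" using True \<psi>_edge(2)[of 0] by (simp add: \<phi>3_def)
    have "y \<le> 1 / 4 \<or> 1 - y \<le> 1 / 4" using True unfolding depth_diag(3) min_le_iff_disj by blast
    then show ?thesis unfolding 0 1 using assms \<psi>_edge(1)[of t] \<psi>_edge(2)[of 0] by auto
  next
    case False
    then show ?thesis unfolding 1 by (simp add: \<phi>3_def)
  qed
qed

text \<open>Depths between 1/4 and 3/8 form the collar of \<psi> in the magnified triangle. The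
  second alternative only concerns the two parameters of the basepoint.\<close>

lemma \<phi>3_0:
  assumes "0 \<le> a" "a \<le> b" "b \<le> 1"
  shows "\<phi>3 0 a b = \<phi>2 1 a b \<or> \<phi>3 0 a b = (0, 0) \<and> \<phi>2 1 a b = (0, 1)"
proof -
  let ?d = "depth a b"
  have d: "0 \<le> ?d" "a \<le> 1 - 2 * ?d" using assms by (auto simp: depth_def min_def)
  consider "?d \<le> 1 / 4" | "1 / 4 < ?d" "?d \<le> 3 / 8" | "3 / 8 < ?d" by linarith
  then show ?thesis
  proof cases
    case 1
    let ?L = "clamp01 (2 * a - 1 / 2 - 2 * ?d)"
    have 2: "\<phi>2 1 a b = (0, clamp01 (2 * ?L - 1 / 2))"
      using 1 d by (auto simp: \<phi>2_def clamp01_def max_def min_def)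
    have "depth 0 ?L = min (1 - ?L) ?L" by (simp add: depth_def)
    then have "\<psi> 0 ?L = (if min (1 - ?L) ?L \<le> 1 / 4 then (0, 0) else (0, clamp01 (2 * ?L - 1 / 2)))"
      by (simp add: \<psi>_def)
    then have 3: "\<phi>3 0 a b = (if min (1 - ?L) ?L \<le> 1 / 4 then (0, 0) else (0, clamp01 (2 * ?L - 1 / 2)))"
      using 1 by (simp add: \<phi>3_def)
    show ?thesis unfolding 2 3 by (auto simp: min_def)
  next
    case 2
    then have ab: "clamp01 (2 * a) = 2 * a" "clamp01 (2 * b - 1 / 2) = 2 * b - 1 / 2"
      using assms d by (auto simp: clamp01_def depth_def)
    have "depth (2 * a) (2 * b - 1 / 2) = 2 * ?d - 1 / 2" by (simp add: depth_def min_def)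
    then have "\<phi>3 0 a b = (0, clamp01 (4 * a + 16 * ?d - 6))"
      using 2 by (simp add: \<phi>3_def ab \<psi>_def)
    moreover have "\<phi>2 1 a b = (0, clamp01 (4 * a + 16 * ?d - 6))"
      using 2 d by (auto simp: \<phi>2_def clamp01_def max_def min_def)
    ultimately show ?thesis by simp
  next
    case 3
    then have ab: "clamp01 (2 * a) = 2 * a" "clamp01 (2 * b - 1 / 2) = 2 * b - 1 / 2"
      using assms d by (auto simp: clamp01_def depth_def)
    have "depth (2 * a) (2 * b - 1 / 2) = 2 * ?d - 1 / 2" by (simp add: depth_def min_def)
    then show ?thesis
      using 3 by (simp add: \<phi>3_def \<phi>2_def ab \<psi>_def)
  qed
qed

lemma \<phi>3_1: "\<phi>3 1 a b = (0, 0)"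
  using \<psi>_edge(2) by (simp add: \<phi>3_def)

lemma \<phi>1_1: "\<phi>1 1 a b = \<phi>2 0 a b"
proof -
  have "x / (1 - 3 * 1 / 4) = 4 * x" for x :: real by simp
  then show ?thesis unfolding \<phi>1_def \<phi>2_def by (simp only:) (simp add: algebra_simps)
qed

context quadratic_quotient
begin

text \<open>The condition for a map on \<open>T\<close> to induce a self-map of E; imposed at all
  times of a homotopy it supplies \<open>h_B\<close> and \<open>h_cong\<close>.\<close>

definition respects_B :: "('a \<times> real \<times> real \<Rightarrow> 'c) \<Rightarrow> bool" where
  "respects_B f \<longleftrightarrow> (\<forall>l\<in>topspace T. f l \<in> B ` topspace T) \<and>
    (\<forall>l\<in>topspace T. \<forall>l'\<in>topspace T. B l = B l' \<longrightarrow> f l = f l')"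

lemma respects_B_cong:
  assumes "\<And>l. l \<in> topspace T \<Longrightarrow> f l = g l"
  shows "respects_B f \<longleftrightarrow> respects_B g"
  using assms by (simp add: respects_B_def del: topspace_prod_topology)

lemma contracting_homotopy_if_contractible:
  assumes "homotopic_with respects_B T V B (\<lambda>_. c)"
  shows "\<exists>k. homotopic_with (\<lambda>f. f ` q ` A \<subseteq> q ` A) V V id k \<and> k ` q ` A \<subseteq> {c}"
proof -
  obtain h where h: "continuous_map (prod_topology unit_interval T) V h"
    "\<forall>l. h (0, l) = B l" "\<forall>l. h (1, l) = c" "\<forall>t\<in>{0..1}. respects_B (\<lambda>l. h (t, l))"
    using assms unfolding homotopic_with_def by (elim exE conjE) (rule that)
  interpret quadratic_quotient_contraction X p r w d m V q h c
  proof unfold_locales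
    show "h (t, l) \<in> B ` topspace T" if "t \<in> {0..1}" "l \<in> topspace T" for t l
      using h(4) that unfolding respects_B_def by blast
    show "h (t, l) = h (t, l')" if "t \<in> {0..1}" "l \<in> topspace T" "l' \<in> topspace T" "B l = B l'" for t l l'
      using h(4) that unfolding respects_B_def by blast
  qed (rule h(1), rule h(2)[rule_format], rule h(3)[rule_format])
  show ?thesis by (rule contracting_homotopy)
qed

lemma continuous_map_B_clamp01:
  assumes "continuous_map Z X f" "continuous_map Z euclideanreal g" "continuous_map Z euclideanreal g'"
  shows "continuous_map Z V (\<lambda>z. B (f z, clamp01 (g z), clamp01 (g' z)))"
proof (intro continuous_map_comp[OF continuous_B] continuous_map_pairedI assms)
  show "continuous_map Z unit_interval (\<lambda>z. clamp01 (g z))" "continuous_map Z unit_interval (\<lambda>z. clamp01 (g' z))"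
    using assms by (simp_all add: continuous_map_into_unit_interval continuous_map_clamp01)
qed

lemma continuous_map_B_clamp01':
  assumes "continuous_map Z X f" "continuous_map Z euclideanreal g"
  shows "continuous_map Z V (\<lambda>z. B (f z, 0, clamp01 (g z)))"
  using continuous_map_B_clamp01[OF assms(1) _ assms(2), of "\<lambda>_. 0"] by simp

lemma sorted_projections:
  "continuous_map (prod_topology unit_interval T) euclideanreal (\<lambda>z. fst z)"
  "continuous_map (prod_topology unit_interval T) X (\<lambda>z. fst (snd z))"
  "continuous_map (prod_topology unit_interval T) euclideanreal (\<lambda>z. min (fst (snd (snd z))) (snd (snd (snd z))))"
  "continuous_map (prod_topology unit_interval T) euclideanreal (\<lambda>z. max (fst (snd (snd z))) (snd (snd (snd z))))"
proof -
  have 1: "continuous_map (prod_topology unit_interval T) (prod_topology unit_interval unit_interval) (\<lambda>z. snd (snd z))"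
    by (intro continuous_map_projections)
  have 2: "continuous_map (prod_topology unit_interval T) euclideanreal (\<lambda>z. fst (snd (snd z)))"
    "continuous_map (prod_topology unit_interval T) euclideanreal (\<lambda>z. snd (snd (snd z)))"
    by (rule continuous_map_unit_interval_real, rule continuous_map_fst'[OF 1] continuous_map_snd'[OF 1])+
  show "continuous_map (prod_topology unit_interval T) euclideanreal (\<lambda>z. min (fst (snd (snd z))) (snd (snd (snd z))))"
    "continuous_map (prod_topology unit_interval T) euclideanreal (\<lambda>z. max (fst (snd (snd z))) (snd (snd (snd z))))"
    by (intro continuous_map_real_min continuous_map_real_max 2)+
  show "continuous_map (prod_topology unit_interval T) euclideanreal (\<lambda>z. fst z)"
    "continuous_map (prod_topology unit_interval T) X (\<lambda>z. fst (snd z))"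
    by (intro continuous_map_unit_interval_real continuous_map_projections)+
qed

text \<open>Heights enter through \<open>min\<close> and \<open>max\<close>, so the conditions at
  both ends need checking only on the triangle \<open>a \<le> b\<close>.\<close>

lemma homotopic_with_sorted:
  fixes \<phi> :: "real \<Rightarrow> real \<Rightarrow> real \<Rightarrow> real \<times> real"
  assumes "continuous_map (prod_topology unit_interval T) V
      (\<lambda>z. B (fst (snd z), \<phi> (fst z) (min (fst (snd (snd z))) (snd (snd (snd z)))) (max (fst (snd (snd z))) (snd (snd (snd z))))))"
    and "\<And>t. t \<in> {0..1} \<Longrightarrow> respects_B (\<lambda>l. B (fst l, \<phi> t (min (fst (snd l)) (snd (snd l))) (max (fst (snd l)) (snd (snd l)))))"
    and "\<And>x a b. \<lbrakk>x \<in> topspace X; 0 \<le> a; a \<le> b; b \<le> 1\<rbrakk> \<Longrightarrow> B (x, \<phi> 0 a b) = f x a b"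
    and "\<And>x a b. \<lbrakk>x \<in> topspace X; 0 \<le> a; a \<le> b; b \<le> 1\<rbrakk> \<Longrightarrow> B (x, \<phi> 1 a b) = g x a b"
  shows "homotopic_with respects_B T V
    (\<lambda>l. f (fst l) (min (fst (snd l)) (snd (snd l))) (max (fst (snd l)) (snd (snd l))))
    (\<lambda>l. g (fst l) (min (fst (snd l)) (snd (snd l))) (max (fst (snd l)) (snd (snd l))))"
proof (rule homotopic_withI[OF assms(1)])
  fix l assume "l \<in> topspace T"
  then have *: "fst l \<in> topspace X" "0 \<le> min (fst (snd l)) (snd (snd l))"
    "min (fst (snd l)) (snd (snd l)) \<le> max (fst (snd l)) (snd (snd l))" "max (fst (snd l)) (snd (snd l)) \<le> 1"
    by auto
  show "B (fst (snd (0, l)), \<phi> (fst (0, l)) (min (fst (snd (snd (0, l)))) (snd (snd (snd (0, l)))))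
      (max (fst (snd (snd (0, l)))) (snd (snd (snd (0, l)))))) =
    f (fst l) (min (fst (snd l)) (snd (snd l))) (max (fst (snd l)) (snd (snd l)))"
    using assms(3)[OF *] by (simp only: fst_conv snd_conv)
  show "B (fst (snd (1, l)), \<phi> (fst (1, l)) (min (fst (snd (snd (1, l)))) (snd (snd (snd (1, l)))))
      (max (fst (snd (snd (1, l)))) (snd (snd (snd (1, l)))))) =
    g (fst l) (min (fst (snd l)) (snd (snd l))) (max (fst (snd l)) (snd (snd l)))"
    using assms(4)[OF *] by (simp only: fst_conv snd_conv)
next
  fix t :: real assume "t \<in> {0..1}"
  then show "respects_B (\<lambda>x. B (fst (snd (t, x)), \<phi> (fst (t, x)) (min (fst (snd (snd (t, x)))) (snd (snd (snd (t, x)))))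
      (max (fst (snd (snd (t, x)))) (snd (snd (snd (t, x)))))))"
    using assms(2)[of t] by (simp only: fst_conv snd_conv)
qed (rule respects_B_cong)

lemma B_sorted:
  assumes "l \<in> topspace T"
  shows "B (fst l, min (fst (snd l)) (snd (snd l)), max (fst (snd l)) (snd (snd l))) = B l"
proof -
  have "(fst l, fst (snd l)) \<in> topspace C" "(fst l, snd (snd l)) \<in> topspace C" using assms by auto
  then show ?thesis
    using Q_commute by (auto simp: B_def min_def max_def)
qed

lemma homotopic_with_B_sorted:
  "homotopic_with respects_B T V B
    (\<lambda>l. B (fst l, min (fst (snd l)) (snd (snd l)), max (fst (snd l)) (snd (snd l))))"
proof (rule homotopic_with_equal)
  show B: "respects_B B" by (simp add: respects_B_def del: topspace_prod_topology)
  have "respects_B (\<lambda>l. B (fst l, min (fst (snd l)) (snd (snd l)), max (fst (snd l)) (snd (snd l)))) \<longleftrightarrow> respects_B B"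
    by (rule respects_B_cong) (rule B_sorted)
  with B show "respects_B (\<lambda>l. B (fst l, min (fst (snd l)) (snd (snd l)), max (fst (snd l)) (snd (snd l))))" by simp
qed (rule continuous_B, rule B_sorted[symmetric])

end

section \<open>The disc of pairs of heights in the reduced symmetric square\<close>

context equiconnected
begin

interpretation SP: quadratic_quotient X p r w d m "reduced_SP2 Y base"
    "\<lambda>(a, b). collapse_class ((\<lambda>y. sp2_class y base) ` topspace Y) (sp2_class a b)"
  by (rule quadratic_quotient_reduced_SP2)

lemma SP_B_eq_iff:
  assumes "x \<in> topspace X" "s \<in> {0..1}" "s' \<in> {0..1}" "x' \<in> topspace X" "t \<in> {0..1}" "t' \<in> {0..1}"
  shows "SP.B (x, s, s') = SP.B (x', t, t') \<longleftrightarrow>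
    \<kappa> (x', t) = \<kappa> (x, s) \<and> \<kappa> (x', t') = \<kappa> (x, s') \<or> \<kappa> (x', t) = \<kappa> (x, s') \<and> \<kappa> (x', t') = \<kappa> (x, s) \<or>
    (\<kappa> (x, s) = base \<or> \<kappa> (x, s') = base) \<and> (\<kappa> (x', t) = base \<or> \<kappa> (x', t') = base)"
proof -
  have "\<kappa> (x, s) \<in> topspace Y" "\<kappa> (x, s') \<in> topspace Y" "\<kappa> (x', t) \<in> topspace Y" "\<kappa> (x', t') \<in> topspace Y"
    by (rule \<kappa>_in_Y; use assms in auto)+
  then show ?thesis
    using base_in_Y by (simp add: SP.B_eq SP.Q_eq collapse_class_eq_iff sp2_class_eq_iff sp2_class_in_axis_iff)
qed

lemma \<kappa>_eq_baseD:
  assumes "\<kappa> (x, s) = base" "x \<in> topspace X" "s \<in> {0..1}"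
  shows "s = 0 \<or> s = 1 \<or> x = p"
proof -
  have "(x, s) \<in> base" using \<kappa>_eq_base[of "(x, s)"] \<eta>_0_iff[of "(x, s)"] assms by auto
  then show ?thesis by (auto simp: suspension_base_def)
qed

lemma \<kappa>_eqD:
  assumes "\<kappa> (x, s) = \<kappa> (x', s')" "\<kappa> (x, s) \<noteq> base" "x \<in> topspace X" "s \<in> {0..1}" "x' \<in> topspace X" "s' \<in> {0..1}"
  shows "x' = x \<and> s' = s"
  using assms \<kappa>_eq_iff[of "(x, s)" "(x', s')"] \<kappa>_eq_base[of "(x, s)"] by auto

text \<open>The edges \<open>a = 0\<close> and \<open>b = 1\<close> are collapsed and the diagonal
  is free, so pushing the heights apart, to 0 and 1, contracts the triangle; a pair with a height at
  an end stays at the basepoint.\<close>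

lemma SP_contractible:
  "homotopic_with SP.respects_B SP.T (reduced_SP2 Y base) SP.B (\<lambda>_. SP.B (p, 0, 0))"
proof -
  let ?\<phi> = "\<lambda>t a b. (clamp01 (a - t), clamp01 (b + t))"
  have triv: "SP.B (x, s, s') = SP.B (p, 0, 0)"
    if "x \<in> topspace X" "s \<in> {0..1}" "s' \<in> {0..1}" "x = p \<or> s = 0 \<or> s' = 1" for x s s'
    using that \<kappa>_0[OF that(1)] \<kappa>_1[OF that(1)] \<kappa>_p p \<kappa>_0[OF p]
    by (auto simp: SP_B_eq_iff[OF that(1-3) p])
  have "homotopic_with SP.respects_B SP.T (reduced_SP2 Y base)
    (\<lambda>l. SP.B (fst l, min (fst (snd l)) (snd (snd l)), max (fst (snd l)) (snd (snd l)))) (\<lambda>l. SP.B (p, 0, 0))"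
  proof (rule SP.homotopic_with_sorted[of ?\<phi> "\<lambda>x a b. SP.B (x, a, b)" "\<lambda>_ _ _. SP.B (p, 0, 0)"])
    show "continuous_map (prod_topology unit_interval SP.T) (reduced_SP2 Y base)
      (\<lambda>z. SP.B (fst (snd z), clamp01 (min (fst (snd (snd z))) (snd (snd (snd z))) - fst z),
        clamp01 (max (fst (snd (snd z))) (snd (snd (snd z))) + fst z)))"
      by (intro SP.continuous_map_B_clamp01 SP.sorted_projections continuous_map_add continuous_map_diff)
    show "SP.B (x, clamp01 (a - 0), clamp01 (b + 0)) = SP.B (x, a, b)"
      if "x \<in> topspace X" "0 \<le> a" "a \<le> b" "b \<le> 1" for x a b
      using that by (simp add: clamp01_def)
    show "SP.B (x, clamp01 (a - 1), clamp01 (b + 1)) = SP.B (p, 0, 0)"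
      if "x \<in> topspace X" "0 \<le> a" "a \<le> b" "b \<le> 1" for x a b
      using that triv[of x 0 1] by simp
    fix t :: real assume t: "t \<in> {0..1}"
    let ?f = "\<lambda>l. SP.B (fst l, clamp01 (min (fst (snd l)) (snd (snd l)) - t), clamp01 (max (fst (snd l)) (snd (snd l)) + t))"
    have f_triv: "?f (x, s, s') = SP.B (p, 0, 0)"
      if "x \<in> topspace X" "s \<in> {0..1}" "s' \<in> {0..1}" "\<kappa> (x, s) = base \<or> \<kappa> (x, s') = base" for x s s'
    proof -
      have "s = 0 \<or> s = 1 \<or> s' = 0 \<or> s' = 1 \<or> x = p"
        using that(4) \<kappa>_eq_baseD[OF _ that(1,2)] \<kappa>_eq_baseD[OF _ that(1,3)] by blast
      then have "x = p \<or> min s s' = 0 \<or> max s s' = 1"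
        using that(2,3) by (auto simp: min_def max_def)
      then have "x = p \<or> clamp01 (min s s' - t) = 0 \<or> clamp01 (max s s' + t) = 1"
        using t by (elim disjE) simp_all
      then show ?thesis using triv[OF that(1)] by simp
    qed
    have "?f l = ?f l'" if l: "l \<in> topspace SP.T" "l' \<in> topspace SP.T" "SP.B l = SP.B l'" for l l'
    proof -
      obtain x s s' where l1: "l = (x, s, s')" "x \<in> topspace X" "s \<in> {0..1}" "s' \<in> {0..1}" using l(1) by auto
      obtain x' u u' where l2: "l' = (x', u, u')" "x' \<in> topspace X" "u \<in> {0..1}" "u' \<in> {0..1}" using l(2) by auto
      note eq = iffD1[OF SP_B_eq_iff[OF l1(2-4) l2(2-4)] l(3)[unfolded l1(1) l2(1)]]
      show ?thesis
      proof (cases "\<kappa> (x, s) = base \<or> \<kappa> (x, s') = base")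
        case True
        then have "\<kappa> (x', u) = base \<or> \<kappa> (x', u') = base" using eq by (elim disjE conjE) simp_all
        then show ?thesis unfolding l1(1) l2(1) unfolding f_triv[OF l1(2-4) True] by (rule f_triv[OF l2(2-4), symmetric])
      next
        case False
        then have "\<kappa> (x, s) = \<kappa> (x', u) \<and> \<kappa> (x, s') = \<kappa> (x', u') \<or>
            \<kappa> (x, s) = \<kappa> (x', u') \<and> \<kappa> (x, s') = \<kappa> (x', u)"
          using eq by (elim disjE) simp_all
        then show ?thesis
        proof (elim disjE conjE)
          assume 1: "\<kappa> (x, s) = \<kappa> (x', u)" "\<kappa> (x, s') = \<kappa> (x', u')"
          show ?thesis
            using \<kappa>_eqD[OF 1(1) _ l1(2,3) l2(2,3)] \<kappa>_eqD[OF 1(2) _ l1(2,4) l2(2,4)] False by (simp add: l1(1) l2(1))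
        next
          assume 2: "\<kappa> (x, s) = \<kappa> (x', u')" "\<kappa> (x, s') = \<kappa> (x', u)"
          show ?thesis
            using \<kappa>_eqD[OF 2(1) _ l1(2,3) l2(2,4)] \<kappa>_eqD[OF 2(2) _ l1(2,4) l2(2,3)] False
            by (simp add: l1(1) l2(1) min.commute max.commute)
        qed
      qed
    qed
    moreover have "?f l \<in> SP.B ` topspace SP.T" if "l \<in> topspace SP.T" for l
      using that by (intro imageI) auto
    ultimately show "SP.respects_B ?f"
      unfolding SP.respects_B_def by blast
  qed
  then show ?thesis
    by (rule homotopic_with_trans[OF SP.homotopic_with_B_sorted])
qed

section \<open>The dunce hat of pairs of heights in the finite subset space\<close>

interpretation Sub: quadratic_quotient X p r w d m "Sub3_based Y base" "\<lambda>(a, b). {base, a, b}"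
  by (rule quadratic_quotient_Sub3_based)

lemma Sub_B_eq: "Sub.B (x, s, s') = {base, \<kappa> (x, s), \<kappa> (x, s')}"
  by (simp add: Sub.B_eq Sub.Q_eq)

text \<open>Neither an element at the basepoint nor a repeated one enlarges the set; this glues the
  edges \<open>b = 1\<close> and \<open>a = b\<close> to \<open>a = 0\<close>.\<close>

lemma Sub_B_edge:
  assumes "x \<in> topspace X" "v = 1 \<or> v = u"
  shows "Sub.B (x, u, v) = Sub.B (x, 0, u)"
  using assms \<kappa>_0[OF assms(1)] \<kappa>_1[OF assms(1)] by (auto simp: Sub_B_eq)

lemma Sub_B_base:
  assumes "x \<in> topspace X"
  shows "Sub.B (x, 0, 0) = {base}" "Sub.B (x, 0, 1) = {base}"
  using \<kappa>_0[OF assms] \<kappa>_1[OF assms] by (auto simp: Sub_B_eq)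

lemma Sub_B_p: "s \<in> {0..1} \<Longrightarrow> s' \<in> {0..1} \<Longrightarrow> Sub.B (p, s, s') = {base}"
  using \<kappa>_p by (auto simp: Sub_B_eq)

text \<open>Over a set of three elements the heights are determined up to order. A smaller set
  \<open>{base, \<kappa> (x, t)}\<close> arises on all three edges, and the premises give it the
  common value at \<open>(t, t)\<close>; over \<open>p\<close> everything is the basepoint.\<close>

lemma respects_Sub_B_sorted:
  fixes \<phi> :: "real \<Rightarrow> real \<Rightarrow> real \<times> real"
  assumes range: "\<And>a b. \<phi> a b \<in> {0..1} \<times> {0..1}"
    and left: "\<And>x y. \<lbrakk>x \<in> topspace X; 0 \<le> y; y \<le> 1\<rbrakk> \<Longrightarrow> Sub.B (x, \<phi> 0 y) = Sub.B (x, \<phi> y y)"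
    and right: "\<And>x y. \<lbrakk>x \<in> topspace X; 0 \<le> y; y \<le> 1\<rbrakk> \<Longrightarrow> Sub.B (x, \<phi> y 1) = Sub.B (x, \<phi> y y)"
    and corner: "\<And>x. x \<in> topspace X \<Longrightarrow> Sub.B (x, \<phi> 0 0) = {base}"
  shows "Sub.respects_B (\<lambda>l. Sub.B (fst l, \<phi> (min (fst (snd l)) (snd (snd l))) (max (fst (snd l)) (snd (snd l)))))"
    (is "Sub.respects_B ?f")
proof -
  let ?g = "\<lambda>x s. Sub.B (x, \<phi> s s)"
  have p_const: "Sub.B (p, \<phi> a b) = {base}" for a b
    using range[of a b] Sub_B_p by (cases "\<phi> a b") simp
  have g_base: "?g x s = {base}" if "x \<in> topspace X" "s \<in> {0..1}" "\<kappa> (x, s) = base" for x s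
    using \<kappa>_eq_baseD[OF that(3,1,2)]
  proof (elim disjE)
    \<comment> \<open>The vertex \<open>(0, 1)\<close> lies on two edges: \<open>right\<close> at 0
      and \<open>left\<close> at 1 carry the value from \<open>(0, 0)\<close> over it to
      \<open>(1, 1)\<close>.\<close>
    assume "s = 1"
    then show ?thesis
      using left[OF that(1), of 1] right[OF that(1), of 0] corner[OF that(1)] by simp
  qed (use corner[OF that(1)] p_const in simp_all)
  have g_cong: "?g x s = ?g x' s'"
    if "x \<in> topspace X" "s \<in> {0..1}" "x' \<in> topspace X" "s' \<in> {0..1}" "\<kappa> (x, s) = \<kappa> (x', s')" for x s x' s'
  proof (cases "\<kappa> (x, s) = base")
    case True
    then show ?thesis using g_base that by metis
  next
    case False
    then show ?thesis using \<kappa>_eqD[OF that(5) False that(1-4)] by simp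
  qed
  have f_base: "?f (x, s, s') = ?g x s'" "?f (x, s', s) = ?g x s'"
    if "x \<in> topspace X" "s \<in> {0..1}" "s' \<in> {0..1}" "\<kappa> (x, s) = base" for x s s'
  proof -
    show "?f (x, s, s') = ?g x s'"
      using \<kappa>_eq_baseD[OF that(4,1,2)]
    proof (elim disjE)
      assume "s = 0"
      then show ?thesis using left[OF that(1), of s'] that(3) by simp
    next
      assume "s = 1"
      then show ?thesis using right[OF that(1), of s'] that(3) by simp
    qed (use p_const in simp)
    then show "?f (x, s', s) = ?g x s'" by (simp add: min.commute max.commute)
  qed
  have degenerate: "\<exists>t\<in>{0..1}. Sub.B (x, s, s') = {base, \<kappa> (x, t)} \<and> ?f (x, s, s') = ?g x t"
    if x: "x \<in> topspace X" and s: "s \<in> {0..1}" "s' \<in> {0..1}"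
      and deg: "\<kappa> (x, s) = base \<or> \<kappa> (x, s') = base \<or> \<kappa> (x, s) = \<kappa> (x, s')" for x s s'
  proof -
    consider "\<kappa> (x, s) = base" | "\<kappa> (x, s') = base" | "\<kappa> (x, s) \<noteq> base" "\<kappa> (x, s) = \<kappa> (x, s')"
      using deg by blast
    then show ?thesis
    proof cases
      case 1
      then show ?thesis using f_base(1)[OF x s 1] by (intro bexI[OF _ s(2)]) (simp add: Sub_B_eq)
    next
      case 2
      then show ?thesis using f_base(2)[OF x s(2,1) 2] by (intro bexI[OF _ s(1)]) (auto simp: Sub_B_eq)
    next
      case 3
      have "s' = s" by (rule conjunct2[OF \<kappa>_eqD[OF 3(2,1) x s(1) x s(2)]])
      then show ?thesis by (intro bexI[OF _ s(1)]) (simp add: Sub_B_eq)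
    qed
  qed
  have "?f l = ?f l'" if l: "l \<in> topspace Sub.T" "l' \<in> topspace Sub.T" "Sub.B l = Sub.B l'" for l l'
  proof -
    obtain x s s' where l1: "l = (x, s, s')" "x \<in> topspace X" "s \<in> {0..1}" "s' \<in> {0..1}" using l(1) by auto
    obtain x' u u' where l2: "l' = (x', u, u')" "x' \<in> topspace X" "u \<in> {0..1}" "u' \<in> {0..1}" using l(2) by auto
    have eq: "{base, \<kappa> (x, s), \<kappa> (x, s')} = {base, \<kappa> (x', u), \<kappa> (x', u')}"
      using l(3) by (simp only: l1(1) l2(1) Sub_B_eq)
    show ?thesis
    proof (cases "\<kappa> (x, s) = base \<or> \<kappa> (x, s') = base \<or> \<kappa> (x, s) = \<kappa> (x, s')")
      case True
      then have "\<kappa> (x', u) = base \<or> \<kappa> (x', u') = base \<or> \<kappa> (x', u) = \<kappa> (x', u')"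
        using eq by (metis empty_iff insert_iff)
      then obtain t' where t': "t' \<in> {0..1}" "Sub.B (x', u, u') = {base, \<kappa> (x', t')}" "?f (x', u, u') = ?g x' t'"
        using degenerate[OF l2(2-4)] by blast
      obtain t where t: "t \<in> {0..1}" "Sub.B (x, s, s') = {base, \<kappa> (x, t)}" "?f (x, s, s') = ?g x t"
        using degenerate[OF l1(2-4) True] by blast
      have "\<kappa> (x, t) = \<kappa> (x', t')"
      proof -
        have "{base, \<kappa> (x, t)} = {base, \<kappa> (x', t')}"
          using l(3) unfolding l1(1) l2(1) t(2) t'(2) .
        then show ?thesis by (auto simp: doubleton_eq_iff)
      qed
      then show ?thesis
        using t(3) t'(3) g_cong[OF l1(2) t(1) l2(2) t'(1)] by (simp only: l1(1) l2(1))
    next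
      case False
      then have "\<kappa> (x, s) = \<kappa> (x', u) \<and> \<kappa> (x, s') = \<kappa> (x', u') \<or>
          \<kappa> (x, s) = \<kappa> (x', u') \<and> \<kappa> (x, s') = \<kappa> (x', u)"
        using eq by (metis empty_iff insert_iff)
      then show ?thesis
      proof (elim disjE conjE)
        assume 1: "\<kappa> (x, s) = \<kappa> (x', u)" "\<kappa> (x, s') = \<kappa> (x', u')"
        show ?thesis
          using \<kappa>_eqD[OF 1(1) _ l1(2,3) l2(2,3)] \<kappa>_eqD[OF 1(2) _ l1(2,4) l2(2,4)] False by (simp add: l1(1) l2(1))
      next
        assume 2: "\<kappa> (x, s) = \<kappa> (x', u')" "\<kappa> (x, s') = \<kappa> (x', u)"
        show ?thesis
          using \<kappa>_eqD[OF 2(1) _ l1(2,3) l2(2,4)] \<kappa>_eqD[OF 2(2) _ l1(2,4) l2(2,3)] False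
          by (simp add: l1(1) l2(1) min.commute max.commute)
      qed
    qed
  qed
  moreover have "?f l \<in> Sub.B ` topspace Sub.T" if "l \<in> topspace Sub.T" for l
  proof (rule imageI)
    show "(fst l, \<phi> (min (fst (snd l)) (snd (snd l))) (max (fst (snd l)) (snd (snd l)))) \<in> topspace Sub.T"
      using that range[of "min (fst (snd l)) (snd (snd l))" "max (fst (snd l)) (snd (snd l))"] by (auto simp: mem_Times_iff)
  qed
  ultimately show ?thesis
    unfolding Sub.respects_B_def by blast
qed

abbreviation lo :: "real \<times> 'a \<times> real \<times> real \<Rightarrow> real" where
  "lo z \<equiv> min (fst (snd (snd z))) (snd (snd (snd z)))"

abbreviation hi :: "real \<times> 'a \<times> real \<times> real \<Rightarrow> real" where
  "hi z \<equiv> max (fst (snd (snd z))) (snd (snd (snd z)))"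

abbreviation IT :: "(real \<times> 'a \<times> real \<times> real) topology" where
  "IT \<equiv> prod_topology unit_interval Sub.T"

lemma continuous_depth:
  assumes "continuous_map Z euclideanreal f" "continuous_map Z euclideanreal g"
  shows "continuous_map Z euclideanreal (\<lambda>z. depth (f z) (g z))"
  unfolding depth_def by (intro continuous_map_rules continuous_map_canonical_const assms)

lemma depth_eqD: "depth a b = e \<Longrightarrow> b = 1 - e \<or> b = a + e"
  by (auto simp: depth_def min_def split: if_splits)

lemma Sub_B_cases:
  "Sub.B (x, if P then u else v) = (if P then Sub.B (x, u) else Sub.B (x, v))"
  by simp

lemma continuous_\<phi>1:
  "continuous_map IT (Sub3_based Y base) (\<lambda>z. Sub.B (fst (snd z), \<phi>1 (fst z) (lo z) (hi z)))"
  unfolding \<phi>1_def Sub_B_cases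
proof (rule continuous_map_cases_le)
  have t: "fst z < 4 / 3" "fst (snd z) \<in> topspace X" if "z \<in> topspace IT" for z using that by auto
  have nz: "1 - 3 * fst z / 4 \<noteq> 0" if "z \<in> topspace IT" for z using t(1)[OF that] by auto
  have c: "continuous_map IT euclideanreal (\<lambda>z. 3 * fst z / 8)" "continuous_map IT euclideanreal (\<lambda>z. 3 * fst z / 4)"
    by (intro continuous_map_real_divide continuous_map_real_mult continuous_map_canonical_const Sub.sorted_projections; simp)+
  show "continuous_map IT euclideanreal (\<lambda>z. depth (lo z) (hi z))"
    by (intro continuous_depth Sub.sorted_projections)
  show "continuous_map IT euclideanreal (\<lambda>z. 3 * fst z / 8)" by (rule c)
  have "continuous_map IT (Sub3_based Y base)
     (\<lambda>z. Sub.B (fst (snd z), 0, clamp01 ((lo z - 3 * fst z / 8 + depth (lo z) (hi z)) / (1 - 3 * fst z / 4))))"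
    by (intro Sub.continuous_map_B_clamp01' continuous_map_real_divide continuous_map_add continuous_map_diff
        continuous_depth continuous_map_canonical_const Sub.sorted_projections c nz)
  then show "continuous_map (subtopology IT {z \<in> topspace IT. depth (lo z) (hi z) \<le> 3 * fst z / 8}) (Sub3_based Y base)
     (\<lambda>z. Sub.B (fst (snd z), 0, clamp01 ((lo z - 3 * fst z / 8 + depth (lo z) (hi z)) / (1 - 3 * fst z / 4))))"
    by (rule continuous_map_from_subtopology)
  have "continuous_map IT (Sub3_based Y base)
     (\<lambda>z. Sub.B (fst (snd z), clamp01 (lo z / (1 - 3 * fst z / 4)), clamp01 ((hi z - 3 * fst z / 8) / (1 - 3 * fst z / 4))))"
    by (intro Sub.continuous_map_B_clamp01 continuous_map_real_divide continuous_map_add continuous_map_diff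
        continuous_depth continuous_map_canonical_const Sub.sorted_projections c nz)
  then show "continuous_map (subtopology IT {z \<in> topspace IT. 3 * fst z / 8 \<le> depth (lo z) (hi z)}) (Sub3_based Y base)
     (\<lambda>z. Sub.B (fst (snd z), clamp01 (lo z / (1 - 3 * fst z / 4)), clamp01 ((hi z - 3 * fst z / 8) / (1 - 3 * fst z / 4))))"
    by (rule continuous_map_from_subtopology)
  show "Sub.B (fst (snd z), 0, clamp01 ((lo z - 3 * fst z / 8 + depth (lo z) (hi z)) / (1 - 3 * fst z / 4))) =
      Sub.B (fst (snd z), clamp01 (lo z / (1 - 3 * fst z / 4)), clamp01 ((hi z - 3 * fst z / 8) / (1 - 3 * fst z / 4)))"
    if z: "z \<in> topspace IT" and eq: "depth (lo z) (hi z) = 3 * fst z / 8" for z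
  proof -
    \<comment> \<open>At this depth the point lies on one of two edges of the inner triangle, which
      \<open>Sub_B_edge\<close> moves to the edge \<open>a = 0\<close>, the target of the
      collar.\<close>
    have "hi z - 3 * fst z / 8 = 1 - 3 * fst z / 4 \<or> hi z - 3 * fst z / 8 = lo z"
      using depth_eqD[OF eq] by auto
    then have "(hi z - 3 * fst z / 8) / (1 - 3 * fst z / 4) = 1 \<or>
        (hi z - 3 * fst z / 8) / (1 - 3 * fst z / 4) = lo z / (1 - 3 * fst z / 4)"
      using nz[OF z] by (elim disjE) simp_all
    then have "Sub.B (fst (snd z), clamp01 (lo z / (1 - 3 * fst z / 4)), clamp01 ((hi z - 3 * fst z / 8) / (1 - 3 * fst z / 4)))
        = Sub.B (fst (snd z), 0, clamp01 (lo z / (1 - 3 * fst z / 4)))"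
      by (intro Sub_B_edge[OF t(2)[OF z]]) auto
    then show ?thesis unfolding eq by simp
  qed
qed

lemma continuous_\<phi>2:
  "continuous_map IT (Sub3_based Y base) (\<lambda>z. Sub.B (fst (snd z), \<phi>2 (fst z) (lo z) (hi z)))"
  unfolding \<phi>2_def Sub_B_cases
proof (rule continuous_map_cases_le)
  have x: "fst (snd z) \<in> topspace X" if "z \<in> topspace IT" for z using that by auto
  let ?d = "\<lambda>z. depth (lo z) (hi z)"
  show d: "continuous_map IT euclideanreal ?d"
    by (intro continuous_depth Sub.sorted_projections)
  show "continuous_map IT euclideanreal (\<lambda>z. 3 / 8)" by (rule continuous_map_canonical_const)
  have "continuous_map IT (Sub3_based Y base) (\<lambda>z. Sub.B (fst (snd z), 0, clamp01
      (4 * lo z - 3 / 2 + ((1 - fst z) * (4 * ?d z) + fst z * max (- 4 * ?d z) (16 * ?d z - 9 / 2)))))"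
    by (intro Sub.continuous_map_B_clamp01' continuous_map_real_mult continuous_map_add continuous_map_diff
        continuous_map_real_max d continuous_map_canonical_const Sub.sorted_projections)
  then show "continuous_map (subtopology IT {z \<in> topspace IT. ?d z \<le> 3 / 8}) (Sub3_based Y base) (\<lambda>z. Sub.B (fst (snd z), 0, clamp01
      (4 * lo z - 3 / 2 + ((1 - fst z) * (4 * ?d z) + fst z * max (- 4 * ?d z) (16 * ?d z - 9 / 2)))))"
    by (rule continuous_map_from_subtopology)
  have "continuous_map IT (Sub3_based Y base)
     (\<lambda>z. Sub.B (fst (snd z), clamp01 (4 * lo z), clamp01 (4 * hi z - 3 / 2)))"
    by (intro Sub.continuous_map_B_clamp01 continuous_map_real_mult continuous_map_diff
        continuous_map_canonical_const Sub.sorted_projections)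
  then show "continuous_map (subtopology IT {z \<in> topspace IT. 3 / 8 \<le> ?d z}) (Sub3_based Y base)
     (\<lambda>z. Sub.B (fst (snd z), clamp01 (4 * lo z), clamp01 (4 * hi z - 3 / 2)))"
    by (rule continuous_map_from_subtopology)
  show "Sub.B (fst (snd z), 0, clamp01
      (4 * lo z - 3 / 2 + ((1 - fst z) * (4 * ?d z) + fst z * max (- 4 * ?d z) (16 * ?d z - 9 / 2)))) =
      Sub.B (fst (snd z), clamp01 (4 * lo z), clamp01 (4 * hi z - 3 / 2))"
    if z: "z \<in> topspace IT" and eq: "?d z = 3 / 8" for z
  proof -
    have "4 * hi z - 3 / 2 = 1 \<or> 4 * hi z - 3 / 2 = 4 * lo z"
      using depth_eqD[OF eq] by auto
    then have "Sub.B (fst (snd z), clamp01 (4 * lo z), clamp01 (4 * hi z - 3 / 2)) = Sub.B (fst (snd z), 0, clamp01 (4 * lo z))"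
      by (intro Sub_B_edge[OF x[OF z]]) auto
    moreover have "4 * lo z - 3 / 2 + ((1 - fst z) * (4 * ?d z) + fst z * max (- 4 * ?d z) (16 * ?d z - 9 / 2)) = 4 * lo z"
      unfolding eq by (simp add: field_simps)
    ultimately show ?thesis by (simp only:)
  qed
qed

lemma continuous_\<psi>:
  assumes "continuous_map Z X f" "continuous_map Z euclideanreal g" "continuous_map Z euclideanreal g'"
  shows "continuous_map Z (Sub3_based Y base) (\<lambda>z. Sub.B (f z, \<psi> (g z) (g' z)))"
  unfolding \<psi>_def Sub_B_cases
proof (rule continuous_map_cases_le)
  let ?d = "\<lambda>z. depth (g z) (g' z)"
  show d: "continuous_map Z euclideanreal ?d"
    by (intro continuous_depth assms)
  show "continuous_map Z euclideanreal (\<lambda>z. 1 / 4)" by (rule continuous_map_canonical_const)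
  have "continuous_map Z (Sub3_based Y base) (\<lambda>z. Sub.B (f z, 0, clamp01 (2 * g z - 2 + 8 * ?d z)))"
    by (intro Sub.continuous_map_B_clamp01' continuous_map_real_mult continuous_map_add continuous_map_diff
        d continuous_map_canonical_const assms)
  then show "continuous_map (subtopology Z {z \<in> topspace Z. ?d z \<le> 1 / 4}) (Sub3_based Y base)
      (\<lambda>z. Sub.B (f z, 0, clamp01 (2 * g z - 2 + 8 * ?d z)))"
    by (rule continuous_map_from_subtopology)
  have "continuous_map Z (Sub3_based Y base) (\<lambda>z. Sub.B (f z, clamp01 (2 * g z), clamp01 (2 * g' z - 1 / 2)))"
    by (intro Sub.continuous_map_B_clamp01 continuous_map_real_mult continuous_map_diff
        continuous_map_canonical_const assms)
  then show "continuous_map (subtopology Z {z \<in> topspace Z. 1 / 4 \<le> ?d z}) (Sub3_based Y base)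
      (\<lambda>z. Sub.B (f z, clamp01 (2 * g z), clamp01 (2 * g' z - 1 / 2)))"
    by (rule continuous_map_from_subtopology)
  show "Sub.B (f z, 0, clamp01 (2 * g z - 2 + 8 * ?d z)) = Sub.B (f z, clamp01 (2 * g z), clamp01 (2 * g' z - 1 / 2))"
    if z: "z \<in> topspace Z" and eq: "?d z = 1 / 4" for z
  proof -
    have "f z \<in> topspace X" using z continuous_map_image_subset_topspace[OF assms(1)] by auto
    moreover have "2 * g' z - 1 / 2 = 1 \<or> 2 * g' z - 1 / 2 = 2 * g z"
      using depth_eqD[OF eq] by auto
    ultimately have "Sub.B (f z, clamp01 (2 * g z), clamp01 (2 * g' z - 1 / 2)) = Sub.B (f z, 0, clamp01 (2 * g z))"
      by (intro Sub_B_edge) auto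
    then show ?thesis unfolding eq by simp
  qed
qed

lemma continuous_\<phi>3:
  "continuous_map IT (Sub3_based Y base) (\<lambda>z. Sub.B (fst (snd z), \<phi>3 (fst z) (lo z) (hi z)))"
  unfolding \<phi>3_def Sub_B_cases
proof (rule continuous_map_cases_le)
  have x: "fst (snd z) \<in> topspace X" "0 \<le> fst z" "fst z \<le> 1" if "z \<in> topspace IT" for z using that by auto
  let ?d = "\<lambda>z. depth (lo z) (hi z)"
  let ?L = "\<lambda>z. clamp01 (2 * lo z - 1 / 2 - 2 * ?d z)"
  show d: "continuous_map IT euclideanreal ?d"
    by (intro continuous_depth Sub.sorted_projections)
  show "continuous_map IT euclideanreal (\<lambda>z. 1 / 4)" by (rule continuous_map_canonical_const)
  have "continuous_map IT (Sub3_based Y base) (\<lambda>z. Sub.B (fst (snd z), \<psi> (fst z * ?L z) (?L z)))"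
    by (intro continuous_\<psi> continuous_map_clamp01 continuous_map_real_mult continuous_map_diff
        d continuous_map_canonical_const Sub.sorted_projections)
  then show "continuous_map (subtopology IT {z \<in> topspace IT. ?d z \<le> 1 / 4}) (Sub3_based Y base)
      (\<lambda>z. Sub.B (fst (snd z), \<psi> (fst z * ?L z) (?L z)))"
    by (rule continuous_map_from_subtopology)
  let ?\<psi> = "\<lambda>z. \<psi> (clamp01 (2 * lo z) + fst z * (clamp01 (2 * hi z - 1 / 2) - clamp01 (2 * lo z))) (clamp01 (2 * hi z - 1 / 2))"
  have "continuous_map IT (Sub3_based Y base) (\<lambda>z. Sub.B (fst (snd z), ?\<psi> z))"
    by (intro continuous_\<psi> continuous_map_clamp01 continuous_map_real_mult continuous_map_diff continuous_map_add
        d continuous_map_canonical_const Sub.sorted_projections)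
  then show "continuous_map (subtopology IT {z \<in> topspace IT. 1 / 4 \<le> ?d z}) (Sub3_based Y base)
      (\<lambda>z. Sub.B (fst (snd z), ?\<psi> z))"
    by (rule continuous_map_from_subtopology)
  show "Sub.B (fst (snd z), \<psi> (fst z * ?L z) (?L z)) = Sub.B (fst (snd z), ?\<psi> z)"
    if z: "z \<in> topspace IT" and eq: "?d z = 1 / 4" for z
  proof -
    \<comment> \<open>On the curve of depth 1/4 both branches stay at the vertex: the collar because
      \<open>?L z\<close> is 0, the inside because the slide stays within an edge of the magnified
      triangle that \<psi> sends to the vertex.\<close>
    have "lo z \<le> 1 / 2" using eq by (auto simp: depth_def min_def split: if_splits)
    then have "?L z = 0" unfolding eq by simp
    then have 1: "\<psi> (fst z * ?L z) (?L z) = (0, 0)" using \<psi>_edge(2)[of 0] by simp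
    have "2 * hi z - 1 / 2 = 1 \<or> 2 * hi z - 1 / 2 = 2 * lo z"
      using depth_eqD[OF eq] by auto
    then have "?\<psi> z = (0, 0)"
    proof
      assume "2 * hi z - 1 / 2 = 1"
      then have "?\<psi> z = \<psi> ((1 - fst z) * clamp01 (2 * lo z) + fst z * 1) 1" by (simp add: algebra_simps)
      also have "\<dots> = (0, 0)" using x[OF z] by (intro \<psi>_edge convex_le) auto
      finally show ?thesis .
    next
      assume "2 * hi z - 1 / 2 = 2 * lo z"
      then show ?thesis using \<psi>_edge(2)[of "clamp01 (2 * lo z)"] by simp
    qed
    with 1 show ?thesis by simp
  qed
qed

lemma Sub_contractible:
  "homotopic_with Sub.respects_B Sub.T (Sub3_based Y base) Sub.B (\<lambda>_. {base})"
proof -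
  let ?s = "\<lambda>\<phi> l. Sub.B (fst l, \<phi> (min (fst (snd l)) (snd (snd l))) (max (fst (snd l)) (snd (snd l))))"
  have B01: "Sub.B (x, (0, 0)) = Sub.B (x, (0, 1))" if "x \<in> topspace X" for x
    using Sub_B_base[OF that] by simp
  have r1: "Sub.respects_B (?s (\<phi>1 t))" if t: "t \<in> {0..1}" for t
  proof (rule respects_Sub_B_sorted[OF \<phi>_range(1)])
    fix x and y :: real assume x: "x \<in> topspace X" and "0 \<le> y" "y \<le> 1"
    then show "Sub.B (x, \<phi>1 t 0 y) = Sub.B (x, \<phi>1 t y y)" "Sub.B (x, \<phi>1 t y 1) = Sub.B (x, \<phi>1 t y y)"
      using \<phi>1_edges[of t y] t B01[OF x] by auto
  next
    fix x assume "x \<in> topspace X"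
    moreover have "- (3 * t / 8) / (1 - 3 * t / 4) \<le> 0"
      using t by (intro divide_nonpos_nonneg) auto
    ultimately show "Sub.B (x, \<phi>1 t 0 0) = {base}"
      using \<phi>1_edges(1)[of t 0] t Sub_B_base(1) by simp
  qed
  have r2: "Sub.respects_B (?s (\<phi>2 t))" if t: "t \<in> {0..1}" for t
  proof (rule respects_Sub_B_sorted[OF \<phi>_range(2)])
    fix x and y :: real assume x: "x \<in> topspace X" and "0 \<le> y" "y \<le> 1"
    then show "Sub.B (x, \<phi>2 t 0 y) = Sub.B (x, \<phi>2 t y y)" "Sub.B (x, \<phi>2 t y 1) = Sub.B (x, \<phi>2 t y y)"
      using \<phi>2_edges[of t y] t B01[OF x] by auto
  next
    fix x assume "x \<in> topspace X"
    then show "Sub.B (x, \<phi>2 t 0 0) = {base}"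
      using \<phi>2_edges(1)[of t 0] t Sub_B_base(1) by simp
  qed
  have r3: "Sub.respects_B (?s (\<phi>3 t))" if t: "t \<in> {0..1}" for t
  proof (rule respects_Sub_B_sorted[OF \<phi>_range(3)])
    fix x and y :: real assume x: "x \<in> topspace X" and "0 \<le> y" "y \<le> 1"
    then show "Sub.B (x, \<phi>3 t 0 y) = Sub.B (x, \<phi>3 t y y)" "Sub.B (x, \<phi>3 t y 1) = Sub.B (x, \<phi>3 t y y)"
      using \<phi>3_edges[of t y] t by auto
  next
    fix x assume "x \<in> topspace X"
    then show "Sub.B (x, \<phi>3 t 0 0) = {base}"
      using \<phi>3_edges(1)[of t 0] t Sub_B_base(1) \<psi>_edge(2)[of 0] by simp
  qed
  have h1: "homotopic_with Sub.respects_B Sub.T (Sub3_based Y base) (?s (\<lambda>a b. (a, b))) (?s (\<phi>2 0))"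
  proof (rule Sub.homotopic_with_sorted[OF continuous_\<phi>1 r1, where f = "\<lambda>x a b. Sub.B (x, a, b)" and g = "\<lambda>x a b. Sub.B (x, \<phi>2 0 a b)"])
    show "Sub.B (x, \<phi>1 0 a b) = Sub.B (x, a, b)"
      if x: "x \<in> topspace X" and ab: "0 \<le> a" "a \<le> b" "b \<le> 1" for x a b
    proof (cases "depth a b \<le> 0")
      \<comment> \<open>At time 0 the collar has shrunk to the edges \<open>b = 1\<close> and
        \<open>a = b\<close>, whose points \<open>\<phi>1\<close> names by the edge
        \<open>a = 0\<close>.\<close>
      case True
      then have "depth a b = 0" "b = 1 \<or> b = a" using ab by (auto simp: depth_def min_def split: if_splits)
      moreover have "clamp01 a = a" using ab by (simp add: clamp01_def)
      ultimately show ?thesis using Sub_B_edge[OF x, of b a] by (simp add: \<phi>1_def)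
    next
      case False
      then show ?thesis using ab by (simp add: \<phi>1_def clamp01_def)
    qed
  qed (simp_all add: \<phi>1_1)
  have h2: "homotopic_with Sub.respects_B Sub.T (Sub3_based Y base) (?s (\<phi>2 0)) (?s (\<phi>2 1))"
    by (rule Sub.homotopic_with_sorted[OF continuous_\<phi>2 r2, where f = "\<lambda>x a b. Sub.B (x, \<phi>2 0 a b)"
          and g = "\<lambda>x a b. Sub.B (x, \<phi>2 1 a b)"]) simp_all
  have h3: "homotopic_with Sub.respects_B Sub.T (Sub3_based Y base) (?s (\<phi>2 1)) (\<lambda>_. {base})"
  proof (rule Sub.homotopic_with_sorted[OF continuous_\<phi>3 r3, where f = "\<lambda>x a b. Sub.B (x, \<phi>2 1 a b)" and g = "\<lambda>x a b. {base}"])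
    show "Sub.B (x, \<phi>3 0 a b) = Sub.B (x, \<phi>2 1 a b)"
      if x: "x \<in> topspace X" and ab: "0 \<le> a" "a \<le> b" "b \<le> 1" for x a b
      using \<phi>3_0[OF ab] B01[OF x] by auto
    show "Sub.B (x, \<phi>3 1 a b) = {base}" if "x \<in> topspace X" for x a b
      using Sub_B_base(1)[OF that] by (simp add: \<phi>3_1)
  qed simp
  show ?thesis
    using homotopic_with_trans[OF Sub.homotopic_with_B_sorted homotopic_with_trans[OF h1 homotopic_with_trans[OF h2 h3]]] .
qed

theorem Sub3_based_homotopy_equivalent_reduced_SP2:
  "Sub3_based Y base homotopy_equivalent_space reduced_SP2 Y base"
proof -
  obtain k where k: "homotopic_with (\<lambda>f. f ` (\<lambda>(a, b). {base, a, b}) ` A \<subseteq> (\<lambda>(a, b). {base, a, b}) ` A)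
      (Sub3_based Y base) (Sub3_based Y base) id k" "k ` (\<lambda>(a, b). {base, a, b}) ` A \<subseteq> {{base}}"
    using Sub.contracting_homotopy_if_contractible[OF Sub_contractible] by (elim exE conjE) (rule that)
  obtain l where l: "homotopic_with (\<lambda>f. f ` (\<lambda>(a, b). collapse_class ((\<lambda>y. sp2_class y base) ` topspace Y) (sp2_class a b)) ` A
        \<subseteq> (\<lambda>(a, b). collapse_class ((\<lambda>y. sp2_class y base) ` topspace Y) (sp2_class a b)) ` A)
      (reduced_SP2 Y base) (reduced_SP2 Y base) id l"
      "l ` (\<lambda>(a, b). collapse_class ((\<lambda>y. sp2_class y base) ` topspace Y) (sp2_class a b)) ` A \<subseteq> {SP.B (p, 0, 0)}"
    using SP.contracting_homotopy_if_contractible[OF SP_contractible] by (elim exE conjE) (rule that)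
  show ?thesis
  proof (rule homotopy_equivalent_space_same_collapse[OF Sub.quotient_q SP.quotient_q Sub.A_subset _ _ k l]; intro ballI impI)
    fix z z' assume z: "z \<in> topspace (prod_topology Y Y)" "z' \<in> topspace (prod_topology Y Y)"
    obtain a b where ab: "z = (a, b)" "a \<in> topspace Y" "b \<in> topspace Y" using z(1) by auto
    obtain a' b' where ab': "z' = (a', b')" "a' \<in> topspace Y" "b' \<in> topspace Y" using z(2) by auto
    show "(case z of (a, b) \<Rightarrow> collapse_class ((\<lambda>y. sp2_class y base) ` topspace Y) (sp2_class a b)) =
        (case z' of (a, b) \<Rightarrow> collapse_class ((\<lambda>y. sp2_class y base) ` topspace Y) (sp2_class a b)) \<or> z \<in> A \<and> z' \<in> A"
      if eq: "(case z of (a, b) \<Rightarrow> {base, a, b}) = (case z' of (a, b) \<Rightarrow> {base, a, b})"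
      using Sub.q_eqD[OF ab(2,3) ab'(2,3) eq[unfolded ab(1) ab'(1)]] sp2_class_commute[of a b]
      unfolding ab(1) ab'(1) by auto
    show "(case z of (a, b) \<Rightarrow> {base, a, b}) = (case z' of (a, b) \<Rightarrow> {base, a, b}) \<or> z \<in> A \<and> z' \<in> A"
      if eq: "(case z of (a, b) \<Rightarrow> collapse_class ((\<lambda>y. sp2_class y base) ` topspace Y) (sp2_class a b)) =
        (case z' of (a, b) \<Rightarrow> collapse_class ((\<lambda>y. sp2_class y base) ` topspace Y) (sp2_class a b))"
      using SP.q_eqD[OF ab(2,3) ab'(2,3) eq[unfolded ab(1) ab'(1)]]
      unfolding ab(1) ab'(1) by auto
  qed
qed

end

section \<open>Simplicial complexes are equiconnected\<close>

lemma continuous_map_realI: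
  assumes "\<And>t e. \<lbrakk>t \<in> topspace T; 0 < e\<rbrakk> \<Longrightarrow> \<exists>U. openin T U \<and> t \<in> U \<and> (\<forall>u\<in>U. \<bar>f u - f t\<bar> < (e::real))"
  shows "continuous_map T euclideanreal f"
proof -
  have "openin T {t \<in> topspace T. f t \<in> W}" if W: "open W" for W
  proof (subst openin_subopen, intro ballI)
    fix t assume t: "t \<in> {t \<in> topspace T. f t \<in> W}"
    then obtain e where e: "0 < e" "\<And>y. \<bar>y - f t\<bar> < e \<Longrightarrow> y \<in> W"
      using W by (auto simp: open_dist dist_real_def)
    obtain U where U: "openin T U" "t \<in> U" "\<forall>u\<in>U. \<bar>f u - f t\<bar> < e"
      using assms[of t e] t e(1) by blast
    then have "U \<subseteq> {t \<in> topspace T. f t \<in> W}"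
      using e(2) openin_subset[OF U(1)] by auto
    with U show "\<exists>V. openin T V \<and> t \<in> V \<and> V \<subseteq> {t \<in> topspace T. f t \<in> W}" by blast
  qed
  then show ?thesis by (simp add: continuous_map)
qed

lemma continuous_map_coordinatewise:
  fixes f :: "'t \<Rightarrow> 'v \<Rightarrow> real"
  assumes "\<And>v. continuous_map T euclideanreal (\<lambda>t. f t v)"
  shows "continuous_map T euclidean f"
proof -
  have "continuous_map T (product_topology (\<lambda>_. euclidean) UNIV) f"
    by (rule continuous_map_coordinatewise_then_product) (use assms in auto)
  then show ?thesis by (simp add: euclidean_product_topology)
qed

lemma continuous_map_coordinate:
  fixes f :: "'t \<Rightarrow> 'v \<Rightarrow> real"
  assumes "continuous_map T euclidean f"
  shows "continuous_map T euclideanreal (\<lambda>t. f t v)"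
proof (rule continuous_map_comp[OF _ assms])
  show "continuous_map euclidean euclideanreal (\<lambda>x. x v)"
    by (simp add: continuous_on_product_coordinates)
qed

definition supp :: "('v \<Rightarrow> real) \<Rightarrow> 'v set" where
  "supp x = {v. x v \<noteq> 0}"

lemma sum_supp_superset:
  fixes x :: "'v \<Rightarrow> real"
  assumes "finite F" "supp x \<subseteq> F" "\<And>v. v \<notin> supp x \<Longrightarrow> f v = 0"
  shows "sum f (supp x) = sum f F"
  using assms by (intro sum.mono_neutral_left) auto

lemma closed_simplexI:
  assumes "finite s" "supp x \<subseteq> s" "\<And>v. 0 \<le> x v" "sum x (supp x) = 1"
  shows "x \<in> closed_simplex s"
  using sum_supp_superset[OF assms(1,2), of x] assms by (auto simp: closed_simplex_def supp_def)

lemma closed_simplexD: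
  assumes "x \<in> closed_simplex s" "finite s"
  shows "supp x \<subseteq> s" "\<And>v. 0 \<le> x v" "sum x (supp x) = 1"
proof -
  show s: "supp x \<subseteq> s" using assms(1) by (auto simp: closed_simplex_def supp_def)
  show "\<And>v. 0 \<le> x v" using assms(1) by (simp add: closed_simplex_def)
  show "sum x (supp x) = 1"
    using sum_supp_superset[OF assms(2) s, of x] assms(1) by (auto simp: closed_simplex_def supp_def)
qed

lemma closed_closed_simplex: "closed (closed_simplex s)"
proof -
  have "closed_simplex s = (\<Inter>v. {x. 0 \<le> x v}) \<inter> (\<Inter>v\<in>- s. {x. x v = 0}) \<inter> {x. sum x s = 1}"
    by (auto simp: closed_simplex_def)
  moreover have "closed {x :: 'a \<Rightarrow> real. 0 \<le> x v}" "closed {x :: 'a \<Rightarrow> real. x v = 0}" for v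
    by (intro closed_Collect_le closed_Collect_eq continuous_on_const continuous_on_product_coordinates)+
  moreover have "closed {x :: 'a \<Rightarrow> real. sum x s = 1}"
    by (intro closed_Collect_eq continuous_on_sum continuous_on_const continuous_on_product_coordinates)
  ultimately show ?thesis by (auto intro!: closed_Int closed_INT)
qed

section \<open>The weak topology and pointwise convergence\<close>

locale realized_complex =
  fixes K :: "'v set set"
  assumes K: "abstract_simplicial_complex K"
begin

abbreviation X :: "('v \<Rightarrow> real) topology" where
  "X \<equiv> geometric_realization K"

abbreviation S :: "('v \<Rightarrow> real) set" where
  "S \<equiv> topspace X"

text \<open>The coarser topology of pointwise convergence of barycentric coordinates: continuity
  into it can be checked coordinatewise, even for maps out of products of \<open>X\<close>.\<close>

abbreviation Xm :: "('v \<Rightarrow> real) topology" where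
  "Xm \<equiv> top_of_set S"

lemma finite_simplex: "s \<in> K \<Longrightarrow> finite s"
  using K by (simp add: abstract_simplicial_complex_def)

lemma SD:
  assumes "x \<in> S"
  shows "finite (supp x)" "supp x \<noteq> {}" "supp x \<in> K" "\<And>v. 0 \<le> x v" "sum x (supp x) = 1" "\<And>v. x v \<le> 1"
    "x \<in> closed_simplex (supp x)"
proof -
  obtain s where s: "s \<in> K" "x \<in> closed_simplex s" using assms by (auto simp: topspace_geometric_realization)
  note x = closed_simplexD[OF s(2) finite_simplex[OF s(1)]]
  show fin: "finite (supp x)" using finite_subset[OF x(1) finite_simplex[OF s(1)]] .
  show sum: "sum x (supp x) = 1" and nonneg: "\<And>v. 0 \<le> x v" by (fact x)+
  then show ne: "supp x \<noteq> {}" by auto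
  have "\<forall>s\<in>K. \<forall>t. t \<noteq> {} \<and> t \<subseteq> s \<longrightarrow> t \<in> K"
    using K unfolding abstract_simplicial_complex_def by (rule conjunct2)
  then show "supp x \<in> K" using s(1) x(1) ne by blast
  show "x v \<le> 1" for v
  proof (cases "v \<in> supp x")
    case True
    then show ?thesis using member_le_sum[where f = x, OF True nonneg fin] sum by simp
  qed (simp add: supp_def)
  show "x \<in> closed_simplex (supp x)" by (rule closed_simplexI[OF fin order_refl nonneg sum])
qed

lemma closed_simplex_subset: "s \<in> K \<Longrightarrow> closed_simplex s \<subseteq> S"
  by (auto simp: topspace_geometric_realization)

lemma continuous_map_X_Xm: "continuous_map X Xm (\<lambda>x. x)"
proof -
  have "openin X {x \<in> S. x \<in> U}" if "open U" for U
    unfolding openin_geometric_realization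
  proof (intro conjI ballI)
    show "{x \<in> S. x \<in> U} \<subseteq> \<Union> (closed_simplex ` K)" by (auto simp: topspace_geometric_realization)
    fix s assume "s \<in> K"
    then have "{x \<in> S. x \<in> U} \<inter> closed_simplex s = closed_simplex s \<inter> U" using closed_simplex_subset by blast
    then show "openin (top_of_set (closed_simplex s)) ({x \<in> S. x \<in> U} \<inter> closed_simplex s)"
      using that by (simp add: openin_open_Int)
  qed
  then have "continuous_map X euclidean (\<lambda>x. x)" by (simp add: continuous_map)
  then show ?thesis by (simp add: continuous_map_in_subtopology)
qed

lemma continuous_Xm_coordinate:
  assumes "continuous_map T Xm f"
  shows "continuous_map T euclideanreal (\<lambda>t. f t v)"
  by (rule continuous_map_coordinate) (use assms in \<open>simp add: continuous_map_in_subtopology\<close>)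

text \<open>Pointwise convergence of nonnegative coordinates of total mass \<open>1\<close> is convergence in mean, so sums
  dominated by them may be interchanged with limits.\<close>

lemma continuous_map_dominated_sum:
  assumes x: "continuous_map T Xm x"
    and \<phi>: "\<And>v. continuous_map T euclideanreal (\<phi> v)"
    and dom: "\<And>t v. t \<in> topspace T \<Longrightarrow> \<bar>\<phi> v t\<bar> \<le> x t v"
  shows "continuous_map T euclideanreal (\<lambda>t. \<Sum>v\<in>supp (x t). \<phi> v t)"
proof (rule continuous_map_realI)
  fix t and e :: real assume t: "t \<in> topspace T" and e: "0 < e"
  have xS: "x u \<in> S" if "u \<in> topspace T" for u
    using continuous_map_image_subset_topspace[OF x] that by auto
  let ?F = "supp (x t)"
  have F: "finite ?F" using SD(1)[OF xS[OF t]] .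
  have c1: "continuous_map T euclideanreal (\<lambda>u. \<Sum>v\<in>?F. \<phi> v u)"
    by (rule continuous_map_sum[OF F]) (rule \<phi>)
  have c2: "continuous_map T euclideanreal (\<lambda>u. \<Sum>v\<in>?F. x u v)"
    by (rule continuous_map_sum[OF F]) (rule continuous_Xm_coordinate[OF x])
  let ?s = "\<Sum>v\<in>?F. \<phi> v t"
  \<comment> \<open>Near \<open>t\<close> the finitely many coordinates in \<open>?F\<close> carry
    mass above \<open>1 - e / 2\<close>; by domination the remaining terms, whose indices are not
    controlled, then sum to less than \<open>e / 2\<close>.\<close>
  let ?U = "{u \<in> topspace T. (\<Sum>v\<in>?F. \<phi> v u) \<in> {?s - e / 2 <..< ?s + e / 2}} \<inter>
    {u \<in> topspace T. (\<Sum>v\<in>?F. x u v) \<in> {1 - e / 2 <..}}"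
  have "openin T ?U"
    by (intro openin_Int openin_continuous_map_preimage[OF c1] openin_continuous_map_preimage[OF c2]) auto
  moreover have "t \<in> ?U" using t e SD(5)[OF xS[OF t]] by simp
  moreover have "\<bar>(\<Sum>v\<in>supp (x u). \<phi> v u) - ?s\<bar> < e" if u: "u \<in> ?U" for u
  proof -
    have uT: "u \<in> topspace T" using u by simp
    note xu = SD[OF xS[OF uT]]
    let ?G = "supp (x u) \<union> ?F"
    have \<phi>0: "\<phi> v u = 0" if "v \<notin> supp (x u)" for v
      using dom[OF uT, of v] that by (simp add: supp_def)
    have split: "sum f (supp (x u)) = sum f ?F + sum f (supp (x u) - ?F)" if "\<And>v. v \<notin> supp (x u) \<Longrightarrow> f v = 0"
      for f :: "'v \<Rightarrow> real"
    proof -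
      have "sum f (supp (x u)) = sum f ?G"
        using that F xu(1) by (intro sum_supp_superset) auto
      also have "\<dots> = sum f ?F + sum f (?G - ?F)"
        using F xu(1) by (intro sum.subset_diff[of ?F ?G f, THEN trans] add.commute) auto
      also have "?G - ?F = supp (x u) - ?F" by blast
      finally show ?thesis .
    qed
    have "\<bar>\<Sum>v\<in>supp (x u) - ?F. \<phi> v u\<bar> \<le> (\<Sum>v\<in>supp (x u) - ?F. x u v)"
      by (rule order_trans[OF sum_abs sum_mono]) (rule dom[OF uT])
    also have "\<dots> = 1 - (\<Sum>v\<in>?F. x u v)"
      using split[of "x u"] xu(5) by (simp add: supp_def)
    also have "\<dots> < e / 2" using u by simp
    finally have "\<bar>\<Sum>v\<in>supp (x u) - ?F. \<phi> v u\<bar> < e / 2" .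
    moreover have "(\<Sum>v\<in>?F. \<phi> v u) \<in> {?s - e / 2<..<?s + e / 2}" using u by blast
    then have "\<bar>(\<Sum>v\<in>?F. \<phi> v u) - ?s\<bar> < e / 2" unfolding greaterThanLessThan_iff by linarith
    ultimately show ?thesis using split[of "\<lambda>v. \<phi> v u", OF \<phi>0] by linarith
  qed
  ultimately show "\<exists>U. openin T U \<and> t \<in> U \<and> (\<forall>u\<in>U. \<bar>(\<Sum>v\<in>supp (x u). \<phi> v u) - ?s\<bar> < e)" by blast
qed

lemma closed_simplex_diff:
  assumes "openin X W" "s \<in> K"
  shows "closed (closed_simplex s - W)"
proof -
  have "openin (top_of_set (closed_simplex s)) (W \<inter> closed_simplex s)"
    using assms by (simp add: openin_geometric_realization)
  then have "closedin (top_of_set (closed_simplex s)) (closed_simplex s - (W \<inter> closed_simplex s))"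
    by (metis closedin_diff closedin_topspace topspace_euclidean_subtopology)
  moreover have "closed_simplex s - (W \<inter> closed_simplex s) = closed_simplex s - W" by blast
  ultimately show ?thesis
    using closedin_closed_trans[OF _ closed_closed_simplex] by metis
qed

text \<open>Locally only finitely many simplices occur, and in a finite union of closed simplices
  the complement of a weakly open set is closed for pointwise convergence.\<close>

lemma continuous_map_locally_finite:
  assumes f: "continuous_map T Xm f"
    and fin: "\<And>t. t \<in> topspace T \<Longrightarrow> \<exists>U F. openin T U \<and> t \<in> U \<and> finite F \<and> (\<forall>u\<in>U. supp (f u) \<subseteq> F)"
  shows "continuous_map T X f"
proof -
  have fS: "f u \<in> S" if "u \<in> topspace T" for u
    using continuous_map_image_subset_topspace[OF f] that by auto
  have fE: "continuous_map T euclidean f" using f by (simp add: continuous_map_in_subtopology)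
  have "openin T {t \<in> topspace T. f t \<in> W}" if W: "openin X W" for W
  proof (subst openin_subopen, intro ballI)
    fix t assume t: "t \<in> {t \<in> topspace T. f t \<in> W}"
    then obtain U F where U: "openin T U" "t \<in> U" "finite F" "\<forall>u\<in>U. supp (f u) \<subseteq> F"
      using fin[of t] by blast
    let ?C = "\<Union>s\<in>{s \<in> K. s \<subseteq> F}. closed_simplex s - W"
    have "finite {s \<in> K. s \<subseteq> F}"
      using U(3) by (intro finite_subset[of "{s \<in> K. s \<subseteq> F}" "Pow F"]) auto
    then have "closed ?C"
      using closed_simplex_diff[OF W] by (intro closed_UN) auto
    then have "openin T {t \<in> topspace T. f t \<in> - ?C}"
      using openin_continuous_map_preimage[OF fE] by (simp only: open_openin[symmetric] open_Compl)
    then have "openin T (U \<inter> {t \<in> topspace T. f t \<in> - ?C})" using U(1) by (rule openin_Int[rotated])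
    moreover have "t \<in> U \<inter> {t \<in> topspace T. f t \<in> - ?C}" using t U(2) by auto
    moreover have "U \<inter> {t \<in> topspace T. f t \<in> - ?C} \<subseteq> {t \<in> topspace T. f t \<in> W}"
    proof
      fix u assume u: "u \<in> U \<inter> {t \<in> topspace T. f t \<in> - ?C}"
      then have "supp (f u) \<in> {s \<in> K. s \<subseteq> F}" "f u \<in> closed_simplex (supp (f u))"
        using SD(3,7)[OF fS[of u]] U(4) by auto
      then have "f u \<in> W" using u by blast
      then show "u \<in> {t \<in> topspace T. f t \<in> W}" using u by simp
    qed
    ultimately show "\<exists>V. openin T V \<and> t \<in> V \<and> V \<subseteq> {t \<in> topspace T. f t \<in> W}" by blast
  qed
  then show ?thesis using fS by (auto simp: continuous_map_def)
qed

text \<open>Since the interval is compact, the tube lemma allows continuity on its product with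
  \<open>X\<close> to be tested on each simplex. This is the route for a homotopy that starts at the
  identity, where supports need not be locally finite.\<close>

lemma continuous_map_homotopy_simplexwise:
  assumes H: "\<And>s. s \<in> K \<Longrightarrow> continuous_map (prod_topology (top_of_set (closed_simplex s)) unit_interval)
      (top_of_set (closed_simplex s)) (\<lambda>z. H (snd z, fst z))"
  shows "continuous_map (prod_topology unit_interval X) X H"
proof -
  have HS: "H (t, x) \<in> closed_simplex s" if "s \<in> K" "x \<in> closed_simplex s" "t \<in> {0..1}" for s t x
    using continuous_map_image_subset_topspace[OF H[OF that(1)]] that(2,3)
    by (auto simp: image_subset_iff)
  have "openin (prod_topology unit_interval X) {z \<in> topspace (prod_topology unit_interval X). H z \<in> W}"
    (is "openin ?P ?pre") if W: "openin X W" for W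
  proof (subst openin_subopen, intro ballI)
    fix z assume z: "z \<in> ?pre"
    obtain t x where tx: "z = (t, x)" "t \<in> {0..1}" "x \<in> S" "H (t, x) \<in> W" using z by auto
    have traces: "openin (prod_topology (top_of_set (closed_simplex s)) unit_interval)
        {z \<in> topspace (prod_topology (top_of_set (closed_simplex s)) unit_interval). H (snd z, fst z) \<in> W \<inter> closed_simplex s}"
      if "s \<in> K" for s
      using W that by (intro openin_continuous_map_preimage[OF H[OF that]]) (simp add: openin_geometric_realization)
    let ?\<sigma> = "supp x"
    note s = SD(3,7)[OF tx(3)]
    have "continuous_map unit_interval (prod_topology (top_of_set (closed_simplex ?\<sigma>)) unit_interval) (\<lambda>t. (x, t))"
      using s(2) by (intro continuous_map_pairedI continuous_map_id[unfolded id_def]) simp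
    from openin_continuous_map_preimage[OF this traces[OF s(1)]]
    have "openin unit_interval {t \<in> {0..1}. H (t, x) \<in> W}"
      using s(2) HS[OF s] by (auto simp: conj_commute elim!: back_subst[of "openin unit_interval"])
    then obtain e where e: "0 < e" "\<And>u. \<lbrakk>u \<in> {0..1}; \<bar>u - t\<bar> < e\<rbrakk> \<Longrightarrow> H (u, x) \<in> W"
      using tx(2,4) unfolding openin_euclidean_subtopology_iff by (force simp: dist_real_def)
    \<comment> \<open>One compact interval around \<open>t\<close>, found at \<open>x\<close> alone,
      serves all simplices; so the points that \<open>H\<close> sends into \<open>W\<close> at all
      times in \<open>J\<close> have an open trace on each of them.\<close>
    define J where "J = {0..1} \<inter> {t - e / 2..t + e / 2}"
    let ?J = "{u \<in> {0..1}. u \<in> {t - e / 2<..<t + e / 2}}"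
    have J: "compactin unit_interval J" "J \<subseteq> {0..1}"
      by (auto simp: J_def compactin_subtopology)
    have xJ: "H (u, x) \<in> W" if "u \<in> J" for u
      using that e by (intro e(2)) (auto simp: J_def)
    define N where "N = {y \<in> S. \<forall>u\<in>J. H (u, y) \<in> W}"
    have "openin X N"
      unfolding openin_geometric_realization
    proof (intro conjI ballI)
      show "N \<subseteq> \<Union> (closed_simplex ` K)" by (auto simp: N_def topspace_geometric_realization)
      fix s assume sK: "s \<in> K"
      show "openin (top_of_set (closed_simplex s)) (N \<inter> closed_simplex s)"
      proof (subst openin_subopen, intro ballI)
        fix y assume y: "y \<in> N \<inter> closed_simplex s"
        have "{y} \<times> J \<subseteq> {z \<in> topspace (prod_topology (top_of_set (closed_simplex s)) unit_interval).
            H (snd z, fst z) \<in> W \<inter> closed_simplex s}"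
          using y J(2) HS[OF sK] by (auto simp: N_def)
        then obtain U V where UV: "openin (top_of_set (closed_simplex s)) U" "y \<in> U" "J \<subseteq> V"
          "U \<times> V \<subseteq> {z \<in> topspace (prod_topology (top_of_set (closed_simplex s)) unit_interval).
            H (snd z, fst z) \<in> W \<inter> closed_simplex s}"
          using tube_lemma_right[OF traces[OF sK] J(1), of y] y by auto
        have "U \<subseteq> N \<inter> closed_simplex s"
        proof
          fix y' assume y': "y' \<in> U"
          then have "y' \<in> closed_simplex s" using openin_subset[OF UV(1)] by auto
          moreover have "H (u, y') \<in> W" if "u \<in> J" for u
          proof -
            have "(y', u) \<in> U \<times> V" using y' that UV(3) by auto
            then show ?thesis using UV(4) by fastforce
          qed
          ultimately show "y' \<in> N \<inter> closed_simplex s"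
            using closed_simplex_subset[OF sK] by (auto simp: N_def)
        qed
        then show "\<exists>U. openin (top_of_set (closed_simplex s)) U \<and> y \<in> U \<and> U \<subseteq> N \<inter> closed_simplex s"
          using UV(1,2) by blast
      qed
    qed
    moreover have "openin unit_interval ?J"
      unfolding openin_open by (rule exI[of _ "{t - e / 2<..<t + e / 2}"]) auto
    ultimately have "openin ?P (?J \<times> N)" by (simp add: openin_prod_Times_iff)
    moreover have "z \<in> ?J \<times> N" using tx e(1) xJ by (auto simp: N_def)
    moreover have "?J \<times> N \<subseteq> ?pre" by (auto simp: N_def J_def)
    ultimately show "\<exists>V. openin ?P V \<and> z \<in> V \<and> V \<subseteq> ?pre" by blast
  qed
  moreover have "H z \<in> S" if "z \<in> topspace (prod_topology unit_interval X)" for z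
  proof -
    obtain t x where "z = (t, x)" "t \<in> {0..1}" "x \<in> S" using \<open>z \<in> _\<close> by auto
    then show ?thesis
      using HS[OF SD(3,7)] closed_simplex_subset[OF SD(3)] by blast
  qed
  ultimately show ?thesis by (auto simp: continuous_map_def)
qed

end

lemma continuous_map_Min:
  assumes "finite F" "F \<noteq> {}" "\<And>v. v \<in> F \<Longrightarrow> continuous_map Z euclideanreal (f v)"
  shows "continuous_map Z euclideanreal (\<lambda>z. Min ((\<lambda>v. f v z) ` F))"
  using assms
proof (induction F rule: finite_ne_induct)
  case (insert v F)
  then show ?case by (simp add: continuous_map_real_min)
qed simp

section \<open>Squeezing a neighbourhood of the basepoint of the complex\<close>

locale pointed_realized_complex = realized_complex +
  fixes p :: "'a \<Rightarrow> real"
  assumes p_in_S: "p \<in> S"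
begin

lemmas p = SD[OF p_in_S]

lemma p_pos: "v \<in> supp p \<Longrightarrow> 0 < p v"
  using p(4)[of v] by (simp add: supp_def)

text \<open>The largest \<open>c\<close> with \<open>x \<ge> c \<cdot> p\<close>; it is \<open>1\<close> at \<open>p\<close> only, and positive on the open star of \<open>p\<close>.\<close>

definition share :: "('a \<Rightarrow> real) \<Rightarrow> real" where
  "share x = Min ((\<lambda>v. x v / p v) ` supp p)"

lemma le_share_iff: "c \<le> share x \<longleftrightarrow> (\<forall>v\<in>supp p. c * p v \<le> x v)"
  using p(1,2) p_pos by (simp add: share_def le_divide_eq)

lemma share_le: "v \<in> supp p \<Longrightarrow> share x * p v \<le> x v"
  using le_share_iff[of "share x" x] by simp

lemma share_nonneg: "x \<in> S \<Longrightarrow> 0 \<le> share x"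
  using SD(4) by (simp add: le_share_iff)

lemma sum_le_1: "x \<in> S \<Longrightarrow> finite F \<Longrightarrow> sum x F \<le> 1"
proof -
  assume x: "x \<in> S" and F: "finite F"
  have "sum x F \<le> sum x (supp x \<union> F)"
    using SD(1,4)[OF x] F by (intro sum_mono2) auto
  also have "\<dots> = sum x (supp x)"
    using SD(1)[OF x] F by (intro sum_supp_superset[symmetric]) (auto simp: supp_def)
  finally show ?thesis using SD(5)[OF x] by simp
qed

lemma share_le_1: "x \<in> S \<Longrightarrow> share x \<le> 1"
proof -
  assume x: "x \<in> S"
  have "(\<Sum>v\<in>supp p. share x * p v) \<le> sum x (supp p)"
    by (rule sum_mono) (rule share_le)
  then have "share x * sum p (supp p) \<le> sum x (supp p)" by (simp add: sum_distrib_left)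
  then show ?thesis using sum_le_1[OF x p(1)] p(5) by simp
qed

text \<open>Share 1 means that \<open>x\<close> dominates \<open>p\<close> in every coordinate, and
  both have total mass 1.\<close>

lemma share_eq_1_iff:
  assumes x: "x \<in> S"
  shows "share x = 1 \<longleftrightarrow> x = p"
proof
  assume "x = p"
  then have "1 \<le> share x" by (simp add: le_share_iff)
  then show "share x = 1" using share_le_1[OF x] by simp
next
  assume "share x = 1"
  then have le: "p v \<le> x v" for v
    using share_le[of v x] SD(4)[OF x, of v] by (cases "v \<in> supp p") (auto simp: supp_def)
  have "x v - p v \<le> 0" for v
  proof -
    have "sum p (supp p) \<le> sum p (insert v (supp p))" using p(1,4) by (intro sum_mono2) auto
    then have "(\<Sum>u\<in>insert v (supp p). x u - p u) \<le> 0"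
      using sum_le_1[OF x, of "insert v (supp p)"] p(1,5) by (simp add: sum_subtractf)
    moreover have "x v - p v \<le> (\<Sum>u\<in>insert v (supp p). x u - p u)"
      using p(1) le by (intro member_le_sum) auto
    ultimately show ?thesis by linarith
  qed
  with le show "x = p" by (intro ext) (simp add: order_antisym)
qed

lemma continuous_share:
  assumes "continuous_map T Xm f"
  shows "continuous_map T euclideanreal (\<lambda>t. share (f t))"
  unfolding share_def
  by (intro continuous_map_Min p continuous_map_real_divide continuous_map_canonical_const
      continuous_Xm_coordinate[OF assms]) (use p_pos in force)

text \<open>Truncating the coordinates below half the mean \<open>\<Sum> x\<^sub>v\<^sup>2\<close> leaves, locally, finitely many of them.\<close>

definition cut :: "('a \<Rightarrow> real) \<Rightarrow> real" where
  "cut x = (\<Sum>v\<in>supp x. (x v)\<^sup>2) / 2"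

definition mass :: "('a \<Rightarrow> real) \<Rightarrow> real" where
  "mass x = (\<Sum>v\<in>supp x. max 0 (x v - cut x))"

definition trunc :: "('a \<Rightarrow> real) \<Rightarrow> 'a \<Rightarrow> real" where
  "trunc x v = max 0 (x v - cut x) / mass x"

text \<open>The value is \<open>p\<close> from share 1/2 on, and a positive share forces the support
  of \<open>p\<close> into that of \<open>x\<close>; so \<open>g x\<close> stays in the closed
  simplex carrying \<open>x\<close>.\<close>

definition g :: "('a \<Rightarrow> real) \<Rightarrow> 'a \<Rightarrow> real" where
  "g x v = min 1 (2 * share x) * p v + (1 - min 1 (2 * share x)) * trunc x v"

lemma cut_pos: "x \<in> S \<Longrightarrow> 0 < cut x"
proof -
  assume x: "x \<in> S"
  have "0 < (\<Sum>v\<in>supp x. (x v)\<^sup>2)"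
    using SD(1,2)[OF x] by (intro sum_pos) (auto simp: supp_def)
  then show ?thesis by (simp add: cut_def)
qed

text \<open>The mean of the coordinates, weighted by themselves, is twice \<open>cut x\<close>; so
  some coordinate exceeds \<open>cut x\<close>.\<close>

lemma mass_pos: "x \<in> S \<Longrightarrow> 0 < mass x"
proof -
  assume x: "x \<in> S"
  note x' = SD[OF x]
  have "\<exists>v\<in>supp x. cut x < x v"
  proof (rule ccontr)
    assume "\<not> ?thesis"
    then have "(\<Sum>v\<in>supp x. (x v)\<^sup>2) \<le> (\<Sum>v\<in>supp x. cut x * x v)"
      unfolding power2_eq_square using x'(4) by (intro sum_mono mult_right_mono) (auto simp: not_less)
    also have "\<dots> = cut x" using x'(5) by (simp flip: sum_distrib_left)
    finally show False using cut_pos[OF x] by (simp add: cut_def)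
  qed
  then obtain v where "v \<in> supp x" "cut x < x v" by blast
  then have "0 < max 0 (x v - cut x)" "max 0 (x v - cut x) \<le> mass x"
    unfolding mass_def using x'(1) member_le_sum[of v "supp x" "\<lambda>v. max 0 (x v - cut x)"] by auto
  then show ?thesis by linarith
qed

lemma trunc:
  assumes x: "x \<in> S"
  shows "0 \<le> trunc x v" "v \<notin> supp x \<Longrightarrow> trunc x v = 0" "sum (trunc x) (supp x) = 1"
proof -
  show "0 \<le> trunc x v" using mass_pos[OF x] by (simp add: trunc_def)
  show "v \<notin> supp x \<Longrightarrow> trunc x v = 0" using cut_pos[OF x] by (simp add: trunc_def supp_def)
  have "sum (trunc x) (supp x) = mass x / mass x"
    by (simp add: trunc_def mass_def flip: sum_divide_distrib)
  then show "sum (trunc x) (supp x) = 1" using mass_pos[OF x] by simp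
qed

lemma convex_combination_in_closed_simplex:
  assumes "finite s" "x \<in> closed_simplex s" "y \<in> closed_simplex s" "0 \<le> t" "t \<le> 1"
  shows "(\<lambda>v. (1 - t) * x v + t * y v) \<in> closed_simplex s"
  using assms by (simp add: closed_simplex_def sum.distrib flip: sum_distrib_left)

lemma trunc_in_closed_simplex: "x \<in> S \<Longrightarrow> trunc x \<in> closed_simplex (supp x)"
  using trunc by (simp add: closed_simplex_def)

lemma closed_simplex_mono:
  assumes "x \<in> closed_simplex s" "s \<subseteq> t" "finite t"
  shows "x \<in> closed_simplex t"
  using closed_simplexD[OF assms(1) finite_subset[OF assms(2,3)]] assms(2,3) by (intro closed_simplexI) auto

lemma g_in_closed_simplex:
  assumes x: "x \<in> S"
  shows "g x \<in> closed_simplex (supp x)"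
proof (cases "share x = 0")
  case True
  then show ?thesis using trunc_in_closed_simplex[OF x] by (simp add: g_def[abs_def])
next
  case False
  then have pos: "0 < share x" using share_nonneg[OF x] by simp
  have "supp p \<subseteq> supp x"
  proof
    fix v assume v: "v \<in> supp p"
    have "0 < share x * p v" using pos p_pos[OF v] by simp
    then show "v \<in> supp x" using share_le[OF v, of x] by (simp add: supp_def)
  qed
  then have "p \<in> closed_simplex (supp x)"
    by (rule closed_simplex_mono[OF p(7) _ SD(1)[OF x]])
  from convex_combination_in_closed_simplex[OF SD(1)[OF x] trunc_in_closed_simplex[OF x] this, of "min 1 (2 * share x)"]
  show ?thesis using pos by (simp add: g_def[abs_def] add.commute)
qed

lemma g_in_S: "x \<in> S \<Longrightarrow> g x \<in> S"
  using g_in_closed_simplex closed_simplex_subset[OF SD(3)] by blast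

lemma g_eq_p: "1 / 2 \<le> share x \<Longrightarrow> g x = p"
  by (simp add: g_def[abs_def] min_def)

lemma continuous_cut: "continuous_map Xm euclideanreal cut"
proof -
  have coord: "continuous_map Xm euclideanreal (\<lambda>x. x v)" for v
    by (rule continuous_Xm_coordinate[OF continuous_map_id[unfolded id_def]])
  have "continuous_map Xm euclideanreal (\<lambda>x. \<Sum>v\<in>supp x. (x v)\<^sup>2)"
  proof (rule continuous_map_dominated_sum[OF continuous_map_id[unfolded id_def]])
    show "continuous_map Xm euclideanreal (\<lambda>x. (x v)\<^sup>2)" for v
      by (rule continuous_map_real_pow[OF coord])
    show "\<bar>(x v)\<^sup>2\<bar> \<le> x v" if "x \<in> topspace Xm" for x v
    proof -
      have "x \<in> S" using that by simp
      from SD(4)[OF this, of v] SD(6)[OF this, of v] show ?thesis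
        using mult_left_le[of "x v" "x v"] by (simp add: power2_eq_square)
    qed
  qed
  then show ?thesis
    unfolding cut_def[abs_def] by (intro continuous_map_real_divide continuous_map_canonical_const) simp_all
qed

lemma continuous_trunc: "continuous_map Xm euclideanreal (\<lambda>x. trunc x v)"
proof -
  have coord: "continuous_map Xm euclideanreal (\<lambda>x. x v)" for v
    by (rule continuous_Xm_coordinate[OF continuous_map_id[unfolded id_def]])
  have pos: "continuous_map Xm euclideanreal (\<lambda>x. max 0 (x v - cut x))" for v
    by (intro continuous_map_real_max continuous_map_diff continuous_map_canonical_const coord continuous_cut)
  have sum: "continuous_map Xm euclideanreal (\<lambda>x. \<Sum>v\<in>supp x. max 0 (x v - cut x))"
  proof (rule continuous_map_dominated_sum[OF continuous_map_id[unfolded id_def] pos])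
    show "\<bar>max 0 (x v - cut x)\<bar> \<le> x v" if "x \<in> topspace Xm" for x v
    proof -
      have "x \<in> S" using that by simp
      from SD(4)[OF this, of v] cut_pos[OF this] show ?thesis by simp
    qed
  qed
  show ?thesis
    unfolding trunc_def mass_def
  proof (rule continuous_map_real_divide[OF pos sum])
    show "(\<Sum>v\<in>supp x. max 0 (x v - cut x)) \<noteq> 0" if "x \<in> topspace Xm" for x
      using mass_pos[of x] that by (simp add: mass_def)
  qed
qed

text \<open>Truncation makes supports locally finite, which improves pointwise continuity to the
  weak topology: the passage back from \<open>Xm\<close> to \<open>X\<close>.\<close>

lemma continuous_g: "continuous_map Xm X g"
proof (rule continuous_map_locally_finite)
  have "continuous_map Xm euclidean g"
    unfolding g_def[abs_def]
    by (intro continuous_map_coordinatewise continuous_map_add continuous_map_diff continuous_map_real_mult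
        continuous_map_real_min continuous_map_canonical_const continuous_trunc
        continuous_share[OF continuous_map_id[unfolded id_def]])
  then show "continuous_map Xm Xm g"
    using g_in_S by (auto simp: continuous_map_in_subtopology)
next
  fix x assume "x \<in> topspace Xm"
  then have x: "x \<in> S" by simp
  let ?F = "supp x"
  \<comment> \<open>At \<open>x\<close> the mass on \<open>?F\<close> is 1 and the cut is positive.
    On \<open>?U\<close> the mass outside \<open>?F\<close> is below the cut, so every coordinate
    there is truncated away.\<close>
  let ?U = "{y \<in> topspace Xm. cut y + sum y ?F \<in> {1<..}}"
  have coord: "continuous_map Xm euclideanreal (\<lambda>x. x v)" for v
    by (rule continuous_Xm_coordinate[OF continuous_map_id[unfolded id_def]])
  have "continuous_map Xm euclideanreal (\<lambda>y. cut y + sum y ?F)"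
    by (intro continuous_map_add continuous_cut continuous_map_sum SD(1)[OF x] coord)
  then have "openin Xm ?U" by (rule openin_continuous_map_preimage) simp
  moreover have "x \<in> ?U" using x cut_pos[OF x] SD(5)[OF x] by simp
  moreover have "supp (g y) \<subseteq> supp x \<union> supp p" if y: "y \<in> ?U" for y
  proof
    fix v assume v: "v \<in> supp (g y)"
    have yS: "y \<in> S" using y by simp
    show "v \<in> supp x \<union> supp p"
    proof (rule ccontr)
      assume nv: "v \<notin> supp x \<union> supp p"
      then have "y v + sum y ?F = sum y (insert v ?F)" using SD(1)[OF x] by simp
      also have "\<dots> \<le> 1" using SD(1)[OF x] by (intro sum_le_1[OF yS]) simp
      finally have "y v \<le> cut y" using y by simp
      then have "g y v = 0" using nv by (simp add: g_def trunc_def supp_def)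
      then show False using v by (simp add: supp_def)
    qed
  qed
  ultimately show "\<exists>U F. openin Xm U \<and> x \<in> U \<and> finite F \<and> (\<forall>y\<in>U. supp (g y) \<subseteq> F)"
    using SD(1)[OF x] p(1) by (intro exI[of _ ?U] exI[of _ "supp x \<union> supp p"]) blast
qed

definition r :: "real \<times> ('a \<Rightarrow> real) \<Rightarrow> 'a \<Rightarrow> real" where
  "r z v = (1 - fst z) * snd z v + fst z * g (snd z) v"

text \<open>The segment from \<open>x\<close> to \<open>g x\<close> lies in the closed simplex
  carrying \<open>x\<close>, so continuity can be checked simplex by simplex.\<close>

lemma continuous_r: "continuous_map (prod_topology unit_interval X) X r"
proof (rule continuous_map_homotopy_simplexwise)
  fix s assume s: "s \<in> K"
  let ?P = "prod_topology (top_of_set (closed_simplex s)) unit_interval"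
  have "closed_simplex s \<subseteq> S" by (rule closed_simplex_subset[OF s])
  then have "continuous_map (top_of_set (closed_simplex s)) Xm (\<lambda>x. x)"
    by (auto simp: continuous_map_in_subtopology)
  then have x: "continuous_map ?P Xm fst"
    using continuous_map_comp[OF _ continuous_map_fst] by blast
  have t: "continuous_map ?P euclideanreal snd"
    by (rule continuous_map_unit_interval_real[OF continuous_map_snd])
  have gx: "continuous_map ?P Xm (\<lambda>z. g (fst z))"
    by (intro continuous_map_comp[OF continuous_map_X_Xm] continuous_map_comp[OF continuous_g] x)
  have "continuous_map ?P euclidean (\<lambda>z. r (snd z, fst z))"
    unfolding r_def[abs_def] fst_conv snd_conv
    by (intro continuous_map_coordinatewise continuous_map_add continuous_map_diff continuous_map_real_mult
        continuous_map_canonical_const t continuous_Xm_coordinate[OF x] continuous_Xm_coordinate[OF gx])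
  moreover have "r (t, x) \<in> closed_simplex s" if "x \<in> closed_simplex s" "t \<in> {0..1}" for t x
  proof -
    have "x \<in> S" using that(1) closed_simplex_subset[OF s] by blast
    then have "g x \<in> closed_simplex s"
      using closed_simplex_mono[OF g_in_closed_simplex closed_simplexD(1)[OF that(1) finite_simplex[OF s]] finite_simplex[OF s]]
      by blast
    then show ?thesis
      unfolding r_def[abs_def] fst_conv snd_conv
      using that(2) by (intro convex_combination_in_closed_simplex[OF finite_simplex[OF s] that(1)]) auto
  qed
  ultimately show "continuous_map ?P (top_of_set (closed_simplex s)) (\<lambda>z. r (snd z, fst z))"
    by (auto simp: continuous_map_in_subtopology)
qed

section \<open>Moving close points together\<close>

definition overlap :: "('a \<Rightarrow> real) \<Rightarrow> ('a \<Rightarrow> real) \<Rightarrow> real" where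
  "overlap x y = (\<Sum>v\<in>supp x. min (x v) (y v))"

lemma overlap_commute:
  assumes "x \<in> S" "y \<in> S"
  shows "overlap x y = overlap y x"
proof -
  have "overlap x y = (\<Sum>v\<in>supp x \<union> supp y. min (x v) (y v))"
    unfolding overlap_def using SD(1,4)[OF assms(1)] SD(1,4)[OF assms(2)]
    by (intro sum_supp_superset) (auto simp: supp_def min_def)
  also have "\<dots> = overlap y x"
    unfolding overlap_def using SD(1,4)[OF assms(1)] SD(1,4)[OF assms(2)]
    by (subst min.commute, intro sum_supp_superset[symmetric]) (auto simp: supp_def min_def)
  finally show ?thesis .
qed

lemma overlap_self: "x \<in> S \<Longrightarrow> overlap x x = 1"
  using SD(5) by (simp add: overlap_def)

text \<open>\<open>1 - overlap x y\<close> is the total mass lost in passing from \<open>x\<close>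
  to the minimum, half the l1 distance; no single coordinate loses more.\<close>

lemma overlap_le:
  assumes x: "x \<in> S" and y: "y \<in> S"
  shows "x v - min (x v) (y v) \<le> 1 - overlap x y"
proof (cases "v \<in> supp x")
  case True
  have "1 - overlap x y = (\<Sum>v\<in>supp x. x v - min (x v) (y v))"
    using SD(5)[OF x] by (simp add: overlap_def sum_subtractf)
  moreover have "x v - min (x v) (y v) \<le> (\<Sum>v\<in>supp x. x v - min (x v) (y v))"
    using True SD(1)[OF x] by (intro member_le_sum[where f = "\<lambda>v. x v - min (x v) (y v)"]) auto
  ultimately show ?thesis by simp
next
  case False
  have "overlap x y \<le> sum x (supp x)" unfolding overlap_def by (rule sum_mono) simp
  moreover have "x v - min (x v) (y v) = 0" using False SD(4)[OF y, of v] by (simp add: supp_def)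
  ultimately show ?thesis using SD(5)[OF x] by simp
qed

lemma overlap_le_1: "x \<in> S \<Longrightarrow> y \<in> S \<Longrightarrow> overlap x y \<le> 1"
  using overlap_le[of x y undefined] min.cobounded1[of "x undefined" "y undefined"] by linarith

lemma continuous_overlap:
  assumes f: "continuous_map T Xm f" and h: "continuous_map T Xm h"
  shows "continuous_map T euclideanreal (\<lambda>t. overlap (f t) (h t))"
  unfolding overlap_def
proof (rule continuous_map_dominated_sum[OF f])
  show "continuous_map T euclideanreal (\<lambda>t. min (f t v) (h t v))" for v
    by (intro continuous_map_real_min continuous_Xm_coordinate[OF f] continuous_Xm_coordinate[OF h])
  show "\<bar>min (f t v) (h t v)\<bar> \<le> f t v" if "t \<in> topspace T" for t v
  proof -
    have "f t \<in> S" "h t \<in> S"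
      using continuous_map_image_subset_topspace[OF f] continuous_map_image_subset_topspace[OF h] that by auto
    then show ?thesis using SD(4)[of "f t" v] SD(4)[of "h t" v] by simp
  qed
qed

text \<open>Points move only if \<open>1 - overlap x y < 2 * \<epsilon>\<close>. The bound 1/4 then
  keeps the overlap above 1/2, and the twelfth bounds the loss in a coordinate \<open>v\<close> of
  the support of \<open>p\<close> by \<open>p v / 6\<close>, the gap between the shares 2/3 and
  1/2.\<close>

definition \<epsilon> :: real where
  "\<epsilon> = min (1 / 4) (Min (p ` supp p) / 12)"

lemma \<epsilon>: "0 < \<epsilon>" "\<epsilon> \<le> 1 / 4" "v \<in> supp p \<Longrightarrow> 12 * \<epsilon> \<le> p v"
proof -
  show "0 < \<epsilon>" using p(1,2) p_pos by (simp add: \<epsilon>_def)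
  show "\<epsilon> \<le> 1 / 4" by (simp add: \<epsilon>_def)
  assume "v \<in> supp p"
  then have "Min (p ` supp p) \<le> p v" using p(1) by simp
  moreover have "\<epsilon> \<le> Min (p ` supp p) / 12" unfolding \<epsilon>_def by simp
  ultimately show "12 * \<epsilon> \<le> p v" by linarith
qed

definition d :: "('a \<Rightarrow> real) \<times> ('a \<Rightarrow> real) \<Rightarrow> real" where
  "d z = (1 - overlap (fst z) (snd z)) / \<epsilon>"

text \<open>The factor \<open>clamp01 (2 - d (snd z))\<close> is 1 up to distance 1 and 0 from
  distance 2 on. Where it is positive the overlap exceeds 1/2, so \<open>max\<close> does not alter
  it there and only keeps the quotient defined elsewhere.\<close>

definition approach :: "real \<times> ('a \<Rightarrow> real) \<times> ('a \<Rightarrow> real) \<Rightarrow> 'a \<Rightarrow> real" where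
  "approach z v = (1 - fst z * clamp01 (2 - d (snd z))) * fst (snd z) v +
    fst z * clamp01 (2 - d (snd z)) * (min (fst (snd z) v) (snd (snd z) v) / max (1 / 2) (overlap (fst (snd z)) (snd (snd z))))"

lemma close_overlap:
  assumes "clamp01 (2 - d (x, y)) \<noteq> 0"
  shows "1 - overlap x y < 2 * \<epsilon>"
proof -
  have "d (x, y) < 2" using assms clamp01_eq(1)[of "2 - d (x, y)"] by linarith
  then show ?thesis using \<epsilon>(1) by (simp add: d_def divide_less_eq mult.commute)
qed

lemma approach_in_closed_simplex:
  assumes u: "0 \<le> u" "u \<le> 1" and xy: "x \<in> S" "y \<in> S"
  shows "approach (u, x, y) \<in> closed_simplex (supp x)"
proof (cases "clamp01 (2 - d (x, y)) = 0")
  case True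
  then show ?thesis using SD(7)[OF xy(1)] by (simp add: approach_def[abs_def])
next
  case False
  then have "1 / 2 < overlap x y" using close_overlap[OF False] \<epsilon>(2) by linarith
  moreover from this have "(\<lambda>v. min (x v) (y v) / overlap x y) \<in> closed_simplex (supp x)"
    using SD(4)[OF xy(1)] SD(4)[OF xy(2)]
    by (auto simp: closed_simplex_def supp_def overlap_def simp flip: sum_divide_distrib)
  ultimately show ?thesis
    using convex_combination_in_closed_simplex[OF SD(1)[OF xy(1)] SD(7)[OF xy(1)], of "\<lambda>v. min (x v) (y v) / overlap x y"
        "u * clamp01 (2 - d (x, y))"] u
    by (simp add: approach_def[abs_def] mult_le_one)
qed

lemma approach_in_S: "0 \<le> u \<Longrightarrow> u \<le> 1 \<Longrightarrow> x \<in> S \<Longrightarrow> y \<in> S \<Longrightarrow> approach (u, x, y) \<in> S"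
  using approach_in_closed_simplex closed_simplex_subset[OF SD(3)] by blast

lemma approach_0: "approach (0, x, y) = x"
  by (simp add: approach_def[abs_def])

lemma approach_self:
  assumes "x \<in> S"
  shows "approach (u, x, x) = x"
  using overlap_self[OF assms] by (simp add: approach_def[abs_def] algebra_simps)

lemma d_commute: "x \<in> S \<Longrightarrow> y \<in> S \<Longrightarrow> d (x, y) = d (y, x)"
  using overlap_commute by (simp add: d_def)

lemma approach_1:
  assumes "x \<in> S" "y \<in> S" "d (x, y) \<le> 1"
  shows "approach (1, x, y) = approach (1, y, x)"
  using assms d_commute[OF assms(1,2)] overlap_commute[OF assms(1,2)]
  by (simp add: approach_def[abs_def] min.commute)

text \<open>Dividing by an overlap of at most 1 does not decrease the minimum, so each coordinate
  stays above it, and it falls short of \<open>x v\<close> by less than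
  \<open>2 * \<epsilon>\<close>. Hence \<open>g\<close> sends the whole motion to
  \<open>p\<close>.\<close>

lemma share_approach:
  assumes u: "0 \<le> u" "u \<le> 1" and xy: "x \<in> S" "y \<in> S" and share: "2 / 3 \<le> share x"
  shows "1 / 2 \<le> share (approach (u, x, y))"
  unfolding le_share_iff
proof
  fix v assume v: "v \<in> supp p"
  have xv: "2 / 3 * p v \<le> x v" using share v by (simp add: le_share_iff)
  show "1 / 2 * p v \<le> approach (u, x, y) v"
  proof (cases "clamp01 (2 - d (x, y)) = 0")
    case True
    then show ?thesis using xv p_pos[OF v] by (simp add: approach_def)
  next
    case False
    let ?m = "min (x v) (y v)" and ?M = "max (1 / 2) (overlap x y)" and ?t = "u * clamp01 (2 - d (x, y))"
    have t: "0 \<le> ?t" "?t \<le> 1" using u by (simp_all add: mult_le_one)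
    have "0 \<le> ?m" using SD(4)[OF xy(1)] SD(4)[OF xy(2)] by simp
    moreover have "?M \<le> 1" using overlap_le_1[OF xy] by simp
    ultimately have "?m * ?M \<le> ?m * 1" by (rule mult_left_mono[rotated])
    moreover have "0 < ?M" by (simp add: less_max_iff_disj)
    ultimately have "?m \<le> ?m / ?M" by (simp only: pos_le_divide_eq mult_1_right)
    then have "?t * ?m \<le> ?t * (?m / ?M)" by (rule mult_left_mono[OF _ t(1)])
    moreover have "(1 - ?t) * ?m \<le> (1 - ?t) * x v" using t by (intro mult_left_mono) auto
    ultimately have "(1 - ?t) * ?m + ?t * ?m \<le> approach (u, x, y) v"
      unfolding approach_def fst_conv snd_conv by linarith
    then have "?m \<le> approach (u, x, y) v" by (simp add: algebra_simps)
    then show ?thesis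
      using xv overlap_le[OF xy, of v] close_overlap[OF False] \<epsilon>(3)[OF v] by linarith
  qed
qed

definition m :: "real \<times> ('a \<Rightarrow> real) \<times> ('a \<Rightarrow> real) \<Rightarrow> 'a \<Rightarrow> real" where
  "m z = g (approach z)"

text \<open>\<open>approach\<close> is only shown continuous for pointwise convergence, and
  \<open>g\<close> restores the weak topology; therefore the motion starts at \<open>g x\<close>,
  which is \<open>r (1, x)\<close>, and not at \<open>x\<close>.\<close>

lemma continuous_m: "continuous_map (prod_topology unit_interval (prod_topology X X)) X m"
proof -
  let ?P = "prod_topology unit_interval (prod_topology X X)"
  have x: "continuous_map ?P Xm (\<lambda>z. fst (snd z))" and y: "continuous_map ?P Xm (\<lambda>z. snd (snd z))"
    by (intro continuous_map_comp[OF continuous_map_X_Xm] continuous_map_projections)+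
  have u: "continuous_map ?P euclideanreal (\<lambda>z. fst z)"
    by (intro continuous_map_unit_interval_real continuous_map_projections)
  have o: "continuous_map ?P euclideanreal (\<lambda>z. overlap (fst (snd z)) (snd (snd z)))"
    by (rule continuous_overlap[OF x y])
  have d: "continuous_map ?P euclideanreal (\<lambda>z. d (snd z))"
    unfolding d_def using \<epsilon>(1) by (intro continuous_map_real_divide continuous_map_diff continuous_map_canonical_const o) simp
  have "continuous_map ?P euclidean approach"
    unfolding approach_def[abs_def]
    by (intro continuous_map_coordinatewise continuous_map_add continuous_map_diff continuous_map_real_mult
        continuous_map_real_divide continuous_map_clamp01 continuous_map_real_min continuous_map_real_max
        continuous_map_canonical_const u d o continuous_Xm_coordinate[OF x] continuous_Xm_coordinate[OF y]) auto
  moreover have "approach z \<in> S" if "z \<in> topspace ?P" for z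
    using that approach_in_S by auto
  ultimately have "continuous_map ?P Xm approach" by (auto simp: continuous_map_in_subtopology)
  from continuous_map_comp[OF continuous_g this] show ?thesis by (simp add: m_def[abs_def])
qed

lemma equiconnected: "equiconnected X p r (\<lambda>x. 1 - share x) d m"
proof
  show "p \<in> S" by (fact p_in_S)
  show "continuous_map (prod_topology unit_interval X) X r" by (rule continuous_r)
  show "continuous_map (prod_topology unit_interval (prod_topology X X)) X m" by (rule continuous_m)
  show "r (0, x) = x" if "x \<in> S" for x by (simp add: r_def[abs_def])
  have "g p = p" using share_eq_1_iff[OF p_in_S] by (intro g_eq_p) simp
  then show "r (t, p) = p" if "t \<in> {0..1}" for t by (simp add: r_def[abs_def] algebra_simps)
  show "continuous_map X euclideanreal (\<lambda>x. 1 - share x)"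
    by (intro continuous_map_diff continuous_map_canonical_const continuous_share continuous_map_X_Xm)
  show "0 \<le> 1 - share x" "1 - share x = 0 \<longleftrightarrow> x = p" if "x \<in> S" for x
    using share_le_1[OF that] share_eq_1_iff[OF that] by auto
  have r_1: "r (1, x) = g x" for x by (simp add: r_def[abs_def])
  show "r (1, x) = p" if "x \<in> S" "1 - share x \<le> 1 / 3" for x
    unfolding r_1 using that by (intro g_eq_p) simp
  show "continuous_map (prod_topology X X) euclideanreal d"
    unfolding d_def[abs_def] using \<epsilon>(1)
    by (intro continuous_map_real_divide continuous_map_diff continuous_map_canonical_const continuous_overlap
        continuous_map_comp[OF continuous_map_X_Xm] continuous_map_projections) simp
  show "d (x, x) = 0" if "x \<in> S" for x using overlap_self[OF that] by (simp add: d_def)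
  show "d (x, y) = d (y, x)" if "x \<in> S" "y \<in> S" for x y by (rule d_commute[OF that])
  show "m (0, x, y) = r (1, x)" if "x \<in> S" "y \<in> S" for x y by (simp add: m_def approach_0 r_1)
  show "m (u, x, x) = r (1, x)" if "u \<in> {0..1}" "x \<in> S" for u x by (simp add: m_def approach_self[OF that(2)] r_1)
  show "m (1, x, y) = m (1, y, x)" if "x \<in> S" "y \<in> S" "d (x, y) \<le> 1" for x y
    by (simp add: m_def approach_1[OF that])
  show "m (u, x, y) = p" if "u \<in> {0..1}" "x \<in> S" "y \<in> S" "1 - share x \<le> 1 / 3" for u x y
    unfolding m_def using that by (intro g_eq_p share_approach) auto
qed

end

theorem proposition5p6:
  fixes K :: "'v set set" and X :: "('v \<Rightarrow> real) topology" and p :: "'v \<Rightarrow> real"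
    and x0 :: "(('v \<Rightarrow> real) \<times> real) set"
  assumes "abstract_simplicial_complex K"
    and "X = geometric_realization K"
    and "path_connected_space X"
    and "p \<in> topspace X"
    and "x0 = suspension_base X p"
  shows "Sub3_based (suspension X p) x0 homotopy_equivalent_space reduced_SP2 (suspension X p) x0"
proof -
  interpret pointed_realized_complex K p
    using assms(1,2,4) by unfold_locales simp_all
  show ?thesis
    unfolding assms(2,5) by (rule equiconnected.Sub3_based_homotopy_equivalent_reduced_SP2[OF equiconnected])
qed

end
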